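(* Let $\ell\ge4$ be even, let $\Phi$ be a root system of type $C_\ell$, and let $\omega\in W_{A_\circ}=\{1,\omega_\ell\}$. Then for every $q\in\mathbb{Z}_{>0}$, $$\chi_{\Phi,q}(\omega) = \begin{cases} (q-1)(q-3)\cdots(q-(2\ell-1)) & \text{if }\omega=1\text{ and }q\notin2\mathbb{Z},\\ (q-2)(q-4)\cdots(q-2(\ell-1))\,(q-\ell) & \text{if }\omega=1\text{ and }q\in2\mathbb{Z},\\ 0 & \text{if }\omega=\omega_\ell\text{ and }\gcd\{4,q\}=1,\\ \prod_{i=1}^{\ell/2}(q-(4i-2)) = (q-2)(q-6)\cdots(q-2(\ell-1)) & \text{if }\omega=\omega_\ell\text{ and }\gcd\{4,q\}=2,\\ (q-\ell)\prod_{i=1}^{\ell/2-1}(q-4i) = (q-4)(q-8)\cdots(q-2(\ell-2))\,(q-\ell) & \text{if }\omega=\omega_\ell\text{ and }\gcd\{4,q\}=4.\end{cases}$$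
   Context: Let $\Phi = \{\pm e_i\pm e_k\ (i<k),\ \pm 2e_k\}\subset E=\mathbb{R}^\ell$, with simple roots $\alpha_i=e_i-e_{i+1}$ ($1\le i\le\ell-1$), $\alpha_\ell=2e_\ell$, Weyl group $W$ and the standard inner product $(\cdot,\cdot)$. The coweight lattice is $Z := \{x\in E : (\alpha,x)\in\mathbb{Z}\ \forall\alpha\in\Phi\}$. For $q\in\mathbb{Z}_{>0}$, $M(\Phi;q) := \{x+qZ\in Z/qZ : (\beta,x)\not\equiv0\pmod q\ \forall\beta\in\Phi\}$; $W$ acts on it via $w(x+qZ)=w(x)+qZ$, and $\chi_{\Phi,q}(w) := \#\{t\in M(\Phi;q) : w(t)=t\}$. Let $\tilde\alpha=\sum_{i=1}^\ell n_i\alpha_i$ be the highest root, $n_0:=1$, $J:=\{i\in\{0,\dots,\ell\}: n_i=1\}$ (here $J=\{0,\ell\}$). Let $w_0$ be the longest element of $W$; for $j\in J\setminus\{0\}$ let $w_j$ be the longest element of the subgroup generated by the simple reflections $s_{\alpha_i}$, $i\ne j$; put $\omega_j := w_jw_0$ and $\omega_0:=1$. Let $A_\circ=\{x\in E : (\alpha_i,x)>0\ \forall i,\ (\tilde\alpha,x)<1\}$; $W_{A_\circ}$ is the subgroup of $w\in W$ mapping the image of $A_\circ$ in $E/Z$ to itself, and $W_{A_\circ}=\{\omega_j : j\in J\}$. *)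

theory Defs
  imports "HOL-Analysis.Analysis" "HOL-Algebra.Algebra" "HOL-Library.Set_Algebras"
begin

text \<open>
  The Euclidean space is \<open>real ^ 'n\<close> with rank \<open>CARD('n)\<close>. The linear order on \<open>'n\<close> only serves to
  number the standard basis vectors by 1, ..., \<open>CARD('n)\<close>, see \<open>bij_betw_ee\<close>. Indices outside
  this range give junk values and never occur below.
\<close>

definition ee :: "nat \<Rightarrow> real ^ 'n::{finite,linorder}" where
  "ee k = axis (sorted_list_of_set (UNIV :: 'n set) ! (k - 1)) 1"

lemma bij_betw_ee: "bij_betw (ee :: nat \<Rightarrow> real ^ 'n::{finite,linorder}) {1..CARD('n)} Basis"
proof -
  let ?xs = "sorted_list_of_set (UNIV :: 'n set)"
  have "bij_betw (\<lambda>k. k - 1) {1..CARD('n)} {..<CARD('n)}"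
    by (rule bij_betw_byWitness[where f' = Suc]) auto
  moreover have "bij_betw (\<lambda>k. ?xs ! k) {..<CARD('n)} UNIV"
    by (rule bij_betw_nth) auto
  moreover have "bij_betw (\<lambda>i. axis i (1::real) :: (real, 'n) vec) UNIV Basis"
    by (auto simp: bij_betw_def inj_on_def axis_eq_axis Basis_vec_def)
  ultimately have "bij_betw ((\<lambda>i. axis i (1::real) :: (real, 'n) vec) \<circ> ((\<lambda>k. ?xs ! k) \<circ> (\<lambda>k. k - 1)))
      {1..CARD('n)} Basis"
    by (blast intro: bij_betw_trans)
  then show ?thesis
    by (simp add: ee_def[abs_def] o_def)
qed

definition roots :: "(real ^ 'n::{finite,linorder}) set" where
  "roots =
     {a *\<^sub>R ee i + b *\<^sub>R ee k | a b i k.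
        a \<in> {1, -1} \<and> b \<in> {1, -1} \<and> 1 \<le> i \<and> i < k \<and> k \<le> CARD('n)} \<union>
     {a *\<^sub>R (2 *\<^sub>R ee k) | a k. a \<in> {1, -1} \<and> 1 \<le> k \<and> k \<le> CARD('n)}"

definition simple_root :: "nat \<Rightarrow> real ^ 'n::{finite,linorder}" where
  "simple_root i = (if i < CARD('n) then ee i - ee (i + 1) else 2 *\<^sub>R ee i)"

text \<open>
  The highest root is the root from which every root is obtained by subtracting a nonnegative
  integral combination of simple roots.
\<close>

definition highest_root :: "real ^ 'n::{finite,linorder}" where
  "highest_root = (THE \<alpha>. \<alpha> \<in> roots \<and>
     (\<forall>\<beta>\<in>roots. \<exists>c :: nat \<Rightarrow> nat. \<alpha> - \<beta> = (\<Sum>i = 1..CARD('n). real (c i) *\<^sub>R simple_root i)))"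

definition reflection :: "'a::real_inner \<Rightarrow> 'a \<Rightarrow> 'a" where
  "reflection \<alpha> x = x - (2 * (\<alpha> \<bullet> x) / (\<alpha> \<bullet> \<alpha>)) *\<^sub>R \<alpha>"

text \<open>
  The multiplication of \<open>BijGroup UNIV\<close> is composition of maps, so \<open>refl_group S\<close> is the group
  generated by the reflections in the (nonzero) vectors of \<open>S\<close>.
\<close>

definition refl_group :: "'a::real_inner set \<Rightarrow> ('a \<Rightarrow> 'a) set" where
  "refl_group S = generate (BijGroup UNIV) (reflection ` S)"

definition weyl_group :: "(real ^ 'n::{finite,linorder} \<Rightarrow> real ^ 'n::{finite,linorder}) set" where
  "weyl_group = refl_group roots"

text \<open>
  Length and longest element refer to the generating reflections in \<open>S\<close>, here always a set of
  simple roots.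
\<close>

definition refl_length :: "'a::real_inner set \<Rightarrow> ('a \<Rightarrow> 'a) \<Rightarrow> nat" where
  "refl_length S w =
     (LEAST n. \<exists>as. length as = n \<and> set as \<subseteq> S \<and> w = foldr (\<circ>) (map reflection as) id)"

definition longest_element :: "'a::real_inner set \<Rightarrow> ('a \<Rightarrow> 'a)" where
  "longest_element S = (THE w. w \<in> refl_group S \<and>
     (\<forall>v\<in>refl_group S. refl_length S v \<le> refl_length S w))"

definition omega :: "nat \<Rightarrow> real ^ 'n::{finite,linorder} \<Rightarrow> real ^ 'n::{finite,linorder}" where
  "omega j = (if j = 0 then id
     else longest_element (simple_root ` ({1..CARD('n)} - {j})) \<circ>
          longest_element (simple_root ` {1..CARD('n)}))"

definition coweight_lattice :: "(real ^ 'n::{finite,linorder}) set" where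
  "coweight_lattice = {x. \<forall>\<alpha>\<in>roots. \<alpha> \<bullet> x \<in> \<int>}"

text \<open>
  The induced action \<open>w (x + L) = w x + L\<close> on cosets of a lattice \<open>L\<close>, given by the union over all
  representatives of the coset; it does not depend on the representative if \<open>w\<close> maps \<open>L\<close> to
  itself, see \<open>coset_action_eq\<close>.
\<close>

definition coset_action :: "'a::real_vector set \<Rightarrow> ('a \<Rightarrow> 'a) \<Rightarrow> 'a set \<Rightarrow> 'a set" where
  "coset_action L w t = (\<Union>x\<in>t. w x +o L)"

lemma coset_action_eq:
  assumes "linear w" "w ` L \<subseteq> L" "0 \<in> L" "\<And>x y. x \<in> L \<Longrightarrow> y \<in> L \<Longrightarrow> x + y \<in> L"
  shows "coset_action L w (x +o L) = w x +o L"
proof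
  show "coset_action L w (x +o L) \<subseteq> w x +o L"
  proof
    fix y assume "y \<in> coset_action L w (x +o L)"
    then obtain u v where uv: "u \<in> L" "v \<in> L" and y: "y = w (x + u) + v"
      by (auto simp: coset_action_def elt_set_plus_def)
    have "y = w x + (w u + v)"
      using y by (simp add: linear_add[OF assms(1)] add.assoc)
    moreover have "w u + v \<in> L"
      using uv assms(2,4) by blast
    ultimately show "y \<in> w x +o L"
      by (auto simp: elt_set_plus_def)
  qed
  have "x + 0 \<in> x +o L"
    using assms(3) by (auto simp: elt_set_plus_def)
  then show "w x +o L \<subseteq> coset_action L w (x +o L)"
    by (auto simp: coset_action_def)
qed

definition fundamental_alcove :: "(real ^ 'n::{finite,linorder}) set" where
  "fundamental_alcove =
     {x. (\<forall>i\<in>{1..CARD('n)}. simple_root i \<bullet> x > 0) \<and> highest_root \<bullet> x < 1}"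

definition alcove_image :: "(real ^ 'n::{finite,linorder}) set set" where
  "alcove_image = (\<lambda>x. x +o coweight_lattice) ` fundamental_alcove"

definition alcove_stabilizer :: "(real ^ 'n::{finite,linorder} \<Rightarrow> real ^ 'n::{finite,linorder}) set" where
  "alcove_stabilizer =
     {w \<in> weyl_group. coset_action coweight_lattice w ` alcove_image = alcove_image}"

definition scaled_lattice :: "nat \<Rightarrow> (real ^ 'n::{finite,linorder}) set" where
  "scaled_lattice q = (\<lambda>z. real q *\<^sub>R z) ` coweight_lattice"

definition regular_cosets :: "nat \<Rightarrow> (real ^ 'n::{finite,linorder}) set set" where
  "regular_cosets q = {x +o scaled_lattice q | x. x \<in> coweight_lattice \<and>
     (\<forall>\<beta>\<in>roots. \<not> (\<exists>m::int. \<beta> \<bullet> x = real_of_int (int q * m)))}"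

definition chi :: "nat \<Rightarrow> (real ^ 'n::{finite,linorder} \<Rightarrow> real ^ 'n::{finite,linorder}) \<Rightarrow> nat" where
  "chi q w = card {t \<in> regular_cosets q. coset_action (scaled_lattice q) w t = t}"

end

theory Submission
  imports Defs
begin

text \<open>
Write a coweight as \<open>x = y / 2\<close> with an integer vector \<open>y\<close> whose entries all have the same parity. Two
such vectors give the same coset modulo \<open>q\<close> times the lattice iff they agree modulo \<open>2q\<close>, possibly
after adding \<open>q\<close> to every entry; so each coset has exactly two representatives with entries in
\<open>{0..<2q}\<close>. The coset avoids all roots iff no entry is divisible by \<open>q\<close> and no two entries are equal or
opposite modulo \<open>2q\<close>. Hence \<open>chi q w\<close> is half the number of such vectors \<open>y\<close> for which \<open>w\<close> moves the
coset of \<open>y / 2\<close> to itself (\<open>twice_chi\<close>).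

For the identity these are vectors of pairwise inequivalent elements under \<open>a \<sim> -a\<close>, an equivalence
whose classes on the allowed residues of one parity all have two elements. Choosing the entries one
after the other removes one class of size \<open>d\<close> each time, whence products of the form
\<open>\<Prod>i. N - d i\<close> (\<open>card_pairwise_inequivalent_functions\<close>). The two parities contribute separately: for
odd \<open>q\<close> they agree, while for even \<open>q\<close> the two products share all factors but one, and adding these
two produces the exceptional factor \<open>q - l\<close>.

The element \<open>omega l\<close> is \<open>x \<mapsto> -(x\<^sub>l, ..., x\<^sub>1)\<close>. A regular coset can be fixed by it only if
\<open>y\<^sub>k + y\<^bsub>l+1-k\<^esub> \<equiv> q\<close> modulo \<open>2q\<close> for all \<open>k\<close>: the other possibility, \<open>\<equiv> 0\<close>, is excluded by regularity.
For odd \<open>q\<close> the equal parities make this impossible. For \<open>q = 2p\<close> the first half of \<open>y\<close> determines the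
second, and regularity of \<open>y\<close> says that the entries of the first half are not divisible by \<open>p\<close> and
pairwise neither equal nor opposite modulo \<open>2p\<close>, while they still range over the residues modulo \<open>4p\<close>
(\<open>sign_distinct_fold\<close>). This is the same counting problem with \<open>p\<close> for \<open>q\<close>, half as many entries, and
classes of four elements \<open>\<plusminus>a, \<plusminus>a + 2p\<close>. The set \<open>sign_distinct_functions m r I\<close> covers both
cases, with \<open>(m, r) = (q, 1)\<close> and \<open>(p, 2)\<close>, and is counted in \<open>card_sign_distinct_functions\<close>.

It remains to compute \<open>omega l\<close> and the stabilizer. Elements of the groups in question permute the
basis vectors up to sign. The vector \<open>height_vector = (l, l-1, ..., 1)\<close> separates the images \<open>\<plusminus>e\<^sub>i\<close>, so
an element is determined as soon as the heights of the images of \<open>e\<^sub>1, ..., e\<^sub>l\<close> are known to be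
positive and monotone. This identifies the element that makes all simple roots negative, which is the
longest one by the usual count of inversions (\<open>longest_element_eqI\<close>): \<open>-1\<close> for all simple roots and
the reversal of coordinates without the last one. For the stabilizer, the same principle is applied
to the image of one particular alcove point, a multiple of \<open>height_vector\<close>
(\<open>alcove_stabilizer_subset\<close>).
\<close>

section \<open>Counting vectors of pairwise inequivalent residues\<close>

text \<open>
Once values in pairwise different classes have been chosen on \<open>I\<close>, exactly \<open>d * card I\<close> elements of \<open>A\<close>
are forbidden for the next argument. The product is taken over the integers, so it also gives the
right answer when \<open>A\<close> has too few classes: then a factor vanishes.
\<close>

lemma card_pairwise_inequivalent_functions:
  fixes cl :: "'b \<Rightarrow> 'b set"
  assumes "finite I" and fin: "finite A"
    and cl: "\<And>a. a \<in> A \<Longrightarrow> a \<in> cl a \<and> cl a \<subseteq> A \<and> card (cl a) = d"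
    and eq: "\<And>a b. a \<in> A \<Longrightarrow> b \<in> cl a \<Longrightarrow> cl b = cl a"
  shows "int (card {f \<in> I \<rightarrow>\<^sub>E A. \<forall>i\<in>I. \<forall>j\<in>I. i \<noteq> j \<longrightarrow> f j \<notin> cl (f i)}) =
         (\<Prod>i<card I. int (card A) - int d * int i)"
  using \<open>finite I\<close>
proof (induction I)
  case empty
  then show ?case by simp
next
  case (insert x I)
  let ?F = "\<lambda>I. {f \<in> I \<rightarrow>\<^sub>E A. \<forall>i\<in>I. \<forall>j\<in>I. i \<noteq> j \<longrightarrow> f j \<notin> cl (f i)}"
  let ?R = "\<lambda>f. A - (\<Union>i\<in>I. cl (f i))"
  have sym: "b \<in> cl a \<longleftrightarrow> a \<in> cl b" if "a \<in> A" "b \<in> A" for a b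
    using cl eq that by blast
  have bij: "bij_betw (\<lambda>(f, a). f(x := a)) (SIGMA f:?F I. ?R f) (?F (insert x I))"
  proof (rule bij_betw_byWitness[where f' = "\<lambda>g. (restrict g I, g x)"])
    show "\<forall>p\<in>SIGMA f:?F I. ?R f.
        (\<lambda>g. (restrict g I, g x)) ((\<lambda>(f, a). f(x := a)) p) = p"
    proof
      fix p assume "p \<in> (SIGMA f:?F I. ?R f)"
      then obtain f a where p: "p = (f, a)" and fF: "f \<in> ?F I" by (rule SigmaE)
      from fF have f: "f \<in> I \<rightarrow>\<^sub>E A" unfolding mem_Collect_eq by (rule conjunct1)
      have "restrict (f(x := a)) I = f"
      proof
        fix i show "restrict (f(x := a)) I i = f i"
          using PiE_arb[OF f, of i] insert.hyps unfolding restrict_def by auto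
      qed
      then show "(\<lambda>g. (restrict g I, g x)) ((\<lambda>(f, a). f(x := a)) p) = p" by (simp add: p)
    qed
    show "\<forall>g\<in>?F (insert x I). (\<lambda>(f, a). f(x := a)) (restrict g I, g x) = g"
    proof
      fix g assume "g \<in> ?F (insert x I)"
      then have g: "g \<in> insert x I \<rightarrow>\<^sub>E A" unfolding mem_Collect_eq by (rule conjunct1)
      have "((restrict g I)(x := g x)) i = g i" for i
        using PiE_arb[OF g, of i] by (cases "i = x"; cases "i \<in> I") simp_all
      then show "(\<lambda>(f, a). f(x := a)) (restrict g I, g x) = g" by (simp only: prod.case) (rule ext)
    qed
    show "(\<lambda>(f, a). f(x := a)) ` (SIGMA f:?F I. ?R f) \<subseteq> ?F (insert x I)"
    proof
      fix g assume "g \<in> (\<lambda>(f, a). f(x := a)) ` (SIGMA f:?F I. ?R f)"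
      then obtain p where p: "p \<in> (SIGMA f:?F I. ?R f)" and gp: "g = (\<lambda>(f, a). f(x := a)) p"
        by (rule imageE)
      from p obtain f a where pfa: "p = (f, a)" and fF: "f \<in> ?F I" and aR: "a \<in> ?R f" by (rule SigmaE)
      have g: "g = f(x := a)" using gp pfa by (simp only: prod.case)
      have f: "f \<in> I \<rightarrow>\<^sub>E A" using fF unfolding mem_Collect_eq by (rule conjunct1)
      have neq: "\<forall>i\<in>I. \<forall>j\<in>I. i \<noteq> j \<longrightarrow> f j \<notin> cl (f i)"
        using fF unfolding mem_Collect_eq by (rule conjunct2)
      have a: "a \<in> A" "a \<notin> (\<Union>i\<in>I. cl (f i))" using aR by (rule DiffD1) (use aR in blast)
      have fA: "f i \<in> A" if "i \<in> I" for i using f that by auto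
      have gA: "g \<in> insert x I \<rightarrow>\<^sub>E A"
        unfolding g using a(1) f by (rule PiE_fun_upd)
      have ga: "f i \<notin> cl a" "a \<notin> cl (f i)" if "i \<in> I" for i
        using that a sym[OF a(1) fA[OF that]] by blast+
      have gx: "g x = a" by (simp add: g)
      have gI: "g i = f i" if "i \<in> I" for i using that insert.hyps by (auto simp: g)
      have "g j \<notin> cl (g i)" if ij: "i \<in> insert x I" "j \<in> insert x I" "i \<noteq> j" for i j
      proof (cases "i = x")
        case True
        then show ?thesis using ij ga(1)[of j] gx gI[of j] by auto
      next
        case False
        then have i: "i \<in> I" using ij by simp
        show ?thesis
        proof (cases "j = x")
          case True
          then show ?thesis using i ga(2)[of i] gx gI[of i] by simp
        next
          case False
          then have "j \<in> I" using ij by simp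
          then show ?thesis using i neq ij(3) gI[of i] gI[of j] by simp
        qed
      qed
      then show "g \<in> ?F (insert x I)" using gA by blast
    qed
    show "(\<lambda>g. (restrict g I, g x)) ` ?F (insert x I) \<subseteq> (SIGMA f:?F I. ?R f)"
    proof
      fix p assume "p \<in> (\<lambda>g. (restrict g I, g x)) ` ?F (insert x I)"
      then obtain g where p: "p = (restrict g I, g x)" and gF: "g \<in> ?F (insert x I)" by (rule imageE)
      have g: "g \<in> insert x I \<rightarrow>\<^sub>E A" using gF unfolding mem_Collect_eq by (rule conjunct1)
      have neq: "\<forall>i\<in>insert x I. \<forall>j\<in>insert x I. i \<noteq> j \<longrightarrow> g j \<notin> cl (g i)"
        using gF unfolding mem_Collect_eq by (rule conjunct2)
      have "g x \<notin> cl (g i)" if "i \<in> I" for i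
        using neq[rule_format, of i x] that insert.hyps(2) by (cases "i = x") simp_all
      moreover have "g x \<in> A" "\<And>i. i \<in> I \<Longrightarrow> g i \<in> A" using PiE_mem[OF g] by auto
      ultimately show "p \<in> (SIGMA f:?F I. ?R f)"
        unfolding p using neq by (intro SigmaI CollectI conjI DiffI) auto
    qed
  qed
  have finF: "finite (?F I)"
    using insert.hyps fin by (intro finite_subset[OF _ finite_PiE[of I "\<lambda>_. A"]]) auto
  have R: "int (card (?R f)) = int (card A) - int d * int (card I)" if f: "f \<in> ?F I" for f
  proof -
    have fA: "f i \<in> A" if "i \<in> I" for i using f that by auto
    have disj: "cl (f i) \<inter> cl (f j) = {}" if "i \<in> I" "j \<in> I" "i \<noteq> j" for i j
    proof (rule ccontr)
      assume "cl (f i) \<inter> cl (f j) \<noteq> {}"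
      then have "cl (f i) = cl (f j)" using eq fA that by blast
      then show False using f that cl fA by blast
    qed
    have sub: "(\<Union>i\<in>I. cl (f i)) \<subseteq> A" using cl fA by blast
    have "card (\<Union>i\<in>I. cl (f i)) = (\<Sum>i\<in>I. card (cl (f i)))"
      proof (rule card_UN_disjoint)
      show "\<forall>i\<in>I. finite (cl (f i))" using cl fA fin finite_subset by blast
    qed (use insert.hyps disj in auto)
    also have "\<dots> = d * card I" using cl fA by simp
    finally have "card (\<Union>i\<in>I. cl (f i)) = d * card I" .
    then show ?thesis
      using card_Diff_subset[OF finite_subset[OF sub fin] sub] card_mono[OF fin sub]
      by (simp add: of_nat_diff)
  qed
  have "int (card (?F (insert x I))) = int (card (SIGMA f:?F I. ?R f))"
    using bij_betw_same_card[OF bij] by simp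
  also have "\<dots> = (\<Sum>f\<in>?F I. int (card (?R f)))"
    using finF fin by (subst card_SigmaI) auto
  also have "\<dots> = int (card (?F I)) * (int (card A) - int d * int (card I))"
    using R by simp
  finally show ?case
    using insert by (simp add: prod.lessThan_Suc mult.commute)
qed

lemma card_residue_class:
  fixes n r a :: int
  assumes "n > 0" "r \<ge> 0"
  shows "int (card {b \<in> {0..<n * r}. n dvd b - a}) = r"
proof -
  have "bij_betw (\<lambda>j. a mod n + n * j) {0..<r} {b \<in> {0..<n * r}. n dvd b - a}"
  proof (rule bij_betw_byWitness[where f' = "\<lambda>b. b div n"])
    show "\<forall>j\<in>{0..<r}. (a mod n + n * j) div n = j"
      using assms by simp
    show "\<forall>b\<in>{b \<in> {0..<n * r}. n dvd b - a}. a mod n + n * (b div n) = b"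
    proof
      fix b assume "b \<in> {b \<in> {0..<n * r}. n dvd b - a}"
      then have "b mod n = a mod n" by (simp add: mod_eq_dvd_iff)
      then show "a mod n + n * (b div n) = b" by (metis mod_mult_div_eq)
    qed
    show "(\<lambda>j. a mod n + n * j) ` {0..<r} \<subseteq> {b \<in> {0..<n * r}. n dvd b - a}"
    proof (clarsimp, intro conjI)
      fix j assume j: "0 \<le> j" "j < r"
      show "0 \<le> a mod n + n * j" using j assms by simp
      have "a mod n + n * j < n * (j + 1)" using assms by (simp add: distrib_left)
      also have "\<dots> \<le> n * r" using j assms by (intro mult_left_mono) auto
      finally show "a mod n + n * j < n * r" .
      show "n dvd a mod n + n * j - a" by (simp flip: mod_eq_dvd_iff)
    qed
    show "(\<lambda>b. b div n) ` {b \<in> {0..<n * r}. n dvd b - a} \<subseteq> {0..<r}"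
    proof
      fix j assume "j \<in> (\<lambda>b. b div n) ` {b \<in> {0..<n * r}. n dvd b - a}"
      then obtain b where b: "j = b div n" "0 \<le> b" "b < n * r" by auto
      have "n * j \<le> b" using pos_mod_sign[OF assms(1), of b] mult_div_mod_eq[of n b] unfolding b(1)
        by linarith
      then have "n * j < n * r" using b(3) by simp
      then show "j \<in> {0..<r}" using b assms by (simp add: pos_imp_zdiv_nonneg_iff)
    qed
  qed
  from bij_betw_same_card[OF this] show ?thesis using assms by simp
qed

text \<open>
Vectors of residues modulo \<open>2 m r\<close> whose entries have equal parity, are not divisible by \<open>m\<close>, and are
pairwise neither equal nor opposite modulo \<open>2 m\<close>. For \<open>r = 1\<close> they represent the regular cosets, and for
\<open>r = 2\<close> the first halves of the regular vectors that belong to cosets fixed by the nontrivial stabilizer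
element.
\<close>

definition sign_distinct_functions :: "int \<Rightarrow> int \<Rightarrow> 'a set \<Rightarrow> ('a \<Rightarrow> int) set" where
  "sign_distinct_functions m r I = {f \<in> I \<rightarrow>\<^sub>E {0..<2 * m * r}.
     (\<forall>i\<in>I. \<forall>j\<in>I. f i mod 2 = f j mod 2) \<and> (\<forall>i\<in>I. \<not> m dvd f i) \<and>
     (\<forall>i\<in>I. \<forall>j\<in>I. i \<noteq> j \<longrightarrow> \<not> 2 * m dvd f j - f i \<and> \<not> 2 * m dvd f j + f i)}"

text \<open>
Nondivisibility by \<open>m\<close> gives \<open>2a \<noteq> 0\<close> modulo \<open>2m\<close>, so that \<open>a\<close> and \<open>-a\<close> are different residues modulo
\<open>2m\<close>; each has \<open>r\<close> lifts, and every class has \<open>2 r\<close> elements. There are \<open>m r\<close> residues of parity \<open>c\<close>; the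
ones to be removed are the multiples of \<open>m\<close> of that parity. For odd \<open>m\<close> these form one residue class
modulo \<open>2m\<close>, for even \<open>m\<close> they are all even.
\<close>

lemma card_sign_distinct_of_parity:
  fixes m r c :: int
  assumes "finite I" "m > 0" "r > 0" "c \<in> {0, 1}"
  shows "int (card {f \<in> I \<rightarrow>\<^sub>E {a \<in> {0..<2 * m * r}. a mod 2 = c \<and> \<not> m dvd a}.
             \<forall>i\<in>I. \<forall>j\<in>I. i \<noteq> j \<longrightarrow> \<not> 2 * m dvd f j - f i \<and> \<not> 2 * m dvd f j + f i}) =
         (\<Prod>i<card I. r * (if odd m then m - 1 else if c = 0 then m - 2 else m) - 2 * r * int i)"
proof -
  define A where "A = {a \<in> {0..<2 * m * r}. a mod 2 = c \<and> \<not> m dvd a}"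
  define cl where "cl a = {b \<in> {0..<2 * m * r}. 2 * m dvd b - a \<or> 2 * m dvd b + a}" for a
  have finA: "finite A" unfolding A_def by (rule finite_subset[of _ "{0..<2 * m * r}"]) auto
  have cardcl: "card (cl a) = nat (2 * r)" if "a \<in> A" for a
  proof -
    have "cl a = {b \<in> {0..<2 * m * r}. 2 * m dvd b - a} \<union> {b \<in> {0..<2 * m * r}. 2 * m dvd b - (- a)}"
      by (auto simp: cl_def)
    moreover have "{b \<in> {0..<2 * m * r}. 2 * m dvd b - a} \<inter> {b \<in> {0..<2 * m * r}. 2 * m dvd b - (- a)} = {}"
    proof -
      have False if "2 * m dvd b - a" "2 * m dvd b - (- a)" for b
      proof -
        have "2 * m dvd (b - (- a)) - (b - a)" using that by (rule dvd_diff[rotated])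
        then show False using \<open>a \<in> A\<close> by (simp add: A_def)
      qed
      then show ?thesis by blast
    qed
    ultimately have "card (cl a) = card {b \<in> {0..<2 * m * r}. 2 * m dvd b - a}
        + card {b \<in> {0..<2 * m * r}. 2 * m dvd b - (- a)}"
      by (simp only: card_Un_disjoint finite_Collect_conjI finite_atLeastLessThan_int
          Collect_mem_eq disjI1)
    then show ?thesis
      using card_residue_class[of "2 * m" r a] card_residue_class[of "2 * m" r "- a"] assms by simp
  qed
  have cls: "a \<in> cl a \<and> cl a \<subseteq> A \<and> card (cl a) = nat (2 * r)" if "a \<in> A" for a
  proof -
    have "cl a \<subseteq> A"
    proof
      fix b assume b: "b \<in> cl a"
      then have "(\<exists>k. b - a = 2 * m * k) \<or> (\<exists>k. b + a = 2 * m * k)"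
        by (simp add: cl_def dvd_def)
      then obtain k where k: "b = a + 2 * m * k \<or> b = - a + 2 * m * k"
        by (metis add.commute diff_add_cancel minus_add_cancel)
      have "b mod 2 = c" "\<not> m dvd b"
      proof -
        have "even (b - a)" using k by auto
        then have "b mod 2 = a mod 2" by presburger
        then show "b mod 2 = c" using that by (simp add: A_def)
        show "\<not> m dvd b"
        proof
          assume "m dvd b"
          then have "m dvd b - 2 * m * k" by simp
          then show False using k that by (auto simp: A_def)
        qed
      qed
      then show "b \<in> A" using b by (simp add: A_def cl_def)
    qed
    then show ?thesis using cardcl[OF that] that by (auto simp: A_def cl_def)
  qed
  have clsub: "cl b \<subseteq> cl a" if "b \<in> cl a" for a b
  proof
    fix x assume x: "x \<in> cl b"
    have "2 * m dvd x - b \<or> 2 * m dvd x + b" "2 * m dvd b - a \<or> 2 * m dvd b + a"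
      using x that by (auto simp: cl_def)
    then have "2 * m dvd x - a \<or> 2 * m dvd x + a"
      using dvd_add[of "2 * m" "x - b" "b - a"] dvd_diff[of "2 * m" "x + b" "b + a"]
        dvd_add[of "2 * m" "x - b" "b + a"] dvd_diff[of "2 * m" "x + b" "b - a"]
      by auto
    then show "x \<in> cl a" using x by (simp add: cl_def)
  qed
  have cleq: "cl b = cl a" if "a \<in> A" "b \<in> cl a" for a b
  proof -
    have "a \<in> cl b" using that by (auto simp: cl_def A_def dvd_diff_commute add.commute)
    then show ?thesis using clsub that by blast
  qed
  let ?B = "{b \<in> {0..<2 * (m * r)}. 2 dvd b - c}"
  let ?D = "{b \<in> {0..<2 * (m * r)}. 2 dvd b - c \<and> m dvd b}"
  have par: "a mod 2 = c \<longleftrightarrow> 2 dvd a - c" for a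
  proof -
    have "c = 0 \<or> c = 1" using assms(4) by simp
    then show ?thesis by presburger
  qed
  have AB: "A = ?B - ?D" by (auto simp: A_def par)
  have "int (card A) = int (card ?B) - int (card ?D)"
  proof -
    have f: "finite ?B" by (rule finite_subset[of _ "{0..<2 * (m * r)}"]) auto
    have "?D \<subseteq> ?B" by auto
    then show ?thesis unfolding AB
      using card_Diff_subset[OF finite_subset[OF _ f], of ?D] card_mono[OF f, of ?D]
      by (simp only: of_nat_diff)
  qed
  moreover have "int (card ?B) = m * r"
    using card_residue_class[of 2 "m * r" c] assms by simp
  moreover have "int (card ?D) = (if odd m then r else if c = 0 then 2 * r else 0)"
  proof (cases "odd m")
    case True
    have "2 dvd b - c \<and> m dvd b \<longleftrightarrow> 2 * m dvd b - m * c" for b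
    proof -
      have "coprime 2 m" using True by simp
      then have "2 * m dvd b - m * c \<longleftrightarrow> 2 dvd b - m * c \<and> m dvd b - m * c"
        using divides_mult dvd_mult_left dvd_mult_right by metis
      also have "2 dvd b - m * c \<longleftrightarrow> 2 dvd b - c" using True by auto
      also have "m dvd b - m * c \<longleftrightarrow> m dvd b"
        by (rule dvd_diff_left_iff) simp
      finally show ?thesis by blast
    qed
    then show ?thesis using card_residue_class[of "2 * m" r "m * c"] assms True
      by (simp add: mult.assoc)
  next
    case even: False
    show ?thesis
    proof (cases "c = 0")
      case True
      have "?D = {b \<in> {0..<m * (2 * r)}. m dvd b - 0}"
        using even True by (auto simp: algebra_simps intro: dvd_trans)
      then show ?thesis using card_residue_class[of m "2 * r" 0] assms True even by simp
    next
      case False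
      then have "?D = {}" using even assms by (auto dest: dvd_trans)
      then show ?thesis using False even by (simp only: card.empty) simp
    qed
  qed
  ultimately have cA: "int (card A) = r * (if odd m then m - 1 else if c = 0 then m - 2 else m)"
    by (cases "odd m"; cases "c = 0") (simp_all add: algebra_simps)
  have "{f \<in> I \<rightarrow>\<^sub>E A. \<forall>i\<in>I. \<forall>j\<in>I. i \<noteq> j \<longrightarrow> \<not> 2 * m dvd f j - f i \<and> \<not> 2 * m dvd f j + f i}
      = {f \<in> I \<rightarrow>\<^sub>E A. \<forall>i\<in>I. \<forall>j\<in>I. i \<noteq> j \<longrightarrow> f j \<notin> cl (f i)}"
    by (auto simp: cl_def A_def PiE_iff)
  then have "int (card {f \<in> I \<rightarrow>\<^sub>E A. \<forall>i\<in>I. \<forall>j\<in>I. i \<noteq> j \<longrightarrow> \<not> 2 * m dvd f j - f i \<and> \<not> 2 * m dvd f j + f i})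
     = (\<Prod>i<card I. int (card A) - int (nat (2 * r)) * int i)"
    using card_pairwise_inequivalent_functions[OF \<open>finite I\<close> finA cls cleq] by simp
  then show ?thesis using assms cA by (simp add: A_def)
qed

text \<open>
The two parities are added. For even \<open>m\<close> the factors are \<open>r (m - 2), r (m - 4), ...\<close> in one case and
\<open>r m, r (m - 2), ...\<close> in the other; the common part is the product up to \<open>card I - 1\<close> and the extra factors
\<open>r (m - 2 card I)\<close> and \<open>r m\<close> add up to \<open>2 r (m - card I)\<close>.
\<close>

lemma card_sign_distinct_functions:
  fixes m r :: int
  assumes I: "finite I" "I \<noteq> {}" and m: "m > 0" and r: "r > 0"
  shows "int (card (sign_distinct_functions m r I)) =
     (if odd m then 2 * (\<Prod>i<card I. r * (m - 1) - 2 * r * int i)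
      else 2 * (\<Prod>i=1..card I - 1. r * m - 2 * r * int i) * (r * m - r * int (card I)))"
proof -
  define F where "F c = {f \<in> I \<rightarrow>\<^sub>E {a \<in> {0..<2 * m * r}. a mod 2 = c \<and> \<not> m dvd a}.
             \<forall>i\<in>I. \<forall>j\<in>I. i \<noteq> j \<longrightarrow> \<not> 2 * m dvd f j - f i \<and> \<not> 2 * m dvd f j + f i}" for c
  have fin: "finite (F c)" for c
  proof -
    have "finite {a \<in> {0..<2 * m * r}. a mod 2 = c \<and> \<not> m dvd a}" by (rule finite_subset[of _ "{0..<2 * m * r}"]) auto
    then show ?thesis unfolding F_def using I by (intro finite_subset[OF _ finite_PiE[of I]]) auto
  qed
  obtain i0 where i0: "i0 \<in> I" using I by blast
  have "sign_distinct_functions m r I = F 0 \<union> F 1"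
  proof (intro equalityI subsetI)
    fix f assume f: "f \<in> sign_distinct_functions m r I"
    define c where "c = f i0 mod 2"
    have f1: "f \<in> I \<rightarrow>\<^sub>E {0..<2 * m * r}" and f2: "\<forall>i\<in>I. \<not> m dvd f i"
      and f3: "\<forall>i\<in>I. \<forall>j\<in>I. i \<noteq> j \<longrightarrow> \<not> 2 * m dvd f j - f i \<and> \<not> 2 * m dvd f j + f i"
      and f4: "\<forall>i\<in>I. \<forall>j\<in>I. f i mod 2 = f j mod 2"
      using f unfolding sign_distinct_functions_def mem_Collect_eq
      by - (elim conjE, assumption)+
    have par: "\<forall>i\<in>I. f i mod 2 = c" using f4 i0 unfolding c_def by blast
    have "f \<in> I \<rightarrow>\<^sub>E {a \<in> {0..<2 * m * r}. a mod 2 = c \<and> \<not> m dvd a}"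
      using PiE_mem[OF f1] PiE_arb[OF f1] f2 par by (intro PiE_I CollectI conjI) blast+
    then have "f \<in> F c" using f3 unfolding F_def by blast
    moreover have "c = 0 \<or> c = 1" unfolding c_def by presburger
    ultimately show "f \<in> F 0 \<union> F 1" by blast
  next
    fix f assume f: "f \<in> F 0 \<union> F 1"
    then obtain c where "f \<in> F c" by blast
    then have f1: "f \<in> I \<rightarrow>\<^sub>E {a \<in> {0..<2 * m * r}. a mod 2 = c \<and> \<not> m dvd a}"
      and f3: "\<forall>i\<in>I. \<forall>j\<in>I. i \<noteq> j \<longrightarrow> \<not> 2 * m dvd f j - f i \<and> \<not> 2 * m dvd f j + f i"
      unfolding F_def mem_Collect_eq by - (elim conjE, assumption)+
    have "f \<in> I \<rightarrow>\<^sub>E {0..<2 * m * r}"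
      using PiE_mem[OF f1] PiE_arb[OF f1] by (intro PiE_I) blast+
    moreover have "\<forall>i\<in>I. f i mod 2 = c \<and> \<not> m dvd f i" using PiE_mem[OF f1] by blast
    ultimately show "f \<in> sign_distinct_functions m r I"
      using f3 unfolding sign_distinct_functions_def by simp
  qed
  moreover have "F 0 \<inter> F 1 = {}"
  proof (rule ccontr)
    assume "F 0 \<inter> F 1 \<noteq> {}"
    then obtain f where "f \<in> F 0" "f \<in> F 1" by blast
    then have "f \<in> I \<rightarrow>\<^sub>E {a \<in> {0..<2 * m * r}. a mod 2 = 0 \<and> \<not> m dvd a}"
      "f \<in> I \<rightarrow>\<^sub>E {a \<in> {0..<2 * m * r}. a mod 2 = 1 \<and> \<not> m dvd a}"
      unfolding F_def mem_Collect_eq by - (elim conjE, assumption)+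
    from this[THEN PiE_mem, OF i0] show False by simp
  qed
  ultimately have "int (card (sign_distinct_functions m r I)) = int (card (F 0)) + int (card (F 1))"
    using fin by (simp add: card_Un_disjoint)
  also have "\<dots> = (\<Prod>i<card I. r * (if odd m then m - 1 else m - 2) - 2 * r * int i)
      + (\<Prod>i<card I. r * (if odd m then m - 1 else m) - 2 * r * int i)"
    using card_sign_distinct_of_parity[OF I(1) m r, of 0] card_sign_distinct_of_parity[OF I(1) m r, of 1]
    unfolding F_def by simp
  finally have *: "int (card (sign_distinct_functions m r I)) = \<dots>" .
  obtain k where k: "card I = Suc k" using I by (metis card_gt_0_iff gr0_conv_Suc)
  have "(\<Prod>i<Suc k. r * (m - 2) - 2 * r * int i) = (\<Prod>i=1..k. r * m - 2 * r * int i) * (r * m - 2 * r * int (Suc k))"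
  proof -
    have "(\<Prod>i<Suc k. r * (m - 2) - 2 * r * int i) = (\<Prod>i<Suc k. r * m - 2 * r * int (Suc i))"
      by (intro prod.cong) (auto simp: algebra_simps)
    also have "\<dots> = (\<Prod>i=1..Suc k. r * m - 2 * r * int i)"
      by (simp only: prod.shift_bounds_cl_Suc_ivl[symmetric] prod.atLeast1_atMost_eq One_nat_def)
    finally show ?thesis by (simp add: mult.commute)
  qed
  moreover have "(\<Prod>i<Suc k. r * m - 2 * r * int i) = (\<Prod>i=1..k. r * m - 2 * r * int i) * (r * m)"
    by (simp only: prod.lessThan_Suc_shift prod.atLeast1_atMost_eq One_nat_def) simp
  ultimately show ?thesis
    using * k by (auto simp: algebra_simps)
qed

section \<open>Groups generated by reflections\<close>

definition refl_product :: "'a::real_inner list \<Rightarrow> 'a \<Rightarrow> 'a" where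
  "refl_product as = foldr (\<circ>) (map reflection as) id"

lemma refl_product_simps [simp]:
  "refl_product [] = id" "refl_product (a # as) = reflection a \<circ> refl_product as"
  by (simp_all add: refl_product_def)

lemma refl_product_append: "refl_product (as @ bs) = refl_product as \<circ> refl_product bs"
  by (induction as) (auto simp: o_assoc)

lemma reflection_involution [simp]: "reflection a \<circ> reflection a = id"
proof
  fix x show "(reflection a \<circ> reflection a) x = id x"
    by (cases "a = 0") (auto simp: reflection_def inner_diff_right algebra_simps)
qed

lemma reflection_self: "reflection a a = - a"
  by (cases "a = 0") (auto simp: reflection_def scaleR_2)

lemma orthogonal_reflection: "orthogonal_transformation (reflection a)"
  unfolding orthogonal_transformation_def
proof
  show "linear (reflection a)"
    by (rule linearI) (auto simp: reflection_def inner_add_right algebra_simps add_divide_distrib)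
  show "\<forall>x y. reflection a x \<bullet> reflection a y = x \<bullet> y"
  proof (intro allI)
    fix x y
    show "reflection a x \<bullet> reflection a y = x \<bullet> y"
      by (cases "a = 0")
         (auto simp: reflection_def inner_diff_left inner_diff_right inner_commute field_simps)
  qed
qed

lemma orthogonal_refl_product: "orthogonal_transformation (refl_product as)"
proof (induction as)
  case Nil
  then show ?case by (simp add: orthogonal_transformation_def linear_id)
next
  case (Cons a as)
  then show ?case
    unfolding refl_product_simps
    by (intro orthogonal_transformation_compose orthogonal_reflection)
qed

lemma bij_reflection: "bij (reflection a)"
  by (rule o_bij[OF reflection_involution reflection_involution])

text \<open>
Reflections are involutions, so products of generators are already closed under inverses. This gives
induction over lists for all properties of group elements.
\<close>

lemma refl_group_eq: "refl_group S = refl_product ` {as. set as \<subseteq> S}"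
proof -
  let ?G = "BijGroup (UNIV :: 'a set)"
  have Bij: "Bij (UNIV :: 'a set) = {f. bij f}" by (auto simp: Bij_def extensional_def)
  have mult: "f \<otimes>\<^bsub>?G\<^esub> g = f \<circ> g" if "bij f" "bij g" for f g
    using that by (simp add: BijGroup_def Bij compose_def fun_eq_iff)
  have one: "\<one>\<^bsub>?G\<^esub> = id" by (simp add: BijGroup_def fun_eq_iff)
  have car: "carrier ?G = {f. bij f}" by (simp add: BijGroup_def Bij)
  interpret G: group ?G by (rule group_BijGroup)
  have inv: "inv\<^bsub>?G\<^esub> (reflection a) = reflection a" for a :: 'a
    by (rule G.inv_equality) (simp_all add: mult one car bij_reflection)
  have bp: "bij (refl_product as)" for as :: "'a list"
    by (induction as) (simp_all only: refl_product_simps bij_id bij_comp bij_reflection)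
  show ?thesis
  proof (intro equalityI subsetI)
    fix w assume "w \<in> refl_group S"
    then have "w \<in> generate ?G (reflection ` S)" by (simp add: refl_group_def)
    then show "w \<in> refl_product ` {as. set as \<subseteq> S}"
    proof induction
      case one
      then show ?case using \<open>\<one>\<^bsub>?G\<^esub> = id\<close> by (auto intro!: image_eqI[of _ _ "[]"])
    next
      case (incl f)
      then obtain a where "a \<in> S" "f = reflection a" by auto
      then show ?case by (intro image_eqI[of _ _ "[a]"]) auto
    next
      case (inv f)
      then obtain a where "a \<in> S" "f = reflection a" by auto
      then show ?case using \<open>\<And>a. inv\<^bsub>?G\<^esub> (reflection a) = reflection a\<close>
        by (intro image_eqI[of _ _ "[a]"]) auto
    next
      case (eng f g)
      then obtain as bs where "set as \<subseteq> S" "set bs \<subseteq> S" "f = refl_product as" "g = refl_product bs"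
        by auto
      then show ?case
        by (intro image_eqI[of _ _ "as @ bs"]) (auto simp: mult bp refl_product_append)
    qed
  next
    fix w assume "w \<in> refl_product ` {as. set as \<subseteq> S}"
    then obtain as where as: "set as \<subseteq> S" and w: "w = refl_product as" by auto
    from as have "refl_product as \<in> generate ?G (reflection ` S)"
    proof (induction as)
      case Nil
      then show ?case using generate.one[of ?G] unfolding one refl_product_simps by blast
    next
      case (Cons a as)
      then have "reflection a \<in> reflection ` S" "refl_product as \<in> generate ?G (reflection ` S)"
        by auto
      then have "reflection a \<otimes>\<^bsub>?G\<^esub> refl_product as \<in> generate ?G (reflection ` S)"
        by (rule generate.eng[OF generate.incl])
      then show ?case unfolding mult[OF bij_reflection bp] refl_product_simps .
    qed
    then show "w \<in> refl_group S" by (simp add: refl_group_def w)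
  qed
qed

lemma refl_group_inverse:
  assumes "w \<in> refl_group S"
  obtains v where "v \<in> refl_group S" "w \<circ> v = id" "v \<circ> w = id"
proof -
  obtain as where as: "set as \<subseteq> S" "w = refl_product as" using assms by (auto simp: refl_group_eq)
  have 1: "refl_product bs \<circ> refl_product (rev bs) = id" for bs :: "'a list"
  proof (induction bs)
    case (Cons b bs)
    have "refl_product (b # bs) \<circ> refl_product (rev (b # bs))
        = reflection b \<circ> (refl_product bs \<circ> refl_product (rev bs)) \<circ> reflection b"
      by (simp add: refl_product_append o_assoc)
    also have "\<dots> = id" unfolding Cons.IH by (simp only: comp_id reflection_involution)
    finally show ?case .
  qed simp
  show ?thesis
    by (rule that[of "refl_product (rev as)"]) (use as 1[of as] 1[of "rev as"] in \<open>auto simp: refl_group_eq\<close>)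
qed

lemma refl_group_compose:
  assumes "v \<in> refl_group S" "w \<in> refl_group S" shows "v \<circ> w \<in> refl_group S"
proof -
  obtain as bs where "set as \<subseteq> S" "v = refl_product as" "set bs \<subseteq> S" "w = refl_product bs"
    using assms by (auto simp: refl_group_eq)
  then show ?thesis unfolding refl_group_eq
    by (intro image_eqI[of _ _ "as @ bs"]) (auto simp: refl_product_append)
qed

lemma refl_group_mono: "S \<subseteq> T \<Longrightarrow> refl_group S \<subseteq> refl_group T"
  by (auto simp: refl_group_eq)

lemma id_in_refl_group: "id \<in> refl_group S"
  unfolding refl_group_eq by (rule image_eqI[of _ _ "[]"]) auto

lemma reflection_in_refl_group: "a \<in> S \<Longrightarrow> reflection a \<in> refl_group S"
  unfolding refl_group_eq by (rule image_eqI[of _ _ "[a]"]) auto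

lemma orthogonal_refl_group: "w \<in> refl_group S \<Longrightarrow> orthogonal_transformation w"
  by (auto simp: refl_group_eq orthogonal_refl_product)

section \<open>Inversions and longest elements\<close>

text \<open>
The length of \<open>v\<close> is the number of positive roots that \<open>v\<close> makes negative, where \<open>h\<close> decides about the
sign. Multiplying by the reflection in \<open>\<alpha> \<in> S\<close> permutes the positive roots other than \<open>\<alpha>\<close> and negates
\<open>\<alpha>\<close>, so it changes this number by exactly one, downwards iff \<open>v \<alpha>\<close> is negative. If every element other
than \<open>id\<close> makes some \<open>\<alpha> \<in> S\<close> negative, then \<open>v\<close> can be reduced to \<open>id\<close> in that many steps; and an element
of maximal length makes all of \<open>S\<close> negative. The set \<open>R\<close> may contain more roots than those generated by
\<open>S\<close>, which allows the same positive roots to serve for a parabolic subgroup.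
\<close>

lemma longest_element_eqI:
  fixes S R :: "'a::real_inner set" and h :: 'a
  assumes fin: "finite R"
    and simple: "\<forall>\<alpha>\<in>S. \<alpha> \<in> R \<and> 0 < h \<bullet> \<alpha>"
    and perm: "\<forall>\<alpha>\<in>S. \<forall>\<beta>\<in>R. 0 < h \<bullet> \<beta> \<and> \<beta> \<noteq> \<alpha> \<longrightarrow>
                 reflection \<alpha> \<beta> \<in> R \<and> 0 < h \<bullet> reflection \<alpha> \<beta>"
    and regular: "\<forall>v\<in>refl_group S. \<forall>\<alpha>\<in>S. h \<bullet> v \<alpha> \<noteq> 0"
    and lowest: "\<forall>v\<in>refl_group S. (\<forall>\<alpha>\<in>S. 0 < h \<bullet> v \<alpha>) \<longrightarrow> v = id"
    and highest: "\<forall>v\<in>refl_group S. (\<forall>\<alpha>\<in>S. h \<bullet> v \<alpha> < 0) \<longrightarrow> v = w0"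
  shows "longest_element S = w0" and "w0 \<in> refl_group S"
proof -
  have S: "\<alpha> \<in> R \<and> 0 < h \<bullet> \<alpha>" if "\<alpha> \<in> S" for \<alpha>
    using simple that by blast
  have reg: "h \<bullet> v \<alpha> \<noteq> 0" if "v \<in> refl_group S" "\<alpha> \<in> S" for v \<alpha>
    using regular that by blast
  define P where "P = {\<beta> \<in> R. 0 < h \<bullet> \<beta>}"
  define N where "N v = card {\<beta> \<in> P. h \<bullet> v \<beta> < 0}" for v :: "'a \<Rightarrow> 'a"
  have finP: "finite P" using fin by (simp add: P_def)
  have step: "N (v \<circ> reflection \<alpha>) + (if h \<bullet> v \<alpha> < 0 then 1 else 0)
        = N v + (if h \<bullet> v \<alpha> < 0 then 0 else 1)"
    if v: "v \<in> refl_group S" and \<alpha>: "\<alpha> \<in> S" for v \<alpha>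
  proof -
    let ?s = "reflection \<alpha>" and ?T = "P - {\<alpha>}"
    have invol: "?s (?s x) = x" for x
      using reflection_involution[of \<alpha>] by (metis comp_apply id_apply)
    have sT: "?s \<beta> \<in> ?T" if "\<beta> \<in> ?T" for \<beta>
    proof -
      have "?s \<beta> \<noteq> \<alpha>"
      proof
        assume "?s \<beta> = \<alpha>"
        then have "\<beta> = - \<alpha>" using invol[of \<beta>] reflection_self[of \<alpha>] by simp
        then show False using that S[OF \<alpha>] by (simp add: P_def)
      qed
      then show ?thesis using perm \<alpha> that by (simp add: P_def)
    qed
    have "bij_betw ?s {\<beta> \<in> ?T. h \<bullet> v (?s \<beta>) < 0} {\<beta> \<in> ?T. h \<bullet> v \<beta> < 0}"
      by (rule bij_betw_byWitness[where f' = ?s]) (use sT invol in auto)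
    then have T: "card {\<beta> \<in> ?T. h \<bullet> v (?s \<beta>) < 0} = card {\<beta> \<in> ?T. h \<bullet> v \<beta> < 0}"
      by (rule bij_betw_same_card)
    have split: "card {\<beta> \<in> P. Q \<beta>} = card {\<beta> \<in> ?T. Q \<beta>} + (if Q \<alpha> then 1 else 0)" for Q
    proof -
      have "{\<beta> \<in> P. Q \<beta>} = (if Q \<alpha> then insert \<alpha> {\<beta> \<in> ?T. Q \<beta>} else {\<beta> \<in> ?T. Q \<beta>})"
        using S[OF \<alpha>] by (auto simp: P_def)
      then show ?thesis using finP by simp
    qed
    have lin: "linear v" using orthogonal_refl_group[OF v] by (simp add: orthogonal_transformation_def)
    have "h \<bullet> v (?s \<alpha>) = - (h \<bullet> v \<alpha>)" by (simp add: reflection_self linear_neg[OF lin])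
    then show ?thesis
      using split[of "\<lambda>\<beta>. h \<bullet> v \<beta> < 0"] split[of "\<lambda>\<beta>. h \<bullet> v (?s \<beta>) < 0"] T reg[OF v \<alpha>]
      by (auto simp: N_def)
  qed
  have closed: "v \<circ> reflection \<alpha> \<in> refl_group S" if "v \<in> refl_group S" "\<alpha> \<in> S" for v \<alpha>
    using that refl_group_compose reflection_in_refl_group by blast
  have N0: "{\<beta> \<in> P. h \<bullet> \<beta> < 0} = {}" by (auto simp: P_def)
  have lower: "N (refl_product as) \<le> length as" if "set as \<subseteq> S" for as
    using that
  proof (induction as rule: rev_induct)
    case Nil
    show ?case by (simp add: N_def N0)
  next
    case (snoc a as)
    then have "refl_product as \<in> refl_group S" "a \<in> S" by (auto simp: refl_group_eq)
    from step[OF this] have "N (refl_product as \<circ> reflection a) \<le> Suc (N (refl_product as))"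
      by (simp split: if_splits)
    moreover have "refl_product (as @ [a]) = refl_product as \<circ> reflection a"
      by (simp only: refl_product_append refl_product_simps comp_id)
    moreover have "N (refl_product as) \<le> length as" using snoc by simp
    ultimately show ?case by (simp only: length_append_singleton)
  qed
  have upper: "\<exists>as. length as = N v \<and> set as \<subseteq> S \<and> v = refl_product as"
    if "v \<in> refl_group S" for v
    using that
  proof (induction "N v" arbitrary: v rule: less_induct)
    case less
    show ?case
    proof (cases "v = id")
      case True
      then show ?thesis by (intro exI[of _ "[]"]) (simp add: N_def N0)
    next
      case False
      then obtain \<alpha> where \<alpha>: "\<alpha> \<in> S" "h \<bullet> v \<alpha> < 0"
        using lowest less.prems reg[OF less.prems] by (meson linorder_neqE)
      let ?v = "v \<circ> reflection \<alpha>"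
      have N: "N v = Suc (N ?v)" using step[OF less.prems \<alpha>(1)] \<alpha>(2) by simp
      then obtain as where as: "length as = N ?v" "set as \<subseteq> S" "?v = refl_product as"
        using less.hyps[of ?v] closed[OF less.prems \<alpha>(1)] by auto
      have "v = ?v \<circ> reflection \<alpha>" by (simp add: comp_assoc)
      then have "v = refl_product (as @ [\<alpha>])" using as by (simp add: refl_product_append)
      then show ?thesis using as N \<alpha> by (intro exI[of _ "as @ [\<alpha>]"]) auto
    qed
  qed
  have len: "refl_length S v = N v" if "v \<in> refl_group S" for v
    unfolding refl_length_def refl_product_def[symmetric]
    using upper[OF that] lower by (intro Least_equality) auto
  have maximal: "v = w0" if v: "v \<in> refl_group S" and max: "\<And>u. u \<in> refl_group S \<Longrightarrow> N u \<le> N v" for v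
  proof (rule highest[rule_format, OF v])
    fix \<alpha> assume \<alpha>: "\<alpha> \<in> S"
    show "h \<bullet> v \<alpha> < 0" using step[OF v \<alpha>] max[OF closed[OF v \<alpha>]] by (simp split: if_splits)
  qed
  have bdd: "N v \<le> card P" for v unfolding N_def by (rule card_mono[OF finP]) auto
  obtain v where v: "v \<in> refl_group S" "\<And>u. u \<in> refl_group S \<Longrightarrow> N u \<le> N v"
    using ex_has_greatest_nat[of "\<lambda>u. u \<in> refl_group S" id N "Suc (card P)"]
      id_in_refl_group bdd by (auto simp: less_Suc_eq_le)
  have "v = w0" by (rule maximal[OF v])
  then show w0: "w0 \<in> refl_group S" using v by simp
  show "longest_element S = w0"
    unfolding longest_element_def
  proof (rule the_equality)
    show "w0 \<in> refl_group S \<and> (\<forall>u\<in>refl_group S. refl_length S u \<le> refl_length S w0)"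
      using v \<open>v = w0\<close> by (simp add: len)
    show "u = w0" if "u \<in> refl_group S \<and> (\<forall>v\<in>refl_group S. refl_length S v \<le> refl_length S u)" for u
      using that by (intro maximal) (auto simp: len)
  qed
qed

section \<open>Signed permutations and the root system\<close>

lemma Basis_eq_ee: "(Basis :: (real ^ 'n::{finite,linorder}) set) = ee ` {1..CARD('n)}"
  using bij_betw_ee[where 'n='n] unfolding bij_betw_def by blast

lemma ee_inner:
  assumes "i \<in> {1..CARD('n::{finite,linorder})}" "j \<in> {1..CARD('n)}"
  shows "ee i \<bullet> (ee j :: (real, 'n) vec) = (if i = j then 1 else 0)"
proof -
  have "(ee i :: (real, 'n) vec) \<in> Basis" "(ee j :: (real, 'n) vec) \<in> Basis"
    unfolding Basis_eq_ee using assms by blast+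
  moreover have "(ee i :: (real, 'n) vec) = ee j \<longleftrightarrow> i = j"
    using inj_on_eq_iff[OF bij_betw_imp_inj_on[OF bij_betw_ee] assms] .
  ultimately show ?thesis by (simp add: inner_Basis)
qed

lemma eqI_ee:
  fixes x y :: "real ^ 'n::{finite,linorder}"
  assumes "\<And>k. k \<in> {1..CARD('n)} \<Longrightarrow> ee k \<bullet> x = ee k \<bullet> y"
  shows "x = y"
proof (rule euclidean_eqI)
  fix b :: "(real, 'n) vec" assume "b \<in> Basis"
  then obtain k where "k \<in> {1..CARD('n)}" "b = ee k"
    unfolding Basis_eq_ee by blast
  then show "x \<bullet> b = y \<bullet> b" using assms by (simp add: inner_commute)
qed

lemma inner_sum_ee:
  assumes "k \<in> {1..CARD('n::{finite,linorder})}"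
  shows "ee k \<bullet> (\<Sum>i=1..CARD('n). c i *\<^sub>R (ee i :: real ^ 'n::{finite,linorder})) = c k"
proof -
  have "ee k \<bullet> (\<Sum>i=1..CARD('n). c i *\<^sub>R (ee i :: (real, 'n) vec)) = (\<Sum>i=1..CARD('n). if i = k then c i else 0)"
    unfolding inner_sum_right using assms by (intro sum.cong) (auto simp: ee_inner)
  then show ?thesis using assms by simp
qed

lemma linear_eqI_ee:
  fixes v w :: "real ^ 'n::{finite,linorder} \<Rightarrow> real ^ 'n::{finite,linorder}"
  assumes "linear v" "linear w" "\<And>k. k \<in> {1..CARD('n)} \<Longrightarrow> v (ee k) = w (ee k)"
  shows "v = w"
proof (rule linear_eq_stdbasis[OF assms(1,2)])
  fix b :: "(real, 'n) vec" assume "b \<in> Basis"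
  then show "v b = w b"
    unfolding Basis_eq_ee using assms(3) by blast
qed

text \<open>
The vector \<open>(l, l - 1, ..., 1)\<close>, half the sum of the positive roots. Its entries are distinct, positive,
and fill \<open>{1..l}\<close>, so that it separates the vectors \<open>\<plusminus>e\<^sub>i\<close>.
\<close>

definition height_vector :: "real ^ 'n::{finite,linorder}" where
  "height_vector = (\<Sum>k=1..CARD('n). (real CARD('n) + 1 - real k) *\<^sub>R ee k)"

lemma height_ee:
  assumes "k \<in> {1..CARD('n::{finite,linorder})}"
  shows "height_vector \<bullet> (ee k :: (real, 'n) vec) = real CARD('n) + 1 - real k"
  unfolding height_vector_def inner_commute[of _ "ee k"] by (rule inner_sum_ee[OF assms])

definition signed_permutation :: "((real ^ 'n::{finite,linorder}) \<Rightarrow> (real ^ 'n::{finite,linorder})) \<Rightarrow> bool" where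
  "signed_permutation w \<longleftrightarrow> orthogonal_transformation w \<and>
     (\<forall>i\<in>{1..CARD('n)}. \<exists>j\<in>{1..CARD('n)}. \<exists>s\<in>{1, -1}. w (ee i) = s *\<^sub>R ee j)"

text \<open>
In the definition of the roots the first index is the smaller one; images under signed permutations
come in arbitrary order.
\<close>

lemma pair_in_roots:
  assumes "i \<in> {1..CARD('n::{finite,linorder})}" "k \<in> {1..CARD('n)}" "i \<noteq> k"
    and "a \<in> {1, -1}" "b \<in> {1, -1}"
  shows "a *\<^sub>R ee i + b *\<^sub>R ee k \<in> (roots :: (real, 'n) vec set)"
proof -
  have *: "a *\<^sub>R ee i + b *\<^sub>R ee k \<in> (roots :: (real, 'n) vec set)"
    if "1 \<le> i" "i < k" "k \<le> CARD('n)" "a \<in> {1, -1}" "b \<in> {1, -1}" for a b i k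
    unfolding roots_def using that by blast
  show ?thesis
  proof (cases "i < k")
    case True
    then show ?thesis using assms by (intro *) auto
  next
    case False
    then have "b *\<^sub>R ee k + a *\<^sub>R ee i \<in> (roots :: (real, 'n) vec set)"
      using assms by (intro *) auto
    then show ?thesis by (simp only: add.commute)
  qed
qed

lemma double_in_roots:
  assumes "k \<in> {1..CARD('n::{finite,linorder})}" "a \<in> {1, -1}"
  shows "a *\<^sub>R (2 *\<^sub>R ee k) \<in> (roots :: (real, 'n) vec set)"
  unfolding roots_def using assms by auto

lemma rootE:
  assumes "\<beta> \<in> (roots :: (real ^ 'n::{finite,linorder}) set)"
  obtains (pair) a b i k where "\<beta> = a *\<^sub>R ee i + b *\<^sub>R ee k" "a \<in> {1, -1}" "b \<in> {1, -1}"
      "i \<in> {1..CARD('n)}" "k \<in> {1..CARD('n)}" "i < k"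
    | (double) a k where "\<beta> = a *\<^sub>R (2 *\<^sub>R ee k)" "a \<in> {1, -1}" "k \<in> {1..CARD('n)}"
proof -
  from assms consider
    "\<exists>a b i k. \<beta> = a *\<^sub>R ee i + b *\<^sub>R ee k \<and> a \<in> {1, -1} \<and> b \<in> {1, -1} \<and> 1 \<le> i \<and> i < k \<and> k \<le> CARD('n)"
    | "\<exists>a k. \<beta> = a *\<^sub>R (2 *\<^sub>R ee k) \<and> a \<in> {1, -1} \<and> 1 \<le> k \<and> k \<le> CARD('n)"
    unfolding roots_def by blast
  then show thesis
  proof cases
    case 1
    then obtain a b i k where "\<beta> = a *\<^sub>R ee i + b *\<^sub>R ee k" "a \<in> {1, -1}" "b \<in> {1, -1}" "1 \<le> i" "i < k" "k \<le> CARD('n)"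
      by blast
    then show thesis by (intro pair[of a i b k]) auto
  next
    case 2
    then obtain a k where "\<beta> = a *\<^sub>R (2 *\<^sub>R ee k)" "a \<in> {1, -1}" "1 \<le> k" "k \<le> CARD('n)" by blast
    then show thesis by (intro double[of a k]) auto
  qed
qed

lemma finite_roots: "finite (roots :: (real ^ 'n::{finite,linorder}) set)"
proof (rule finite_subset)
  show "(roots :: (real, 'n) vec set) \<subseteq>
      (\<lambda>(a, b, i, k). a *\<^sub>R ee i + b *\<^sub>R ee k) ` ({1, -1} \<times> {1, -1} \<times> {1..CARD('n)} \<times> {1..CARD('n)})
      \<union> (\<lambda>(a, k). a *\<^sub>R (2 *\<^sub>R ee k)) ` ({1, -1} \<times> {1..CARD('n)})"
  proof
    fix \<beta> :: "(real, 'n) vec" assume "\<beta> \<in> roots"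
    then show "\<beta> \<in> (\<lambda>(a, b, i, k). a *\<^sub>R ee i + b *\<^sub>R ee k) ` ({1, -1} \<times> {1, -1} \<times> {1..CARD('n)} \<times> {1..CARD('n)})
      \<union> (\<lambda>(a, k). a *\<^sub>R (2 *\<^sub>R ee k)) ` ({1, -1} \<times> {1..CARD('n)})"
    proof (cases rule: rootE)
      case (pair a b i k)
      then show ?thesis by (intro UnI1 image_eqI[of _ _ "(a, b, i, k)"]) simp_all
    next
      case (double a k)
      then show ?thesis by (intro UnI2 image_eqI[of _ _ "(a, k)"]) simp_all
    qed
  qed
qed simp

lemma signed_permutationE:
  assumes "signed_permutation w" "i \<in> {1..CARD('n::{finite,linorder})}"
  obtains s j where "s \<in> {1, -1}" "j \<in> {1..CARD('n)}" "w (ee i) = s *\<^sub>R (ee j :: (real, 'n) vec)"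
  using assms unfolding signed_permutation_def by blast

lemma signed_permutation_linear: "signed_permutation w \<Longrightarrow> linear w"
  by (simp add: signed_permutation_def orthogonal_transformation_def)

lemma signed_permutation_inner: "signed_permutation w \<Longrightarrow> w x \<bullet> w y = x \<bullet> y"
  by (simp add: signed_permutation_def orthogonal_transformation_def)

lemma signed_permutation_id: "signed_permutation id"
  unfolding signed_permutation_def
proof (intro conjI ballI)
  fix i assume "i \<in> {1..CARD('a)}"
  then show "\<exists>j\<in>{1..CARD('a)}. \<exists>s\<in>{1, -1}. id (ee i :: (real, 'a) vec) = s *\<^sub>R ee j"
    by (intro bexI[of _ i] bexI[of _ 1]) simp_all
qed (simp add: orthogonal_transformation_def linear_id)

lemma signed_permutation_compose:
  fixes v w :: "real ^ 'n::{finite,linorder} \<Rightarrow> real ^ 'n::{finite,linorder}"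
  assumes v: "signed_permutation v" and w: "signed_permutation w"
  shows "signed_permutation (v \<circ> w)"
  unfolding signed_permutation_def
proof (intro conjI ballI)
  show "orthogonal_transformation (v \<circ> w)"
    using assms unfolding signed_permutation_def by (intro orthogonal_transformation_compose) auto
  fix i assume "i \<in> {1..CARD('n)}"
  then obtain s j where 1: "s \<in> {1, -1}" "j \<in> {1..CARD('n)}" "w (ee i) = s *\<^sub>R ee j"
    by (rule signed_permutationE[OF w])
  from 1(2) obtain t k where 2: "t \<in> {1, -1}" "k \<in> {1..CARD('n)}" "v (ee j) = t *\<^sub>R ee k"
    by (rule signed_permutationE[OF v])
  have "(v \<circ> w) (ee i) = (s * t) *\<^sub>R ee k"
    using 1 2 linear_scale[OF signed_permutation_linear[OF v]] by simp
  moreover have "s * t \<in> {1, -1}" using 1 2 by auto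
  ultimately show "\<exists>k\<in>{1..CARD('n)}. \<exists>s\<in>{1, -1}. (v \<circ> w) (ee i) = s *\<^sub>R ee k"
    using 2(2) by blast
qed

lemma signed_permutation_uminus:
  fixes v :: "real ^ 'n::{finite,linorder} \<Rightarrow> real ^ 'n::{finite,linorder}"
  assumes v: "signed_permutation v"
  shows "signed_permutation (\<lambda>x. - v x)"
  unfolding signed_permutation_def
proof (intro conjI ballI)
  show "orthogonal_transformation (\<lambda>x. - v x)"
    unfolding orthogonal_transformation_def
    using signed_permutation_linear[OF v] signed_permutation_inner[OF v]
    by (simp add: linear_compose_neg)
  fix i assume "i \<in> {1..CARD('n)}"
  then obtain s j where 1: "s \<in> {1, -1}" "j \<in> {1..CARD('n)}" "v (ee i) = s *\<^sub>R ee j"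
    by (rule signed_permutationE[OF v])
  then have "- v (ee i) = (- s) *\<^sub>R ee j" "- s \<in> {1, -1}" by auto
  then show "\<exists>j\<in>{1..CARD('n)}. \<exists>s\<in>{1, -1}. - v (ee i) = s *\<^sub>R ee j" using 1(2) by blast
qed

lemma signed_permutation_roots:
  fixes w :: "real ^ 'n::{finite,linorder} \<Rightarrow> real ^ 'n::{finite,linorder}"
  assumes w: "signed_permutation w" and \<beta>: "\<beta> \<in> roots"
  shows "w \<beta> \<in> roots"
  using \<beta>
proof (cases rule: rootE)
  case (pair a b i k)
  obtain s j where 1: "s \<in> {1, -1}" "j \<in> {1..CARD('n)}" "w (ee i) = s *\<^sub>R ee j"
    by (rule signed_permutationE[OF w pair(4)])
  obtain t m where 2: "t \<in> {1, -1}" "m \<in> {1..CARD('n)}" "w (ee k) = t *\<^sub>R ee m"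
    by (rule signed_permutationE[OF w pair(5)])
  have "w (ee i) \<bullet> w (ee k) = 0"
    using pair signed_permutation_inner[OF w] by (simp add: ee_inner)
  then have "j \<noteq> m" using 1 2 by (auto simp: ee_inner)
  moreover have "w \<beta> = (a * s) *\<^sub>R ee j + (b * t) *\<^sub>R ee m"
    using 1 2 pair signed_permutation_linear[OF w] by (simp add: linear_add linear_scale)
  moreover have "a * s \<in> {1, -1}" "b * t \<in> {1, -1}" using 1 2 pair by auto
  ultimately show ?thesis using pair_in_roots[OF 1(2) 2(2)] by simp
next
  case (double a k)
  obtain t m where 2: "t \<in> {1, -1}" "m \<in> {1..CARD('n)}" "w (ee k) = t *\<^sub>R ee m"
    by (rule signed_permutationE[OF w double(3)])
  then have "w \<beta> = (a * t) *\<^sub>R (2 *\<^sub>R ee m)"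
    using double signed_permutation_linear[OF w] by (simp add: linear_scale)
  moreover have "a * t \<in> {1, -1}" using 2 double by auto
  ultimately show ?thesis using double_in_roots[OF 2(2)] by simp
qed

lemma root_height_nonzero:
  assumes "\<beta> \<in> (roots :: (real ^ 'n::{finite,linorder}) set)"
  shows "height_vector \<bullet> \<beta> \<noteq> 0"
  using assms
proof (cases rule: rootE)
  case (pair a b i k)
  then have "height_vector \<bullet> \<beta> = a * (real CARD('n) + 1 - real i) + b * (real CARD('n) + 1 - real k)"
    by (simp add: inner_add_right height_ee)
  then show ?thesis using pair by auto
next
  case (double a k)
  then have "height_vector \<bullet> \<beta> = a * (2 * (real CARD('n) + 1 - real k))"
    by (simp add: height_ee)
  then show ?thesis using double by auto
qed

lemma reflection_ee:
  assumes "\<alpha> \<in> (roots :: (real ^ 'n::{finite,linorder}) set)" "m \<in> {1..CARD('n)}"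
  shows "\<exists>j\<in>{1..CARD('n)}. \<exists>s\<in>{1, -1}. reflection \<alpha> (ee m) = s *\<^sub>R ee j"
  using assms(1)
proof (cases rule: rootE)
  case (pair a b i k)
  have sq: "a * a = 1" "b * b = 1" using pair by auto
  have n: "\<alpha> \<bullet> \<alpha> = 2"
    using pair sq by (simp add: inner_add_left inner_add_right ee_inner)
  have m: "\<alpha> \<bullet> ee m = (if m = i then a else if m = k then b else 0)"
    using pair assms(2) by (auto simp: inner_add_left ee_inner)
  have r: "reflection \<alpha> (ee m) = ee m - (\<alpha> \<bullet> ee m) *\<^sub>R \<alpha>"
    by (simp add: reflection_def n)
  consider "m = i" | "m = k" | "m \<noteq> i" "m \<noteq> k" by blast
  then show ?thesis
  proof cases
    case 1
    then have "reflection \<alpha> (ee m) = (- (a * b)) *\<^sub>R ee k"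
      unfolding r m using pair(1) sq by (simp add: scaleR_add_right)
    moreover have "- (a * b) \<in> {1, -1}" using pair by auto
    ultimately show ?thesis using pair by blast
  next
    case 2
    then have "reflection \<alpha> (ee m) = (- (b * a)) *\<^sub>R ee i"
      unfolding r m using pair(1,6) sq by (simp add: scaleR_add_right)
    moreover have "- (b * a) \<in> {1, -1}" using pair by auto
    ultimately show ?thesis using pair by blast
  next
    case 3
    then have "reflection \<alpha> (ee m) = 1 *\<^sub>R ee m" unfolding r m by simp
    then show ?thesis using assms(2) by blast
  qed
next
  case (double a k)
  have sq: "a * a = 1" using double by auto
  have n: "\<alpha> \<bullet> \<alpha> = 4" using double sq by (simp add: ee_inner)
  have m: "\<alpha> \<bullet> ee m = (if m = k then 2 * a else 0)"
    using double assms(2) by (auto simp: ee_inner)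
  have "reflection \<alpha> (ee m) = (if m = k then -1 else 1) *\<^sub>R ee m"
    unfolding reflection_def n m using double(1,2) by (auto simp: scaleR_2)
  then show ?thesis using assms(2) by (cases "m = k") auto
qed

lemma reflection_signed_permutation: "\<alpha> \<in> roots \<Longrightarrow> signed_permutation (reflection \<alpha>)"
  unfolding signed_permutation_def using orthogonal_reflection reflection_ee by blast

lemma refl_group_signed_permutation:
  fixes w :: "real ^ 'n::{finite,linorder} \<Rightarrow> real ^ 'n::{finite,linorder}"
  assumes "w \<in> refl_group S" "S \<subseteq> roots"
  shows "signed_permutation w"
proof -
  obtain as where as: "set as \<subseteq> S" "w = refl_product as" using assms by (auto simp: refl_group_eq)
  from as(1) have "signed_permutation (refl_product as)"
  proof (induction as)
    case Nil
    then show ?case using signed_permutation_id by (simp only: refl_product_simps)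
  next
    case (Cons a as)
    then have "a \<in> roots" using assms by auto
    then show ?case using Cons unfolding refl_product_simps
      by (intro signed_permutation_compose reflection_signed_permutation) auto
  qed
  then show ?thesis using as by simp
qed

lemma simple_root_in_roots:
  assumes "i \<in> {1..CARD('n::{finite,linorder})}"
  shows "simple_root i \<in> (roots :: (real, 'n) vec set)"
proof (cases "i < CARD('n)")
  case True
  then show ?thesis
    using pair_in_roots[where 'n='n, of i "i + 1" 1 "-1"] assms by (simp add: simple_root_def)
next
  case False
  then show ?thesis
    using double_in_roots[where 'n='n, of i 1] assms by (simp add: simple_root_def)
qed

lemma height_simple_root:
  assumes "i \<in> {1..CARD('n::{finite,linorder})}"
  shows "0 < height_vector \<bullet> (simple_root i :: (real, 'n) vec)"
  using assms by (auto simp: simple_root_def inner_diff_right height_ee)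

lemma reflection_simple_root_ee:
  assumes "i \<in> {1..CARD('n::{finite,linorder})}" "m \<in> {1..CARD('n)}"
  shows "reflection (simple_root i) (ee m :: (real, 'n) vec) =
    (if i < CARD('n) then ee (if m = i then i + 1 else if m = i + 1 then i else m)
     else if m = i then - ee m else ee m)"
proof (cases "i < CARD('n)")
  case True
  let ?\<alpha> = "ee i - ee (i + 1) :: (real, 'n) vec"
  have n: "?\<alpha> \<bullet> ?\<alpha> = 2"
    using True assms by (simp add: inner_diff_left inner_diff_right ee_inner)
  have m: "?\<alpha> \<bullet> ee m = (if m = i then 1 else if m = i + 1 then -1 else 0)"
    using assms True by (auto simp: inner_diff_left ee_inner)
  have "reflection ?\<alpha> (ee m) = ee m - (?\<alpha> \<bullet> ee m) *\<^sub>R ?\<alpha>"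
    unfolding reflection_def n by simp
  then show ?thesis unfolding m using True by (simp add: simple_root_def)
next
  case False
  let ?\<alpha> = "2 *\<^sub>R ee i :: (real, 'n) vec"
  have n: "?\<alpha> \<bullet> ?\<alpha> = 4" using assms by (simp add: ee_inner)
  have m: "?\<alpha> \<bullet> ee m = (if m = i then 2 else 0)" using assms by (auto simp: ee_inner)
  have "reflection ?\<alpha> (ee m) = ee m - (if m = i then 2 else 0) *\<^sub>R ee i"
    unfolding reflection_def n m by simp
  then show ?thesis using False by (simp add: simple_root_def scaleR_2)
qed

text \<open>
The reflection in \<open>e\<^sub>i - e\<^bsub>i+1\<^esub>\<close> exchanges two neighbouring coordinates, which inverts the order of no
other pair of indices; the one in \<open>2 e\<^sub>l\<close> only changes the sign of the last coordinate, which has the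
smallest height.
\<close>

lemma reflection_simple_root_positive:
  fixes \<beta> :: "real ^ 'n::{finite,linorder}"
  assumes i: "i \<in> {1..CARD('n)}" and \<beta>: "\<beta> \<in> roots" and pos: "0 < height_vector \<bullet> \<beta>"
    and neq: "\<beta> \<noteq> simple_root i"
  shows "0 < height_vector \<bullet> reflection (simple_root i) \<beta>"
proof -
  let ?s = "reflection (simple_root i :: (real, 'n) vec)"
  have lin: "linear ?s" using orthogonal_reflection[of "simple_root i :: (real, 'n) vec"] by (simp add: orthogonal_transformation_def)
  show ?thesis
    using \<beta>
  proof (cases rule: rootE)
    case (pair a b j k)
    have h: "height_vector \<bullet> \<beta> = a * (real CARD('n) + 1 - real j) + b * (real CARD('n) + 1 - real k)"
      using pair by (simp add: inner_add_right height_ee)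
    have a: "a = 1" using pos pair unfolding h by auto
    have s: "?s \<beta> = ?s (ee j) + b *\<^sub>R ?s (ee k)"
      using pair a lin by (simp add: linear_add linear_scale)
    show ?thesis
    proof (cases "i < CARD('n)")
      case True
      define t where "t m = (if m = i then i + 1 else if m = i + 1 then i else m)" for m
      have t: "t m \<in> {1..CARD('n)}" if "m \<in> {1..CARD('n)}" for m
        using that True i by (auto simp: t_def)
      have "?s (ee m) = ee (t m)" if "m \<in> {1..CARD('n)}" for m
        using reflection_simple_root_ee[OF i that] True by (simp add: t_def)
      then have hs: "height_vector \<bullet> ?s \<beta> = (real CARD('n) + 1 - real (t j)) + b * (real CARD('n) + 1 - real (t k))"
        unfolding s using pair t by (simp add: inner_add_right height_ee)
      show ?thesis
      proof (cases "b = 1")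
        case True
        then show ?thesis unfolding hs using t[of j] t[of k] pair by simp
      next
        case False
        then have b: "b = -1" using pair by simp
        then have "\<not> (j = i \<and> k = i + 1)" using neq pair(1) a True by (auto simp: simple_root_def)
        then have "t j < t k" using pair by (auto simp: t_def)
        then show ?thesis unfolding hs b by simp
      qed
    next
      case False
      then have i: "i = CARD('n)" using i by simp
      have "?s (ee j) = ee j" "?s (ee k) = ee k \<or> ?s (ee k) = - ee k"
        using reflection_simple_root_ee[OF \<open>i \<in> _\<close>, of j] reflection_simple_root_ee[OF \<open>i \<in> _\<close>, of k]
          pair i by auto
      then have "height_vector \<bullet> ?s \<beta> = (real CARD('n) + 1 - real j) + b * (real CARD('n) + 1 - real k)
         \<or> height_vector \<bullet> ?s \<beta> = (real CARD('n) + 1 - real j) - b * (real CARD('n) + 1 - real k)"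
        unfolding s using pair by (auto simp: inner_add_right height_ee)
      then show ?thesis using pair by auto
    qed
  next
    case (double a k)
    have h: "height_vector \<bullet> \<beta> = a * (2 * (real CARD('n) + 1 - real k))"
      using double by (simp add: height_ee)
    have a: "a = 1" using pos double unfolding h by auto
    have s: "?s \<beta> = 2 *\<^sub>R ?s (ee k)"
      using double a lin by (simp add: linear_scale)
    have "\<exists>j\<in>{1..CARD('n)}. ?s (ee k) = ee j"
      using reflection_simple_root_ee[OF i double(3)] i double neq a
      by (auto simp: simple_root_def split: if_splits)
    then show ?thesis unfolding s by (auto simp: height_ee)
  qed
qed

section \<open>The longest elements and their product\<close>

text \<open>
There is no room for gaps: \<open>f i \<ge> i\<close> follows by counting up from \<open>1\<close>, and \<open>f i \<le> i\<close> by counting down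
from \<open>l\<close>.
\<close>

lemma increasing_fills_interval:
  fixes f :: "nat \<Rightarrow> int"
  assumes inc: "\<And>i. i \<in> {1..<l} \<Longrightarrow> f i < f (i + 1)"
    and range: "\<And>i. i \<in> {1..l} \<Longrightarrow> 1 \<le> f i \<and> f i \<le> int l"
    and i: "i \<in> {1..l}"
  shows "f i = int i"
proof -
  have "1 \<le> i" "i \<le> l" using i by auto
  from this have "int i \<le> f i"
  proof (induction i rule: dec_induct)
    case base
    then show ?case using range[of 1] by simp
  next
    case (step n)
    then show ?case using inc[of n] by simp
  qed
  moreover from \<open>i \<le> l\<close> \<open>1 \<le> i\<close> have "f i \<le> int i"
  proof (induction i rule: inc_induct)
    case base
    then show ?case using range[of l] by simp
  next
    case (step n)
    then show ?case using inc[of n] by simp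
  qed
  ultimately show ?thesis by simp
qed

lemma signed_permutation_height:
  fixes v :: "real ^ 'n::{finite,linorder} \<Rightarrow> real ^ 'n::{finite,linorder}"
  assumes v: "signed_permutation v" and i: "i \<in> {1..CARD('n)}"
  obtains g :: int where "height_vector \<bullet> v (ee i) = real_of_int g" "\<bar>g\<bar> \<in> {1..int CARD('n)}"
proof -
  obtain s j where 1: "s \<in> {1, -1}" "j \<in> {1..CARD('n)}" "v (ee i) = s *\<^sub>R ee j"
    using i by (rule signed_permutationE[OF v])
  have "height_vector \<bullet> v (ee i) = real_of_int ((if s = 1 then 1 else -1) * (int CARD('n) + 1 - int j))"
    using 1 by (auto simp: height_ee)
  moreover have "\<bar>(if s = 1 then 1 else -1) * (int CARD('n) + 1 - int j)\<bar> \<in> {1..int CARD('n)}"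
    using 1 by auto
  ultimately show thesis by (rule that)
qed

lemma signed_permutation_eqI_height:
  fixes v w :: "real ^ 'n::{finite,linorder} \<Rightarrow> real ^ 'n::{finite,linorder}"
  assumes v: "signed_permutation v" and w: "signed_permutation w"
    and eq: "\<And>i. i \<in> {1..CARD('n)} \<Longrightarrow> height_vector \<bullet> v (ee i) = height_vector \<bullet> w (ee i)"
  shows "v = w"
proof (rule linear_eqI_ee[OF signed_permutation_linear[OF v] signed_permutation_linear[OF w]])
  fix i assume i: "i \<in> {1..CARD('n)}"
  obtain s j where 1: "s \<in> {1, -1}" "j \<in> {1..CARD('n)}" "v (ee i) = s *\<^sub>R ee j"
    using i by (rule signed_permutationE[OF v])
  obtain t k where 2: "t \<in> {1, -1}" "k \<in> {1..CARD('n)}" "w (ee i) = t *\<^sub>R ee k"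
    using i by (rule signed_permutationE[OF w])
  have "s * (real CARD('n) + 1 - real j) = t * (real CARD('n) + 1 - real k)"
    using eq[OF i] 1 2 by (simp add: height_ee)
  then have "s = t \<and> j = k" using 1 2 by auto
  then show "v (ee i) = w (ee i)" using 1 2 by simp
qed

definition reverse_coords :: "real ^ 'n::{finite,linorder} \<Rightarrow> real ^ 'n::{finite,linorder}" where
  "reverse_coords x = (\<Sum>k=1..CARD('n). (ee (CARD('n) + 1 - k) \<bullet> x) *\<^sub>R ee k)"

lemma ee_reverse_coords:
  assumes "k \<in> {1..CARD('n::{finite,linorder})}"
  shows "ee k \<bullet> reverse_coords (x :: (real, 'n) vec) = ee (CARD('n) + 1 - k) \<bullet> x"
  unfolding reverse_coords_def by (rule inner_sum_ee[OF assms])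

lemma inner_eq_sum_ee:
  fixes x y :: "real ^ 'n::{finite,linorder}"
  shows "x \<bullet> y = (\<Sum>k=1..CARD('n). (ee k \<bullet> x) * (ee k \<bullet> y))"
proof -
  have "x \<bullet> y = (\<Sum>b\<in>ee ` {1..CARD('n)}. (x \<bullet> b) * (y \<bullet> b))"
    unfolding Basis_eq_ee[symmetric] by (rule euclidean_inner)
  also have "\<dots> = (\<Sum>k=1..CARD('n). (x \<bullet> ee k) * (y \<bullet> ee k))"
    using sum.reindex[OF bij_betw_imp_inj_on[OF bij_betw_ee[where 'n='n]]] by simp
  finally show ?thesis by (simp only: inner_commute)
qed

lemma reverse_coords_ee:
  assumes "i \<in> {1..CARD('n::{finite,linorder})}"
  shows "reverse_coords (ee i :: (real, 'n) vec) = ee (CARD('n) + 1 - i)"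
proof (rule eqI_ee)
  fix k assume k: "k \<in> {1..CARD('n)}"
  show "ee k \<bullet> reverse_coords (ee i :: (real, 'n) vec) =
      ee k \<bullet> (ee (CARD('n) + 1 - i) :: (real, 'n) vec)"
    unfolding ee_reverse_coords[OF k] using k assms by (subst (1 2) ee_inner) auto
qed

lemma signed_permutation_reverse_coords: "signed_permutation (reverse_coords :: (real ^ 'n::{finite,linorder} \<Rightarrow> _))"
  unfolding signed_permutation_def orthogonal_transformation_def
proof (intro conjI ballI allI)
  show "linear (reverse_coords :: (real, 'n) vec \<Rightarrow> _)"
    by (rule linearI; rule eqI_ee) (simp_all add: ee_reverse_coords inner_add_right)
  show "reverse_coords x \<bullet> reverse_coords y = x \<bullet> y" for x y :: "(real, 'n) vec"
  proof -
    have "reverse_coords x \<bullet> reverse_coords y = (\<Sum>k=1..CARD('n). (ee (CARD('n) + 1 - k) \<bullet> x) * (ee (CARD('n) + 1 - k) \<bullet> y))"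
      unfolding inner_eq_sum_ee[of "reverse_coords x"] by (intro sum.cong) (simp_all add: ee_reverse_coords)
    also have "\<dots> = (\<Sum>k=1..CARD('n). (ee k \<bullet> x) * (ee k \<bullet> y))"
      by (rule sum.atLeastAtMost_rev[symmetric])
    finally show ?thesis unfolding inner_eq_sum_ee[of x] .
  qed
  fix i assume i: "i \<in> {1..CARD('n)}"
  show "\<exists>j\<in>{1..CARD('n)}. \<exists>s\<in>{1, -1}. reverse_coords (ee i :: (real, 'n) vec) = s *\<^sub>R ee j"
    using reverse_coords_ee[OF i] i by (intro bexI[of _ "CARD('n) + 1 - i"] bexI[of _ 1]) auto
qed

text \<open>
The heights of the images are \<open>l\<close> distinct integers in \<open>{1..l}\<close>; being monotone they are determined,
and they determine \<open>v\<close>. The same reasoning with decreasing heights singles out the identity.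
\<close>

lemma increasing_signed_permutation:
  fixes v :: "real ^ 'n::{finite,linorder} \<Rightarrow> real ^ 'n::{finite,linorder}"
  assumes v: "signed_permutation v"
    and pos: "\<And>i. i \<in> {1..CARD('n)} \<Longrightarrow> 0 < height_vector \<bullet> v (ee i)"
    and inc: "\<And>i. i \<in> {1..<CARD('n)} \<Longrightarrow> height_vector \<bullet> v (ee i) < height_vector \<bullet> v (ee (i + 1))"
  shows "v = reverse_coords"
proof (rule signed_permutation_eqI_height[OF v signed_permutation_reverse_coords])
  define g where "g i = \<lfloor>height_vector \<bullet> v (ee i)\<rfloor>" for i
  have g: "height_vector \<bullet> v (ee i) = real_of_int (g i) \<and> 1 \<le> g i \<and> g i \<le> int CARD('n)"
    if i: "i \<in> {1..CARD('n)}" for i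
  proof -
    obtain h where "height_vector \<bullet> v (ee i) = real_of_int h" "\<bar>h\<bar> \<in> {1..int CARD('n)}"
      using v i by (rule signed_permutation_height)
    then show ?thesis using pos[OF i] by (simp add: g_def)
  qed
  have mono: "g i < g (i + 1)" if "i \<in> {1..<CARD('n)}" for i
    using inc[OF that] g[of i] g[of "i + 1"] that by simp
  fix i assume i: "i \<in> {1..CARD('n)}"
  have "g i = int i"
    by (rule increasing_fills_interval[where f = g and l = "CARD('n)", OF mono _ i]) (use g in auto)
  then show "height_vector \<bullet> v (ee i) = height_vector \<bullet> reverse_coords (ee i :: (real, 'n) vec)"
    using g[OF i] i by (subst reverse_coords_ee[OF i], subst height_ee) auto
qed

lemma decreasing_signed_permutation:
  fixes v :: "real ^ 'n::{finite,linorder} \<Rightarrow> real ^ 'n::{finite,linorder}"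
  assumes v: "signed_permutation v"
    and pos: "\<And>i. i \<in> {1..CARD('n)} \<Longrightarrow> 0 < height_vector \<bullet> v (ee i)"
    and dec: "\<And>i. i \<in> {1..<CARD('n)} \<Longrightarrow> height_vector \<bullet> v (ee (i + 1)) < height_vector \<bullet> v (ee i)"
  shows "v = id"
proof (rule signed_permutation_eqI_height[OF v signed_permutation_id])
  define g where "g i = int CARD('n) + 1 - \<lfloor>height_vector \<bullet> v (ee i)\<rfloor>" for i
  have g: "height_vector \<bullet> v (ee i) = real_of_int (int CARD('n) + 1 - g i) \<and> 1 \<le> g i \<and> g i \<le> int CARD('n)"
    if i: "i \<in> {1..CARD('n)}" for i
  proof -
    obtain h where "height_vector \<bullet> v (ee i) = real_of_int h" "\<bar>h\<bar> \<in> {1..int CARD('n)}"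
      using v i by (rule signed_permutation_height)
    then show ?thesis using pos[OF i] by (simp add: g_def)
  qed
  have mono: "g i < g (i + 1)" if "i \<in> {1..<CARD('n)}" for i
    using dec[OF that] g[of i] g[of "i + 1"] that by simp
  fix i assume i: "i \<in> {1..CARD('n)}"
  have "g i = int i"
    by (rule increasing_fills_interval[where f = g and l = "CARD('n)", OF mono _ i]) (use g in auto)
  then show "height_vector \<bullet> v (ee i) = height_vector \<bullet> id (ee i :: (real, 'n) vec)"
    using g[OF i] height_ee[OF i] by simp
qed

lemma simple_positive_imp_id:
  fixes v :: "real ^ 'n::{finite,linorder} \<Rightarrow> real ^ 'n::{finite,linorder}"
  assumes v: "signed_permutation v"
    and pos: "\<And>i. i \<in> {1..CARD('n)} \<Longrightarrow> 0 < height_vector \<bullet> v (simple_root i)"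
  shows "v = id"
proof -
  have lin: "linear v" using v by (rule signed_permutation_linear)
  have dec: "height_vector \<bullet> v (ee (i + 1)) < height_vector \<bullet> v (ee i)" if "i \<in> {1..<CARD('n)}" for i
    using pos[of i] that lin by (simp add: simple_root_def linear_diff inner_diff_right)
  have last: "0 < height_vector \<bullet> v (ee CARD('n))"
    using pos[of "CARD('n)"] lin by (simp add: simple_root_def linear_scale Suc_leI)
  show ?thesis
  proof (rule decreasing_signed_permutation[OF v _ dec])
    fix i assume "i \<in> {1..CARD('n)}"
    then have "i \<le> CARD('n)" "1 \<le> i" by auto
    then show "0 < height_vector \<bullet> v (ee i)"
    proof (induction i rule: inc_induct)
      case base
      then show ?case using last by simp
    next
      case (step n)
      then show ?case using dec[of n] by simp
    qed
  qed
qed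

text \<open>
The full positive system of type \<open>C\<close> is used for counting inversions, whatever the set \<open>S\<close> of simple
roots is.
\<close>

lemma longest_element_of_simple_subset:
  fixes S :: "(real ^ 'n::{finite,linorder}) set"
  assumes S: "S \<subseteq> simple_root ` {1..CARD('n)}"
    and lowest: "\<forall>v\<in>refl_group S. (\<forall>\<alpha>\<in>S. 0 < height_vector \<bullet> v \<alpha>) \<longrightarrow> v = id"
    and highest: "\<forall>v\<in>refl_group S. (\<forall>\<alpha>\<in>S. height_vector \<bullet> v \<alpha> < 0) \<longrightarrow> v = w0"
  shows "longest_element S = w0" and "w0 \<in> refl_group S"
proof -
  have roots: "S \<subseteq> roots"
  proof
    fix \<alpha> assume "\<alpha> \<in> S"
    then obtain i where "i \<in> {1..CARD('n)}" "\<alpha> = simple_root i" using S by blast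
    then show "\<alpha> \<in> roots" using simple_root_in_roots by simp
  qed
  have simple: "\<forall>\<alpha>\<in>S. \<alpha> \<in> roots \<and> 0 < height_vector \<bullet> \<alpha>"
  proof (intro ballI conjI)
    fix \<alpha> assume \<alpha>: "\<alpha> \<in> S"
    then show "\<alpha> \<in> roots" using roots by blast
    from \<alpha> obtain i where "i \<in> {1..CARD('n)}" "\<alpha> = simple_root i" using S by blast
    then show "0 < height_vector \<bullet> \<alpha>" using height_simple_root by simp
  qed
  have perm: "\<forall>\<alpha>\<in>S. \<forall>\<beta>\<in>roots. 0 < height_vector \<bullet> \<beta> \<and> \<beta> \<noteq> \<alpha> \<longrightarrow>
      reflection \<alpha> \<beta> \<in> roots \<and> 0 < height_vector \<bullet> reflection \<alpha> \<beta>"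
  proof (intro ballI impI conjI)
    fix \<alpha> \<beta> assume \<alpha>: "\<alpha> \<in> S" and \<beta>: "\<beta> \<in> roots" "0 < height_vector \<bullet> \<beta> \<and> \<beta> \<noteq> \<alpha>"
    show "reflection \<alpha> \<beta> \<in> roots"
      using \<alpha> roots by (intro signed_permutation_roots[OF reflection_signed_permutation] \<beta>(1)) blast
    obtain i where i: "i \<in> {1..CARD('n)}" "\<alpha> = simple_root i" using \<alpha> S by blast
    show "0 < height_vector \<bullet> reflection \<alpha> \<beta>"
      using reflection_simple_root_positive[OF i(1) \<beta>(1)] \<beta>(2) unfolding i(2) by blast
  qed
  have regular: "\<forall>v\<in>refl_group S. \<forall>\<alpha>\<in>S. height_vector \<bullet> v \<alpha> \<noteq> 0"
  proof (intro ballI)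
    fix v \<alpha> assume v: "v \<in> refl_group S" and "\<alpha> \<in> S"
    then have "\<alpha> \<in> roots" using roots by blast
    then show "height_vector \<bullet> v \<alpha> \<noteq> 0"
      by (rule root_height_nonzero[OF signed_permutation_roots[OF refl_group_signed_permutation[OF v roots]]])
  qed
  note longest = longest_element_eqI[OF finite_roots simple perm regular lowest highest]
  show "longest_element S = w0" by (rule longest(1))
  show "w0 \<in> refl_group S" by (rule longest(2))
qed

lemma longest_element_type_C:
  defines "S \<equiv> (simple_root :: _ \<Rightarrow> real ^ 'n::{finite,linorder}) ` {1..CARD('n)}"
  shows "longest_element S = uminus" "uminus \<in> refl_group S"
proof -
  have S: "S \<subseteq> roots" using simple_root_in_roots[where 'n='n] by (auto simp: S_def)
  note sp = refl_group_signed_permutation[OF _ S]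
  have lowest: "\<forall>v\<in>refl_group S. (\<forall>\<alpha>\<in>S. 0 < height_vector \<bullet> v \<alpha>) \<longrightarrow> v = id"
  proof (intro ballI impI)
    fix v assume v: "v \<in> refl_group S" and "\<forall>\<alpha>\<in>S. 0 < height_vector \<bullet> v \<alpha>"
    then show "v = id" by (intro simple_positive_imp_id[OF sp[OF v]]) (simp add: S_def)
  qed
  have highest: "\<forall>v\<in>refl_group S. (\<forall>\<alpha>\<in>S. height_vector \<bullet> v \<alpha> < 0) \<longrightarrow> v = uminus"
  proof (intro ballI impI)
    fix v assume v: "v \<in> refl_group S" and neg: "\<forall>\<alpha>\<in>S. height_vector \<bullet> v \<alpha> < 0"
    have "(\<lambda>x. - v x) = id"
    proof (rule simple_positive_imp_id[OF signed_permutation_uminus[OF sp[OF v]]])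
      fix i assume "i \<in> {1..CARD('n)}"
      then show "0 < height_vector \<bullet> - v (simple_root i)" using neg by (simp add: S_def)
    qed
    then have "- v x = x" for x by (metis id_apply)
    then have "v x = - x" for x by (metis minus_minus)
    then show "v = uminus" by (rule ext)
  qed
  have sub: "S \<subseteq> simple_root ` {1..CARD('n)}" unfolding S_def by (rule subset_refl)
  note longest = longest_element_of_simple_subset[OF sub lowest highest]
  show "longest_element S = uminus" by (rule longest(1))
  show "uminus \<in> refl_group S" by (rule longest(2))
qed

text \<open>
Without the last simple root, the group permutes the basis vectors with no signs. So the heights of
their images stay positive, and an element that makes all these simple roots negative makes them
increase.
\<close>

lemma longest_element_type_A:
  defines "S \<equiv> (simple_root :: _ \<Rightarrow> real ^ 'n::{finite,linorder}) ` {1..<CARD('n)}"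
  shows "longest_element S = reverse_coords" "reverse_coords \<in> refl_group S"
proof -
  have S: "S \<subseteq> roots" using simple_root_in_roots[where 'n='n] by (auto simp: S_def)
  note sp = refl_group_signed_permutation[OF _ S]
  have ee: "\<exists>j\<in>{1..CARD('n)}. v (ee i) = ee j" if v: "v \<in> refl_group S" and i: "i \<in> {1..CARD('n)}" for v i
  proof -
    obtain as where as: "set as \<subseteq> S" "v = refl_product as" using v by (auto simp: refl_group_eq)
    from as(1) have "\<exists>j\<in>{1..CARD('n)}. refl_product as (ee i) = ee j"
    proof (induction as)
      case Nil
      then show ?case using i by auto
    next
      case (Cons a as)
      then obtain j k where j: "j \<in> {1..CARD('n)}" "refl_product as (ee i) = ee j"
        and k: "k \<in> {1..<CARD('n)}" "a = simple_root k" by (auto simp: S_def)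
      have "refl_product (a # as) (ee i) = ee (if j = k then k + 1 else if j = k + 1 then k else j)"
        using reflection_simple_root_ee[where 'n='n, of k j] j k by simp
      moreover have "(if j = k then k + 1 else if j = k + 1 then k else j) \<in> {1..CARD('n)}"
        using j k by auto
      ultimately show ?case by blast
    qed
    then show ?thesis using as by simp
  qed
  have eepos: "0 < height_vector \<bullet> v (ee i)" if "v \<in> refl_group S" "i \<in> {1..CARD('n)}" for v i
    using ee[OF that] by (auto simp: height_ee)
  have step: "height_vector \<bullet> v (simple_root i) = height_vector \<bullet> v (ee i) - height_vector \<bullet> v (ee (i + 1))"
    if "v \<in> refl_group S" "i \<in> {1..<CARD('n)}" for v i
    using signed_permutation_linear[OF sp[OF that(1)]] that(2)
    by (simp add: simple_root_def linear_diff inner_diff_right)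
  have lowest: "\<forall>v\<in>refl_group S. (\<forall>\<alpha>\<in>S. 0 < height_vector \<bullet> v \<alpha>) \<longrightarrow> v = id"
  proof (intro ballI impI)
    fix v assume v: "v \<in> refl_group S" and pos: "\<forall>\<alpha>\<in>S. 0 < height_vector \<bullet> v \<alpha>"
    show "v = id"
    proof (rule decreasing_signed_permutation[OF sp[OF v] eepos[OF v]])
      fix i assume i: "i \<in> {1..<CARD('n)}"
      then have "0 < height_vector \<bullet> v (simple_root i)" using pos by (simp add: S_def)
      then show "height_vector \<bullet> v (ee (i + 1)) < height_vector \<bullet> v (ee i)" using step[OF v i] by simp
    qed
  qed
  have highest: "\<forall>v\<in>refl_group S. (\<forall>\<alpha>\<in>S. height_vector \<bullet> v \<alpha> < 0) \<longrightarrow> v = reverse_coords"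
  proof (intro ballI impI)
    fix v assume v: "v \<in> refl_group S" and neg: "\<forall>\<alpha>\<in>S. height_vector \<bullet> v \<alpha> < 0"
    show "v = reverse_coords"
    proof (rule increasing_signed_permutation[OF sp[OF v] eepos[OF v]])
      fix i assume i: "i \<in> {1..<CARD('n)}"
      then have "height_vector \<bullet> v (simple_root i) < 0" using neg by (simp add: S_def)
      then show "height_vector \<bullet> v (ee i) < height_vector \<bullet> v (ee (i + 1))" using step[OF v i] by simp
    qed
  qed
  have sub: "S \<subseteq> simple_root ` {1..CARD('n)}" unfolding S_def by (intro image_mono) auto
  note longest = longest_element_of_simple_subset[OF sub lowest highest]
  show "longest_element S = reverse_coords" by (rule longest(1))
  show "reverse_coords \<in> refl_group S" by (rule longest(2))
qed

lemma omega_eq: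
  "omega CARD('n) = (\<lambda>x :: real ^ 'n::{finite,linorder}. reverse_coords (- x))"
  "omega CARD('n) \<in> (weyl_group :: ((real, 'n) vec \<Rightarrow> (real, 'n) vec) set)"
proof -
  have sets: "{1..CARD('n)} - {CARD('n)} = {1..<CARD('n)}" by auto
  show "omega CARD('n) = (\<lambda>x :: (real, 'n) vec. reverse_coords (- x))"
    unfolding omega_def sets longest_element_type_A longest_element_type_C by (auto simp: o_def)
  have "simple_root ` {1..<CARD('n)} \<subseteq> (roots :: (real, 'n) vec set)"
    "simple_root ` {1..CARD('n)} \<subseteq> (roots :: (real, 'n) vec set)"
    using simple_root_in_roots[where 'n='n] by auto
  then have "reverse_coords \<in> (weyl_group :: ((real, 'n) vec \<Rightarrow> (real, 'n) vec) set)"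
    "uminus \<in> (weyl_group :: ((real, 'n) vec \<Rightarrow> (real, 'n) vec) set)"
    unfolding weyl_group_def using longest_element_type_A(2) longest_element_type_C(2) refl_group_mono
    by blast+
  then have "reverse_coords \<circ> uminus \<in> (weyl_group :: ((real, 'n) vec \<Rightarrow> (real, 'n) vec) set)"
    unfolding weyl_group_def by (rule refl_group_compose)
  then show "omega CARD('n) \<in> (weyl_group :: ((real, 'n) vec \<Rightarrow> (real, 'n) vec) set)"
    unfolding \<open>omega CARD('n) = _\<close> comp_def .
qed

section \<open>Coordinates on the coweight lattice\<close>

definition half_vector :: "(nat \<Rightarrow> int) \<Rightarrow> real ^ 'n::{finite,linorder}" where
  "half_vector y = (\<Sum>k=1..CARD('n). (real_of_int (y k) / 2) *\<^sub>R ee k)"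

lemma ee_half_vector:
  assumes "k \<in> {1..CARD('n::{finite,linorder})}"
  shows "ee k \<bullet> (half_vector y :: (real, 'n) vec) = real_of_int (y k) / 2"
  unfolding half_vector_def by (rule inner_sum_ee[OF assms])

lemma half_vector_diff:
  "half_vector y - half_vector z = (half_vector (\<lambda>k. y k - z k) :: real ^ 'n::{finite,linorder})"
  by (rule eqI_ee) (simp add: inner_diff_right ee_half_vector diff_divide_distrib)

lemma half_vector_scale:
  "real_of_int c *\<^sub>R half_vector y = (half_vector (\<lambda>k. c * y k) :: real ^ 'n::{finite,linorder})"
  by (rule eqI_ee) (simp add: ee_half_vector)

lemma half_vector_eq_iff:
  "(half_vector y :: real ^ 'n::{finite,linorder}) = half_vector z \<longleftrightarrow> (\<forall>k\<in>{1..CARD('n)}. y k = z k)"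
proof
  assume eq: "(half_vector y :: (real, 'n) vec) = half_vector z"
  show "\<forall>k\<in>{1..CARD('n)}. y k = z k"
  proof
    fix k assume k: "k \<in> {1..CARD('n)}"
    have "real_of_int (y k) / 2 = real_of_int (z k) / 2"
      using ee_half_vector[OF k, of y] ee_half_vector[OF k, of z] by (simp only: eq)
    then show "y k = z k" by simp
  qed
next
  assume "\<forall>k\<in>{1..CARD('n)}. y k = z k"
  then show "(half_vector y :: (real, 'n) vec) = half_vector z"
    unfolding half_vector_def by (intro sum.cong) auto
qed

definition equal_parity :: "nat \<Rightarrow> (nat \<Rightarrow> int) \<Rightarrow> bool" where
  "equal_parity l y \<longleftrightarrow> (\<forall>i\<in>{1..l}. \<forall>j\<in>{1..l}. y i mod 2 = y j mod 2)"

lemma sign_eq_of_int: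
  assumes "a \<in> {1, -1 :: real}"
  obtains c :: int where "a = real_of_int c" "c \<in> {1, -1}"
  using assms by (intro that[of "if a = 1 then 1 else -1"]) auto

lemma root_half_vector:
  assumes "i \<in> {1..CARD('n::{finite,linorder})}" "k \<in> {1..CARD('n)}"
  shows "(a *\<^sub>R ee i + b *\<^sub>R ee k) \<bullet> (half_vector y :: (real, 'n) vec)
       = (a * real_of_int (y i) + b * real_of_int (y k)) / 2"
  using assms by (simp add: inner_add_left ee_half_vector add_divide_distrib)

lemma double_root_half_vector:
  assumes "k \<in> {1..CARD('n::{finite,linorder})}"
  shows "(a *\<^sub>R (2 *\<^sub>R ee k)) \<bullet> (half_vector y :: (real, 'n) vec) = a * real_of_int (y k)"
  using assms by (simp add: ee_half_vector)

text \<open>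
Pairing with \<open>2 e\<^sub>k\<close> shows that the doubled coordinates are integers, and pairing with \<open>e\<^sub>i - e\<^sub>k\<close> shows
that they have the same parity.
\<close>

lemma coweight_lattice_eq:
  "(coweight_lattice :: (real ^ 'n::{finite,linorder}) set) = half_vector ` {y. equal_parity CARD('n) y}"
proof (intro equalityI subsetI)
  fix x :: "(real, 'n) vec" assume "x \<in> coweight_lattice"
  then have int: "\<And>\<alpha>. \<alpha> \<in> roots \<Longrightarrow> \<alpha> \<bullet> x \<in> \<int>" by (simp add: coweight_lattice_def)
  define y where "y k = \<lfloor>2 * (ee k \<bullet> x)\<rfloor>" for k
  have y: "ee k \<bullet> x = real_of_int (y k) / 2" if "k \<in> {1..CARD('n)}" for k
  proof -
    have "1 *\<^sub>R (2 *\<^sub>R ee k) \<bullet> x \<in> \<int>" by (intro int double_in_roots that) simp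
    then have "2 * (ee k \<bullet> x) \<in> \<int>" by simp
    then have "real_of_int (y k) = 2 * (ee k \<bullet> x)" unfolding y_def by (auto elim: Ints_cases)
    then show ?thesis by simp
  qed
  have "x = half_vector y" by (rule eqI_ee) (simp add: ee_half_vector y)
  moreover have "equal_parity CARD('n) y"
    unfolding equal_parity_def
  proof (intro ballI)
    fix i j assume ij: "i \<in> {1..CARD('n)}" "j \<in> {1..CARD('n)}"
    show "y i mod 2 = y j mod 2"
    proof (cases "i = j")
      case False
      then have "(1 *\<^sub>R ee i + (-1) *\<^sub>R ee j) \<bullet> x \<in> \<int>" by (intro int pair_in_roots ij) auto
      then have "(1 *\<^sub>R ee i + (-1) *\<^sub>R ee j) \<bullet> (half_vector y :: (real, 'n) vec) \<in> \<int>" using \<open>x = half_vector y\<close> by simp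
      then obtain m :: int where "(real_of_int (y i) - real_of_int (y j)) / 2 = real_of_int m"
        unfolding root_half_vector[OF ij] by (auto elim: Ints_cases)
      then have "real_of_int (y i - y j) = real_of_int (2 * m)" by simp
      then have "y i - y j = 2 * m" by (simp only: of_int_eq_iff)
      then show ?thesis by presburger
    qed simp
  qed
  ultimately show "x \<in> half_vector ` {y. equal_parity CARD('n) y}" by blast
next
  fix x :: "(real, 'n) vec" assume "x \<in> half_vector ` {y. equal_parity CARD('n) y}"
  then obtain y where x: "x = half_vector y" and par: "equal_parity CARD('n) y" by blast
  show "x \<in> coweight_lattice"
    unfolding coweight_lattice_def
  proof (intro CollectI ballI)
    fix \<beta> :: "(real, 'n) vec" assume "\<beta> \<in> roots"
    then show "\<beta> \<bullet> x \<in> \<int>"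
    proof (cases rule: rootE)
      case (pair a b i k)
      have "y i mod 2 = y k mod 2" using par pair(4,5) unfolding equal_parity_def by blast
      then have "y k = y i + 2 * ((y k - y i) div 2)" by presburger
      then obtain m where m: "y k = y i + 2 * m" by blast
      obtain a' where a': "a = real_of_int a'" "a' \<in> {1, -1}" by (rule sign_eq_of_int[OF pair(2)])
      obtain b' where b': "b = real_of_int b'" "b' \<in> {1, -1}" by (rule sign_eq_of_int[OF pair(3)])
      note ab = a'(1) b'(1) a'(2) b'(2)
      have "even (a' + b')" using ab(3,4) by auto
      then obtain c where c: "a' + b' = 2 * c" by (elim evenE)
      have "a' * y i + b' * y k = (a' + b') * y i + 2 * b' * m" unfolding m by (simp add: algebra_simps)
      then have "a' * y i + b' * y k = 2 * (c * y i + b' * m)" unfolding c by (simp add: algebra_simps)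
      then have "a * real_of_int (y i) + b * real_of_int (y k) = real_of_int (2 * (c * y i + b' * m))"
        unfolding ab by (metis of_int_add of_int_mult)
      then have "\<beta> \<bullet> x = real_of_int (c * y i + b' * m)"
        unfolding x pair(1) root_half_vector[OF pair(4,5)] by simp
      then show ?thesis by simp
    next
      case (double a k)
      then have "\<beta> \<bullet> x = real_of_int (y k) \<or> \<beta> \<bullet> x = real_of_int (- y k)"
        unfolding x double(1) double_root_half_vector[OF double(3)] by auto
      then show ?thesis by auto
    qed
  qed
qed

text \<open>
In doubled coordinates the scaled lattice consists of \<open>q\<close> times an integer vector of one parity. The two
alternatives are the two parities.
\<close>

lemma scaled_lattice_iff:
  assumes q: "q > 0"
  shows "(half_vector z :: real ^ 'n::{finite,linorder}) \<in> scaled_lattice q \<longleftrightarrow>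
    (\<forall>k\<in>{1..CARD('n)}. 2 * int q dvd z k) \<or> (\<forall>k\<in>{1..CARD('n)}. 2 * int q dvd z k + int q)"
proof
  assume "(half_vector z :: (real, 'n) vec) \<in> scaled_lattice q"
  then obtain y where par: "equal_parity CARD('n) y"
    and "(half_vector z :: (real, 'n) vec) = real_of_int (int q) *\<^sub>R half_vector y"
    unfolding scaled_lattice_def coweight_lattice_eq by auto
  then have z: "\<And>k. k \<in> {1..CARD('n)} \<Longrightarrow> z k = int q * y k"
    unfolding half_vector_scale half_vector_eq_iff by blast
  have "(1::nat) \<in> {1..CARD('n)}" by (simp add: Suc_leI)
  then have par1: "y k mod 2 = y 1 mod 2" if "k \<in> {1..CARD('n)}" for k
    using par that unfolding equal_parity_def by blast
  show "(\<forall>k\<in>{1..CARD('n)}. 2 * int q dvd z k) \<or> (\<forall>k\<in>{1..CARD('n)}. 2 * int q dvd z k + int q)"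
  proof (cases "even (y 1)")
    case True
    have "2 * int q dvd z k" if k: "k \<in> {1..CARD('n)}" for k
    proof -
      have "y k mod 2 = y 1 mod 2" by (rule par1[OF k])
      then have "even (y k)" using True by presburger
      then obtain m where m: "y k = 2 * m" by (elim evenE)
      then have "z k = 2 * int q * m" using z[OF k] by simp
      then show ?thesis by simp
    qed
    then show ?thesis by blast
  next
    case False
    have "2 * int q dvd z k + int q" if k: "k \<in> {1..CARD('n)}" for k
    proof -
      have "y k mod 2 = y 1 mod 2" by (rule par1[OF k])
      then have "odd (y k)" using False by presburger
      then obtain m where "y k = 2 * m + 1" by (elim oddE)
      then have "z k + int q = 2 * int q * (m + 1)" using z[OF k] by (simp add: algebra_simps)
      then show ?thesis by simp
    qed
    then show ?thesis by blast
  qed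
next
  assume *: "(\<forall>k\<in>{1..CARD('n)}. 2 * int q dvd z k) \<or> (\<forall>k\<in>{1..CARD('n)}. 2 * int q dvd z k + int q)"
  have "\<exists>y. equal_parity CARD('n) y \<and> (\<forall>k\<in>{1..CARD('n)}. z k = int q * y k)"
  proof (rule disjE[OF *])
    assume d: "\<forall>k\<in>{1..CARD('n)}. 2 * int q dvd z k"
    have "\<forall>k\<in>{1..CARD('n)}. z k = int q * (2 * (z k div (2 * int q)))"
    proof
      fix k assume "k \<in> {1..CARD('n)}"
      then have "2 * int q * (z k div (2 * int q)) = z k" using d by (simp only: dvd_mult_div_cancel)
      then show "z k = int q * (2 * (z k div (2 * int q)))" by (simp only: mult.assoc mult.left_commute)
    qed
    moreover have "equal_parity CARD('n) (\<lambda>k. 2 * (z k div (2 * int q)))" by (simp add: equal_parity_def)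
    ultimately show ?thesis by blast
  next
    assume d: "\<forall>k\<in>{1..CARD('n)}. 2 * int q dvd z k + int q"
    have "\<forall>k\<in>{1..CARD('n)}. z k = int q * (2 * ((z k + int q) div (2 * int q)) - 1)"
    proof
      fix k assume "k \<in> {1..CARD('n)}"
      then have "2 * int q * ((z k + int q) div (2 * int q)) = z k + int q" using d by (simp only: dvd_mult_div_cancel)
      then have "int q * (2 * ((z k + int q) div (2 * int q))) = z k + int q" by (simp only: mult.assoc mult.left_commute)
      then show "z k = int q * (2 * ((z k + int q) div (2 * int q)) - 1)" by (simp only: right_diff_distrib mult_1_right)
    qed
    moreover have "equal_parity CARD('n) (\<lambda>k. 2 * ((z k + int q) div (2 * int q)) - 1)"
    proof -
      have "(2 * a - 1) mod 2 = (2 * b - 1) mod (2 :: int)" for a b by presburger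
      then show ?thesis unfolding equal_parity_def by blast
    qed
    ultimately show ?thesis by blast
  qed
  then obtain y where y: "equal_parity CARD('n) y" "\<forall>k\<in>{1..CARD('n)}. z k = int q * y k" by blast
  have "(half_vector z :: (real, 'n) vec) = real q *\<^sub>R half_vector y"
    using half_vector_scale[where 'n='n, of "int q" y] half_vector_eq_iff[where 'n='n, THEN iffD2, OF y(2)]
    by (simp only: of_int_of_nat_eq)
  then show "(half_vector z :: (real, 'n) vec) \<in> scaled_lattice q"
    unfolding scaled_lattice_def coweight_lattice_eq using y(1) by blast
qed

lemma coset_eq_iff:
  fixes L :: "'a::ab_group_add set"
  assumes "0 \<in> L" and diff: "\<And>x y. x \<in> L \<Longrightarrow> y \<in> L \<Longrightarrow> x - y \<in> L"
  shows "x +o L = y +o L \<longleftrightarrow> x - y \<in> L"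
proof
  assume "x +o L = y +o L"
  moreover have "x + 0 \<in> x +o L" unfolding elt_set_plus_def using assms(1) by blast
  ultimately obtain b where "b \<in> L" "x + 0 = y + b" unfolding elt_set_plus_def by blast
  then show "x - y \<in> L" by (simp add: algebra_simps)
next
  have add: "a + b \<in> L" if "a \<in> L" "b \<in> L" for a b
    using diff[OF that(1) diff[OF assms(1) that(2)]] by simp
  have *: "u +o L \<subseteq> v +o L" if "u - v \<in> L" for u v
  proof
    fix z assume "z \<in> u +o L"
    then obtain b where "b \<in> L" "z = u + b" unfolding elt_set_plus_def by blast
    then have "z = v + ((u - v) + b)" by simp
    moreover have "(u - v) + b \<in> L" by (rule add[OF that \<open>b \<in> L\<close>])
    ultimately show "z \<in> v +o L" unfolding elt_set_plus_def by blast
  qed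
  assume "x - y \<in> L"
  then have "y - x \<in> L" using diff[OF assms(1)] by (metis diff_0 minus_diff_eq)
  then show "x +o L = y +o L" using * \<open>x - y \<in> L\<close> by blast
qed

lemma coweight_lattice_diff:
  "0 \<in> (coweight_lattice :: (real ^ 'n::{finite,linorder}) set)"
  "x \<in> coweight_lattice \<Longrightarrow> y \<in> coweight_lattice \<Longrightarrow> x - y \<in> (coweight_lattice :: (real, 'n) vec set)"
  by (auto simp: coweight_lattice_def inner_diff_right)

lemma scaled_lattice_diff:
  "0 \<in> (scaled_lattice q :: (real ^ 'n::{finite,linorder}) set)"
  "x \<in> scaled_lattice q \<Longrightarrow> y \<in> scaled_lattice q \<Longrightarrow> x - y \<in> (scaled_lattice q :: (real, 'n) vec set)"
proof -
  have "real q *\<^sub>R (0 :: (real, 'n) vec) \<in> scaled_lattice q"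
    unfolding scaled_lattice_def using coweight_lattice_diff(1) by blast
  then show "0 \<in> (scaled_lattice q :: (real, 'n) vec set)" by simp
  show "x - y \<in> (scaled_lattice q :: (real, 'n) vec set)" if "x \<in> scaled_lattice q" "y \<in> scaled_lattice q"
  proof -
    obtain a where a: "x = real q *\<^sub>R a" "a \<in> coweight_lattice"
      using \<open>x \<in> _\<close> unfolding scaled_lattice_def by blast
    obtain b where b: "y = real q *\<^sub>R b" "b \<in> coweight_lattice"
      using \<open>y \<in> _\<close> unfolding scaled_lattice_def by blast
    have "x - y = real q *\<^sub>R (a - b)" unfolding a b by (simp add: scaleR_diff_right)
    then show ?thesis unfolding scaled_lattice_def using a b coweight_lattice_diff(2) by blast
  qed
qed

lemma scaled_coset_eq_iff:
  "x +o scaled_lattice q = y +o scaled_lattice q \<longleftrightarrow> x - y \<in> (scaled_lattice q :: (real ^ 'n::{finite,linorder}) set)"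
  by (rule coset_eq_iff[OF scaled_lattice_diff(1)]) (rule scaled_lattice_diff(2))

lemma coset_add_closed:
  assumes "0 \<in> L" "\<And>x y. x \<in> L \<Longrightarrow> y \<in> L \<Longrightarrow> x - y \<in> L" "a \<in> L" "b \<in> L"
  shows "a + b \<in> (L :: 'a::ab_group_add set)"
  using assms(2)[OF assms(3) assms(2)[OF assms(1,4)]] by simp

lemma weyl_coweight_lattice:
  fixes w :: "real ^ 'n::{finite,linorder} \<Rightarrow> real ^ 'n::{finite,linorder}"
  assumes w: "w \<in> weyl_group"
  shows "w ` coweight_lattice \<subseteq> coweight_lattice"
proof
  fix y assume "y \<in> w ` coweight_lattice"
  then obtain x where x: "x \<in> coweight_lattice" "y = w x" by blast
  obtain v where v: "v \<in> refl_group roots" "w \<circ> v = id"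
    using w unfolding weyl_group_def by (rule refl_group_inverse)
  have "\<alpha> \<bullet> w x \<in> \<int>" if "\<alpha> \<in> roots" for \<alpha>
  proof -
    have "\<alpha> \<bullet> w x = w (v \<alpha>) \<bullet> w x" using v(2) by (metis comp_apply id_apply)
    also have "\<dots> = v \<alpha> \<bullet> x"
      using w unfolding weyl_group_def by (intro signed_permutation_inner refl_group_signed_permutation) auto
    also have "\<dots> \<in> \<int>"
      using x(1) signed_permutation_roots[OF refl_group_signed_permutation[OF v(1)] that]
      by (auto simp: coweight_lattice_def)
    finally show ?thesis .
  qed
  then show "y \<in> coweight_lattice" unfolding x(2) coweight_lattice_def by blast
qed

lemma weyl_linear:
  fixes w :: "real ^ 'n::{finite,linorder} \<Rightarrow> real ^ 'n::{finite,linorder}"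
  assumes w: "w \<in> weyl_group"
  shows "linear w"
  using w unfolding weyl_group_def
  by (intro signed_permutation_linear refl_group_signed_permutation) auto

lemma coset_action_coweight:
  fixes w :: "real ^ 'n::{finite,linorder} \<Rightarrow> real ^ 'n::{finite,linorder}"
  assumes w: "w \<in> weyl_group"
  shows "coset_action coweight_lattice w (x +o coweight_lattice) = w x +o coweight_lattice"
  by (rule coset_action_eq[OF weyl_linear[OF w] weyl_coweight_lattice[OF w] coweight_lattice_diff(1)])
     (rule coset_add_closed[OF coweight_lattice_diff])

lemma coset_action_scaled:
  fixes w :: "real ^ 'n::{finite,linorder} \<Rightarrow> real ^ 'n::{finite,linorder}"
  assumes w: "w \<in> weyl_group"
  shows "coset_action (scaled_lattice q) w (x +o scaled_lattice q) = w x +o scaled_lattice q"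
proof (rule coset_action_eq[OF weyl_linear[OF w] _ scaled_lattice_diff(1)])
  show "w ` scaled_lattice q \<subseteq> scaled_lattice q"
    unfolding scaled_lattice_def
  proof clarify
    fix z :: "(real, 'n) vec" assume "z \<in> coweight_lattice"
    then have "w z \<in> coweight_lattice" using weyl_coweight_lattice[OF w] by blast
    then show "w (real q *\<^sub>R z) \<in> (*\<^sub>R) (real q) ` coweight_lattice"
      unfolding linear_scale[OF weyl_linear[OF w]] by (rule imageI)
  qed
qed (rule coset_add_closed[OF scaled_lattice_diff])

section \<open>Counting fixed regular cosets\<close>

text \<open>
The roots \<open>\<plusminus>2 e\<^sub>k\<close> give the condition on single entries and the roots \<open>\<plusminus>e\<^sub>i \<plusminus> e\<^sub>k\<close> the condition on
pairs, which acquires the modulus \<open>2q\<close> because \<open>y\<close> is twice the vector.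
\<close>

lemma regular_half_vector_iff:
  "(\<forall>\<beta>\<in>roots. \<not> (\<exists>m::int. \<beta> \<bullet> (half_vector y :: real ^ 'n::{finite,linorder}) = real_of_int (int q * m))) \<longleftrightarrow>
   (\<forall>i\<in>{1..CARD('n)}. \<not> int q dvd y i) \<and>
   (\<forall>i\<in>{1..CARD('n)}. \<forall>j\<in>{1..CARD('n)}. i \<noteq> j \<longrightarrow>
      \<not> 2 * int q dvd y j - y i \<and> \<not> 2 * int q dvd y j + y i)"
  (is "?L \<longleftrightarrow> ?A \<and> ?B")
proof
  assume L: ?L
  have ?A
  proof (intro ballI notI)
    fix i assume i: "i \<in> {1..CARD('n)}" and "int q dvd y i"
    then obtain m where "y i = int q * m" by (elim dvdE)
    then have "(1 *\<^sub>R (2 *\<^sub>R ee i)) \<bullet> (half_vector y :: (real, 'n) vec) = real_of_int (int q * m)"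
      unfolding double_root_half_vector[OF i] by simp
    moreover have "1 *\<^sub>R (2 *\<^sub>R ee i) \<in> (roots :: (real, 'n) vec set)" by (rule double_in_roots[OF i]) simp
    ultimately show False using L by blast
  qed
  moreover have ?B
  proof (intro ballI impI)
    fix i j assume ij: "i \<in> {1..CARD('n)}" "j \<in> {1..CARD('n)}" "i \<noteq> j"
    have *: "\<not> 2 * int q dvd y j + c * y i" if c: "c = 1 \<or> c = -1" for c
    proof
      assume "2 * int q dvd y j + c * y i"
      then obtain m where m: "y j + c * y i = 2 * int q * m" by (elim dvdE)
      then have "real_of_int (y j + c * y i) = real_of_int (2 * int q * m)" by (simp only:)
      then have "(real_of_int c *\<^sub>R ee i + 1 *\<^sub>R ee j) \<bullet> (half_vector y :: (real, 'n) vec) = real_of_int (int q * m)"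
        unfolding root_half_vector[OF ij(1,2)] by simp
      moreover have "real_of_int c *\<^sub>R ee i + 1 *\<^sub>R ee j \<in> (roots :: (real, 'n) vec set)"
        by (rule pair_in_roots[OF ij]) (use c in auto)
      ultimately show False using L by blast
    qed
    show "\<not> 2 * int q dvd y j - y i \<and> \<not> 2 * int q dvd y j + y i"
      using *[of 1] *[of "-1"] by simp
  qed
  ultimately show "?A \<and> ?B" by blast
next
  assume AB: "?A \<and> ?B"
  show ?L
  proof (intro ballI notI)
    fix \<beta> :: "(real, 'n) vec" assume "\<beta> \<in> roots" and "\<exists>m::int. \<beta> \<bullet> half_vector y = real_of_int (int q * m)"
    then obtain m :: int where m: "\<beta> \<bullet> half_vector y = real_of_int (int q * m)" by blast
    from \<open>\<beta> \<in> roots\<close> show False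
    proof (cases rule: rootE)
      case (pair a b i k)
      obtain a' where a': "a = real_of_int a'" "a' \<in> {1, -1}" by (rule sign_eq_of_int[OF pair(2)])
      obtain b' where b': "b = real_of_int b'" "b' \<in> {1, -1}" by (rule sign_eq_of_int[OF pair(3)])
      note ab = a'(1) b'(1) a'(2) b'(2)
      have "real_of_int (a' * y i + b' * y k) = real_of_int (2 * int q * m)"
        using m unfolding pair(1) root_half_vector[OF pair(4,5)] ab by simp
      then have "a' * y i + b' * y k = 2 * int q * m" by (simp only: of_int_eq_iff)
      then have "2 * int q dvd a' * y i + b' * y k" by simp
      then have "2 * int q dvd b' * (a' * y i + b' * y k)" by (rule dvd_mult)
      moreover have "b' * (a' * y i + b' * y k) = y k - y i \<or> b' * (a' * y i + b' * y k) = y k + y i"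
        using ab(3,4) by auto
      ultimately have "2 * int q dvd y k - y i \<or> 2 * int q dvd y k + y i" by auto
      moreover have "\<not> 2 * int q dvd y k - y i \<and> \<not> 2 * int q dvd y k + y i"
        using conjunct2[OF AB] pair(4,5) less_imp_neq[OF pair(6)] by blast
      ultimately show False by blast
    next
      case (double a k)
      have "a * real_of_int (y k) = real_of_int (int q * m)"
        using m unfolding double(1) double_root_half_vector[OF double(3)] .
      then have "real_of_int (y k) = real_of_int (int q * m) \<or> real_of_int (y k) = real_of_int (- (int q * m))"
        using double(2) by auto
      then have "y k = int q * m \<or> y k = - (int q * m)" by (simp only: of_int_eq_iff)
      then have "int q dvd y k" by auto
      then show False using AB double(3) by blast
    qed
  qed
qed

text \<open>
Extensional in order to lie in a set of the form \<open>I \<rightarrow>\<^sub>E A\<close>, on which vectors can be counted.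
\<close>

definition residue_vector :: "nat \<Rightarrow> nat \<Rightarrow> (nat \<Rightarrow> int) \<Rightarrow> nat \<Rightarrow> int" where
  "residue_vector l q z = (\<lambda>k\<in>{1..l}. z k mod (2 * int q))"

lemma residue_vector_sign_distinct:
  assumes q: "q > 0" and par: "equal_parity l z"
    and A: "\<forall>i\<in>{1..l}. \<not> int q dvd z i"
    and B: "\<forall>i\<in>{1..l}. \<forall>j\<in>{1..l}. i \<noteq> j \<longrightarrow> \<not> 2 * int q dvd z j - z i \<and> \<not> 2 * int q dvd z j + z i"
  shows "residue_vector l q z \<in> sign_distinct_functions (int q) 1 {1..l}"
proof -
  let ?r = "\<lambda>k. z k mod (2 * int q)"
  have r: "residue_vector l q z k = ?r k" if "k \<in> {1..l}" for k
    using that by (simp only: residue_vector_def restrict_apply if_True)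
  have "residue_vector l q z \<in> {1..l} \<rightarrow>\<^sub>E {0..<2 * int q * 1}"
    unfolding residue_vector_def by (intro restrict_PiE_iff[THEN iffD2] ballI) (use q in simp)
  moreover have "\<forall>i\<in>{1..l}. \<forall>j\<in>{1..l}. residue_vector l q z i mod 2 = residue_vector l q z j mod 2"
  proof (intro ballI)
    fix i j assume ij: "i \<in> {1..l}" "j \<in> {1..l}"
    have "?r k mod 2 = z k mod 2" for k by (rule mod_mod_cancel) simp
    then show "residue_vector l q z i mod 2 = residue_vector l q z j mod 2"
      using par ij unfolding equal_parity_def r[OF ij(1)] r[OF ij(2)] by metis
  qed
  moreover have "\<forall>i\<in>{1..l}. \<not> int q dvd residue_vector l q z i"
  proof
    fix i assume i: "i \<in> {1..l}"
    have "int q dvd ?r i \<longleftrightarrow> int q dvd z i" by (rule dvd_mod_iff) simp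
    then show "\<not> int q dvd residue_vector l q z i" using A i unfolding r[OF i] by blast
  qed
  moreover have "\<forall>i\<in>{1..l}. \<forall>j\<in>{1..l}. i \<noteq> j \<longrightarrow>
     \<not> 2 * int q dvd residue_vector l q z j - residue_vector l q z i \<and>
     \<not> 2 * int q dvd residue_vector l q z j + residue_vector l q z i"
  proof (intro ballI impI)
    fix i j assume ij: "i \<in> {1..l}" "j \<in> {1..l}" "i \<noteq> j"
    have "2 * int q dvd ?r j - ?r i \<longleftrightarrow> 2 * int q dvd z j - z i"
      "2 * int q dvd ?r j + ?r i \<longleftrightarrow> 2 * int q dvd z j + z i"
      unfolding dvd_eq_mod_eq_0 by (simp_all only: mod_diff_eq mod_add_eq)
    then show "\<not> 2 * int q dvd residue_vector l q z j - residue_vector l q z i \<and>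
     \<not> 2 * int q dvd residue_vector l q z j + residue_vector l q z i"
      using B ij unfolding r[OF ij(1)] r[OF ij(2)] by blast
  qed
  ultimately show ?thesis unfolding sign_distinct_functions_def by (intro CollectI conjI)
qed

lemma half_residue_vector:
  assumes q: "q > 0"
  shows "half_vector z - half_vector (residue_vector CARD('n) q z) \<in> (scaled_lattice q :: (real ^ 'n::{finite,linorder}) set)"
proof -
  have "2 * int q dvd z k - residue_vector CARD('n) q z k" if "k \<in> {1..CARD('n)}" for k
    using that by (simp add: residue_vector_def)
  then show ?thesis unfolding half_vector_diff scaled_lattice_iff[OF q] by blast
qed

lemma sign_distinctD:
  assumes "y \<in> sign_distinct_functions m r I"
  shows "y \<in> I \<rightarrow>\<^sub>E {0..<2 * m * r}"
    and "\<forall>i\<in>I. \<forall>j\<in>I. y i mod 2 = y j mod 2"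
    and "\<forall>i\<in>I. \<not> m dvd y i"
    and "\<forall>i\<in>I. \<forall>j\<in>I. i \<noteq> j \<longrightarrow> \<not> 2 * m dvd y j - y i \<and> \<not> 2 * m dvd y j + y i"
  using assms unfolding sign_distinct_functions_def mem_Collect_eq by - (elim conjE, assumption)+

text \<open>
The other representative of the coset of \<open>y / 2\<close> is obtained by adding \<open>q\<close> to all entries and reducing
modulo \<open>2q\<close>. It satisfies the same conditions because sums and differences of two entries change by
\<open>2q\<close> or \<open>0\<close>.
\<close>

lemma residue_class_fibre:
  assumes q: "q > 0" and y: "y \<in> sign_distinct_functions (int q) 1 {1..CARD('n::{finite,linorder})}"
  shows "card {y' \<in> sign_distinct_functions (int q) 1 {1..CARD('n)}.
     (half_vector y' :: (real, 'n) vec) +o scaled_lattice q = half_vector y +o scaled_lattice q} = 2"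
proof -
  let ?Y = "sign_distinct_functions (int q) 1 {1..CARD('n)}"
  let ?s = "residue_vector CARD('n) q (\<lambda>k. y k + int q)"
  have l: "(1::nat) \<in> {1..CARD('n)}" by (simp add: Suc_leI)
  note D = sign_distinctD[OF y]
  have s: "?s \<in> ?Y"
  proof (rule residue_vector_sign_distinct[OF q])
    have "(y i + int q) mod 2 = (y j + int q) mod 2"
      if "i \<in> {1..CARD('n)}" "j \<in> {1..CARD('n)}" for i j
    proof -
      have "y i mod 2 = y j mod 2" using D(2) that by blast
      then show ?thesis by presburger
    qed
    then show "equal_parity CARD('n) (\<lambda>k. y k + int q)" unfolding equal_parity_def by blast
    show "\<forall>i\<in>{1..CARD('n)}. \<not> int q dvd y i + int q" using D(3) by simp
    have "y j + int q + (y i + int q) = (y j + y i) + 2 * int q" for i j by simp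
    then have "2 * int q dvd y j + int q + (y i + int q) \<longleftrightarrow> 2 * int q dvd y j + y i" for i j
      by (simp only: dvd_add_left_iff dvd_refl)
    moreover have "y j + int q - (y i + int q) = y j - y i" for i j by simp
    ultimately show "\<forall>i\<in>{1..CARD('n)}. \<forall>j\<in>{1..CARD('n)}. i \<noteq> j \<longrightarrow>
        \<not> 2 * int q dvd y j + int q - (y i + int q) \<and> \<not> 2 * int q dvd y j + int q + (y i + int q)"
      using D(4) by (simp only:)
  qed
  have sk: "?s k = (y k + int q) mod (2 * int q)" if "k \<in> {1..CARD('n)}" for k
    using that by (simp only: residue_vector_def restrict_apply if_True)
  have ne: "?s \<noteq> y"
  proof
    assume "?s = y"
    then have "(y 1 + int q) mod (2 * int q) = y 1" using sk[OF l] by simp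
    moreover have "y 1 mod (2 * int q) = y 1" using PiE_mem[OF D(1) l] by simp
    ultimately have "2 * int q dvd (y 1 + int q) - y 1" by (simp only: mod_eq_dvd_iff[symmetric])
    then have "2 * int q dvd int q" by simp
    then show False using q zdvd_imp_le[of "2 * int q" "int q"] by simp
  qed
  have "{y' \<in> ?Y. (half_vector y' :: (real, 'n) vec) +o scaled_lattice q = half_vector y +o scaled_lattice q} = {y, ?s}"
  proof (intro equalityI subsetI)
    fix y' assume "y' \<in> {y' \<in> ?Y. (half_vector y' :: (real, 'n) vec) +o scaled_lattice q = half_vector y +o scaled_lattice q}"
    then have y': "y' \<in> ?Y" and "(half_vector y' :: (real, 'n) vec) +o scaled_lattice q = half_vector y +o scaled_lattice q"
      by simp_all
    then have "(half_vector y' :: (real, 'n) vec) - half_vector y \<in> scaled_lattice q"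
      by (simp only: scaled_coset_eq_iff)
    then consider "\<forall>k\<in>{1..CARD('n)}. 2 * int q dvd y' k - y k"
      | "\<forall>k\<in>{1..CARD('n)}. 2 * int q dvd y' k - y k + int q"
      unfolding half_vector_diff scaled_lattice_iff[OF q] by blast
    then show "y' \<in> {y, ?s}"
    proof cases
      case 1
      have "y' = y"
      proof (rule PiE_ext[OF sign_distinctD(1)[OF y'] D(1)])
        fix k assume k: "k \<in> {1..CARD('n)}"
        have "y' k mod (2 * int q) = y k mod (2 * int q)" using 1 k by (simp only: mod_eq_dvd_iff)
        then show "y' k = y k"
          using PiE_mem[OF sign_distinctD(1)[OF y'] k] PiE_mem[OF D(1) k] by simp
      qed
      then show ?thesis by simp
    next
      case 2
      have "y' = ?s"
      proof (rule PiE_ext[OF sign_distinctD(1)[OF y'] sign_distinctD(1)[OF s]])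
        fix k assume k: "k \<in> {1..CARD('n)}"
        have "2 * int q dvd y' k - y k + int q" using 2 k by blast
        then have "2 * int q dvd (y' k - y k + int q) - 2 * int q" by (rule dvd_diff) simp
        moreover have "(y' k - y k + int q) - 2 * int q = y' k - (y k + int q)" by simp
        ultimately have "2 * int q dvd y' k - (y k + int q)" by (simp only:)
        then have "y' k mod (2 * int q) = (y k + int q) mod (2 * int q)" by (simp only: mod_eq_dvd_iff)
        then show "y' k = ?s k"
          using PiE_mem[OF sign_distinctD(1)[OF y'] k] sk[OF k] by simp
      qed
      then show ?thesis by simp
    qed
  next
    fix y' assume "y' \<in> {y, ?s}"
    moreover have "(half_vector ?s :: (real, 'n) vec) - half_vector y \<in> scaled_lattice q"
    proof -
      have "2 * int q dvd ?s k - y k + int q" if k: "k \<in> {1..CARD('n)}" for k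
      proof -
        have "2 * int q dvd ?s k - (y k + int q)"
          unfolding sk[OF k] by (simp only: mod_eq_dvd_iff[symmetric] mod_mod_trivial)
        then have "2 * int q dvd ?s k - (y k + int q) + 2 * int q" by (simp only: dvd_add_left_iff dvd_refl)
        then show ?thesis by (simp add: algebra_simps)
      qed
      then show ?thesis unfolding half_vector_diff scaled_lattice_iff[OF q] by blast
    qed
    ultimately show "y' \<in> {y' \<in> ?Y. (half_vector y' :: (real, 'n) vec) +o scaled_lattice q = half_vector y +o scaled_lattice q}"
      using s y scaled_coset_eq_iff[of "half_vector ?s :: (real, 'n) vec" q "half_vector y"] by blast
  qed
  then show ?thesis using ne by simp
qed

lemma finite_sign_distinct_functions: "finite I \<Longrightarrow> finite (sign_distinct_functions m r I)"
  unfolding sign_distinct_functions_def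
  by (rule finite_subset[OF _ finite_PiE[of I "\<lambda>_. {0..<2 * m * r}"]]) auto

text \<open>
The vectors \<open>y\<close> map onto the regular cosets fixed by \<open>w\<close>, and all fibres have two elements. Whether a
vector \<open>y\<close> is counted on the right depends only on its coset.
\<close>

lemma twice_chi:
  fixes w :: "real ^ 'n::{finite,linorder} \<Rightarrow> real ^ 'n::{finite,linorder}"
  assumes q: "q > 0" and w: "w \<in> weyl_group"
  shows "2 * chi q w = card {y \<in> sign_distinct_functions (int q) 1 {1..CARD('n)}.
           w (half_vector y) - half_vector y \<in> scaled_lattice q}"
proof -
  let ?Y = "sign_distinct_functions (int q) 1 {1..CARD('n)}"
  let ?L = "scaled_lattice q :: (real, 'n) vec set"
  define \<Phi> where "\<Phi> y = (half_vector y :: (real, 'n) vec) +o ?L" for y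
  define T where "T = {t \<in> regular_cosets q. coset_action ?L w t = t}"
  define F where "F = {y \<in> ?Y. w (half_vector y) - half_vector y \<in> ?L}"
  have fixed: "coset_action ?L w (x +o ?L) = x +o ?L \<longleftrightarrow> w x - x \<in> ?L" for x
    unfolding coset_action_scaled[OF w] by (rule scaled_coset_eq_iff)
  have F_iff: "y \<in> F \<longleftrightarrow> y \<in> ?Y \<and> coset_action ?L w (\<Phi> y) = \<Phi> y" for y
    unfolding F_def \<Phi>_def fixed by blast
  have finY: "finite ?Y" by (rule finite_sign_distinct_functions) simp
  have "T = \<Phi> ` F"
  proof (intro equalityI subsetI)
    fix t assume "t \<in> T"
    then obtain x where t: "t = x +o ?L" and x: "x \<in> coweight_lattice"
      and reg: "\<forall>\<beta>\<in>roots. \<not> (\<exists>m::int. \<beta> \<bullet> x = real_of_int (int q * m))" and fixed_t: "coset_action ?L w t = t"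
      unfolding T_def regular_cosets_def by blast
    obtain z where z: "x = half_vector z" "equal_parity CARD('n) z"
      using x unfolding coweight_lattice_eq by blast
    let ?y = "residue_vector CARD('n) q z"
    have y: "?y \<in> ?Y"
      using reg unfolding z(1) regular_half_vector_iff
      by (intro residue_vector_sign_distinct[OF q z(2)]) blast+
    have "t = \<Phi> ?y"
      unfolding t \<Phi>_def z(1)
      by (rule scaled_coset_eq_iff[THEN iffD2, OF half_residue_vector[OF q]])
    moreover from this have "?y \<in> F" using fixed_t y fixed unfolding F_def \<Phi>_def by blast
    ultimately show "t \<in> \<Phi> ` F" by blast
  next
    fix t assume "t \<in> \<Phi> ` F"
    then obtain y where y: "y \<in> F" "t = \<Phi> y" by blast
    then have yY: "y \<in> ?Y" unfolding F_def by blast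
    have "half_vector y \<in> (coweight_lattice :: (real, 'n) vec set)"
      unfolding coweight_lattice_eq using sign_distinctD(2)[OF yY] by (intro imageI CollectI) (simp only: equal_parity_def)
    moreover have "\<forall>\<beta>\<in>roots. \<not> (\<exists>m::int. \<beta> \<bullet> (half_vector y :: (real, 'n) vec) = real_of_int (int q * m))"
      unfolding regular_half_vector_iff using sign_distinctD(3,4)[OF yY] by blast
    ultimately have "t \<in> regular_cosets q" unfolding y(2) \<Phi>_def regular_cosets_def by blast
    then show "t \<in> T" using y fixed unfolding T_def F_def \<Phi>_def by blast
  qed
  have finF: "finite F" using finY unfolding F_def by simp
  have fibre: "card {y \<in> F. \<Phi> y = t} = 2" if t: "t \<in> T" for t
  proof -
    obtain y0 where y0: "y0 \<in> F" "t = \<Phi> y0" using t \<open>T = \<Phi> ` F\<close> by blast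
    have "{y \<in> F. \<Phi> y = t} = {y \<in> ?Y. \<Phi> y = \<Phi> y0}"
      using y0(1) unfolding y0(2) F_iff by auto
    then show ?thesis
      using residue_class_fibre[where 'n='n, OF q, of y0] y0(1) unfolding \<Phi>_def F_def by simp
  qed
  have "card F = (\<Sum>t\<in>T. card {y \<in> F. \<Phi> y = t})"
  proof -
    have "F = (\<Union>t\<in>T. {y \<in> F. \<Phi> y = t})" unfolding \<open>T = \<Phi> ` F\<close> by blast
    also have "card \<dots> = (\<Sum>t\<in>T. card {y \<in> F. \<Phi> y = t})"
      using finF \<open>T = \<Phi> ` F\<close> by (intro card_UN_disjoint) auto
    finally show ?thesis .
  qed
  also have "\<dots> = 2 * card T" using fibre by simp
  finally show ?thesis unfolding chi_def T_def F_def by simp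
qed

lemma chi_id:
  assumes q: "q > 0"
  shows "2 * int (chi q (id :: real ^ 'n::{finite,linorder} \<Rightarrow> _)) =
    (if odd q then 2 * (\<Prod>i<CARD('n). int q - 1 - 2 * int i)
     else 2 * (\<Prod>i=1..CARD('n) - 1. int q - 2 * int i) * (int q - int CARD('n)))"
proof -
  have w: "id \<in> (weyl_group :: ((real, 'n) vec \<Rightarrow> _) set)"
    unfolding weyl_group_def by (rule id_in_refl_group)
  have "2 * chi q (id :: (real, 'n) vec \<Rightarrow> _) = card (sign_distinct_functions (int q) 1 {1..CARD('n)})"
    unfolding twice_chi[OF q w] using scaled_lattice_diff(1)[where 'n='n, of q] by simp
  then have "2 * int (chi q (id :: (real, 'n) vec \<Rightarrow> _)) = int (card (sign_distinct_functions (int q) 1 {1..CARD('n)}))"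
    by linarith
  also have "\<dots> = (if odd (int q) then 2 * (\<Prod>i<card {1..CARD('n)}. 1 * (int q - 1) - 2 * 1 * int i)
      else 2 * (\<Prod>i=1..card {1..CARD('n)} - 1. 1 * int q - 2 * 1 * int i) * (1 * int q - 1 * int (card {1..CARD('n)})))"
    by (rule card_sign_distinct_functions) (use q in \<open>auto simp: Suc_leI\<close>)
  finally show ?thesis by simp
qed

lemma omega_half_vector:
  "reverse_coords (- half_vector y) = (half_vector (\<lambda>k. - y (CARD('n) + 1 - k)) :: real ^ 'n::{finite,linorder})"
proof (rule eqI_ee)
  fix k assume k: "k \<in> {1..CARD('n)}"
  then have k': "CARD('n) + 1 - k \<in> {1..CARD('n)}" by auto
  show "ee k \<bullet> reverse_coords (- (half_vector y :: (real, 'n) vec)) = ee k \<bullet> (half_vector (\<lambda>k. - y (CARD('n) + 1 - k)) :: (real, 'n) vec)"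
    unfolding ee_reverse_coords[OF k] inner_minus_right ee_half_vector[OF k] ee_half_vector[OF k'] by simp
qed

text \<open>
Of the two ways in which \<open>w x - x\<close> can lie in the scaled lattice, divisibility of \<open>y\<^sub>1 + y\<^sub>l\<close> by \<open>2q\<close> is
excluded by regularity. This uses \<open>l \<noteq> 1\<close>, which follows from \<open>l\<close> being even.
\<close>

lemma twice_chi_omega:
  assumes q: "q > 0" and even: "even CARD('n::{finite,linorder})"
  shows "2 * chi q (omega CARD('n) :: (real, 'n) vec \<Rightarrow> _) =
    card {y \<in> sign_distinct_functions (int q) 1 {1..CARD('n)}.
      \<forall>k\<in>{1..CARD('n)}. 2 * int q dvd y k + y (CARD('n) + 1 - k) + int q}"
proof -
  let ?l = "CARD('n)"
  have "reverse_coords (- half_vector y) - half_vector y \<in> (scaled_lattice q :: (real, 'n) vec set) \<longleftrightarrow>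
      (\<forall>k\<in>{1..?l}. 2 * int q dvd y k + y (?l + 1 - k) + int q)"
    if y: "y \<in> sign_distinct_functions (int q) 1 {1..?l}" for y
  proof -
    have l: "(1::nat) \<in> {1..?l}" by (simp add: Suc_leI)
    have l': "?l \<in> {1..?l}" by (simp add: Suc_leI)
    have "?l \<noteq> 1" using even by auto
    then have "\<not> 2 * int q dvd y 1 + y ?l" using sign_distinctD(4)[OF y] l l' by blast
    moreover have "- y (?l + 1 - 1) - y 1 = - (y 1 + y ?l)" by simp
    ultimately have "\<not> 2 * int q dvd - y (?l + 1 - 1) - y 1" by (simp only: dvd_minus_iff not_False_eq_True)
    then have "\<not> (\<forall>k\<in>{1..?l}. 2 * int q dvd - y (?l + 1 - k) - y k)" using l by blast
    moreover have "2 * int q dvd - y (?l + 1 - k) - y k + int q \<longleftrightarrow> 2 * int q dvd y k + y (?l + 1 - k) + int q" for k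
    proof -
      have "- y (?l + 1 - k) - y k + int q = - (y k + y (?l + 1 - k) + int q) + 2 * int q" by simp
      then have "2 * int q dvd - y (?l + 1 - k) - y k + int q \<longleftrightarrow> 2 * int q dvd - (y k + y (?l + 1 - k) + int q)"
        by (simp only: dvd_add_left_iff dvd_refl)
      then show ?thesis by (simp only: dvd_minus_iff)
    qed
    ultimately show ?thesis
      unfolding omega_half_vector half_vector_diff scaled_lattice_iff[OF q] by blast
  qed
  then have "{y \<in> sign_distinct_functions (int q) 1 {1..?l}.
       reverse_coords (- half_vector y) - half_vector y \<in> (scaled_lattice q :: (real, 'n) vec set)} =
      {y \<in> sign_distinct_functions (int q) 1 {1..?l}.
      \<forall>k\<in>{1..?l}. 2 * int q dvd y k + y (?l + 1 - k) + int q}" by blast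
  then show ?thesis
    unfolding twice_chi[OF q omega_eq(2)] unfolding omega_eq(1) by (simp only:)
qed

text \<open>
The sum of two entries of the same parity and the odd number \<open>q\<close> is odd, so it is no multiple of \<open>2q\<close>.
\<close>

lemma chi_omega_odd:
  assumes "odd q" and even: "even CARD('n::{finite,linorder})"
  shows "chi q (omega CARD('n) :: (real, 'n) vec \<Rightarrow> _) = 0"
proof -
  let ?l = "CARD('n)"
  have q: "q > 0" using assms(1) by (rule odd_pos)
  have l: "(1::nat) \<in> {1..?l}" and l': "?l \<in> {1..?l}" by (simp_all add: Suc_leI)
  have "\<not> (\<forall>k\<in>{1..?l}. 2 * int q dvd y k + y (?l + 1 - k) + int q)"
    if y: "y \<in> sign_distinct_functions (int q) 1 {1..?l}" for y
  proof
    assume "\<forall>k\<in>{1..?l}. 2 * int q dvd y k + y (?l + 1 - k) + int q"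
    then have "2 * int q dvd y 1 + y (?l + 1 - 1) + int q" using l by blast
    then have "even (y 1 + y ?l + int q)" by (simp only: diff_add_inverse2) (rule dvd_mult_left)
    moreover have "y 1 mod 2 = y ?l mod 2" using sign_distinctD(2)[OF y] l l' by blast
    then have "even (y 1 + y ?l)" by presburger
    ultimately show False using assms(1) by simp
  qed
  then have "{y \<in> sign_distinct_functions (int q) 1 {1..?l}.
      \<forall>k\<in>{1..?l}. 2 * int q dvd y k + y (?l + 1 - k) + int q} = {}" by blast
  then have "2 * chi q (omega ?l :: (real, 'n) vec \<Rightarrow> _) = 0"
    unfolding twice_chi_omega[OF q even] by (simp only: card.empty)
  then show ?thesis by simp
qed

text \<open>
Here \<open>q = 2p\<close> and \<open>l = 2m\<close>. The condition \<open>y\<^sub>k + y\<^bsub>2m+1-k\<^esub> \<equiv> 2p\<close> modulo \<open>4p\<close> recovers the second half of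
\<open>y\<close> from the first. Since the values \<open>y\<^sub>i\<close> and \<open>2p - y\<^sub>i\<close> both occur in \<open>y\<close>, being different from \<open>\<plusminus>y\<^sub>j\<close> and
from \<open>\<plusminus>(2p - y\<^sub>j)\<close> modulo \<open>4p\<close> amounts to being different from \<open>\<plusminus>y\<^sub>j\<close> modulo \<open>2p\<close>. For the two partners
\<open>y\<^sub>i\<close> and \<open>2p - y\<^sub>i\<close> themselves, it means \<open>2 y\<^sub>i \<noteq> 2p\<close> modulo \<open>4p\<close>; together with \<open>2p\<close> not dividing \<open>y\<^sub>i\<close>
this says that \<open>p\<close> does not divide \<open>y\<^sub>i\<close>.
\<close>

lemma sign_distinct_fold:
  fixes m p :: nat
  assumes p: "p > 0"
  shows "bij_betw (\<lambda>y. restrict y {1..m})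
     {y \<in> sign_distinct_functions (2 * int p) 1 {1..2 * m}.
        \<forall>k\<in>{1..2 * m}. 4 * int p dvd y k + y (2 * m + 1 - k) + 2 * int p}
     (sign_distinct_functions (int p) 2 {1..m})"
    (is "bij_betw ?r ?Y ?G")
proof -
  define lift where "lift g k = (if k \<le> m then g k else 2 * int p - g (2 * m + 1 - k))" for g :: "nat \<Rightarrow> int" and k
  let ?e = "\<lambda>g. residue_vector (2 * m) (2 * p) (lift g)"
  have Y: "y \<in> sign_distinct_functions (2 * int p) 1 {1..2 * m}"
    "\<And>k. k \<in> {1..2 * m} \<Longrightarrow> 4 * int p dvd y k + y (2 * m + 1 - k) + 2 * int p" if "y \<in> ?Y" for y
    using that by blast+
  have e: "?e g k = lift g k mod (4 * int p)" if "k \<in> {1..2 * m}" for g k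
    using that by (simp add: residue_vector_def del: One_nat_def)
  \<comment> \<open>Modulo \<open>4p\<close>, a multiple of \<open>2p\<close> is \<open>0\<close> or \<open>2p\<close>.\<close>
  have dvd_half: "2 * int p dvd x \<longleftrightarrow> 4 * int p dvd x \<or> 4 * int p dvd x + 2 * int p" for x
  proof
    assume "2 * int p dvd x"
    then obtain s where s: "x = 2 * int p * s" by (elim dvdE)
    show "4 * int p dvd x \<or> 4 * int p dvd x + 2 * int p"
    proof (cases "even s")
      case True
      then obtain t where "s = 2 * t" by (elim evenE)
      then have "x = 4 * int p * t" using s by simp
      then show ?thesis by simp
    next
      case False
      then obtain t where "s = 2 * t + 1" by (elim oddE)
      then have "x + 2 * int p = 4 * int p * (t + 1)" using s by (simp add: algebra_simps)
      then show ?thesis by simp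
    qed
  next
    have d: "2 * int p dvd 4 * int p" by (rule dvdI[of _ _ 2]) simp
    assume "4 * int p dvd x \<or> 4 * int p dvd x + 2 * int p"
    then have "2 * int p dvd x \<or> 2 * int p dvd x + 2 * int p" using dvd_trans[OF d] by blast
    then show "2 * int p dvd x" by simp
  qed
  have rY: "?r y \<in> ?G" if y: "y \<in> ?Y" for y
  proof -
    note D = sign_distinctD[OF Y(1)[OF y]]
    \<comment> \<open>An index in the first half never equals its partner since \<open>2m + 1\<close> is odd.\<close>
    have sub: "k \<in> {1..2 * m}" "2 * m + 1 - k \<in> {1..2 * m}" "2 * m + 1 - k \<noteq> k" if "k \<in> {1..m}" for k
      using that by auto
    have r: "?r y k = y k" if "k \<in> {1..m}" for k using that by (simp only: restrict_apply if_True)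
    have cond: "4 * int p dvd y k + y (2 * m + 1 - k) + 2 * int p" if "k \<in> {1..m}" for k
      by (rule Y(2)[OF y sub(1)[OF that]])
    have distinct: "\<not> 4 * int p dvd y j - y i" "\<not> 4 * int p dvd y j + y i"
      if "i \<in> {1..2 * m}" "j \<in> {1..2 * m}" "i \<noteq> j" for i j
    proof -
      have "\<not> 2 * (2 * int p) dvd y j - y i \<and> \<not> 2 * (2 * int p) dvd y j + y i" using D(4) that by blast
      then show "\<not> 4 * int p dvd y j - y i" "\<not> 4 * int p dvd y j + y i" by simp_all
    qed
    have "?r y \<in> {1..m} \<rightarrow>\<^sub>E {0..<2 * int p * 2}"
    proof (intro restrict_PiE_iff[THEN iffD2] ballI)
      fix k assume "k \<in> {1..m}"
      then have "y k \<in> {0..<2 * (2 * int p) * 1}" by (intro PiE_mem[OF D(1)] sub)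
      then show "y k \<in> {0..<2 * int p * 2}" by simp
    qed
    moreover have "\<forall>i\<in>{1..m}. \<forall>j\<in>{1..m}. ?r y i mod 2 = ?r y j mod 2"
    proof (intro ballI)
      fix i j assume ij: "i \<in> {1..m}" "j \<in> {1..m}"
      show "?r y i mod 2 = ?r y j mod 2"
        unfolding r[OF ij(1)] r[OF ij(2)] using D(2) sub(1)[OF ij(1)] sub(1)[OF ij(2)] by blast
    qed
    moreover have "\<forall>i\<in>{1..m}. \<not> int p dvd ?r y i"
    proof (intro ballI notI)
      fix i assume i: "i \<in> {1..m}" and "int p dvd ?r y i"
      then have "int p dvd y i" by (simp only: r)
      then have "2 * int p dvd 2 * y i" by (rule mult_dvd_mono[OF dvd_refl])
      then have "4 * int p dvd 2 * y i \<or> 4 * int p dvd 2 * y i + 2 * int p" unfolding dvd_half .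
      then show False
      proof
        assume "4 * int p dvd 2 * y i"
        then have "2 * (2 * int p) dvd 2 * y i" by simp
        then have "2 * int p dvd y i" by (simp only: dvd_mult_cancel_left) simp
        then show False using D(3) sub(1)[OF i] by blast
      next
        assume "4 * int p dvd 2 * y i + 2 * int p"
        from dvd_diff[OF cond[OF i] this] have "4 * int p dvd y (2 * m + 1 - i) - y i" by simp
        then show False using distinct(1)[OF sub(1,2)[OF i] sub(3)[OF i, symmetric]] by blast
      qed
    qed
    moreover have "\<forall>i\<in>{1..m}. \<forall>j\<in>{1..m}. i \<noteq> j \<longrightarrow>
        \<not> 2 * int p dvd ?r y j - ?r y i \<and> \<not> 2 * int p dvd ?r y j + ?r y i"
    proof (intro ballI impI)
      fix i j assume ij: "i \<in> {1..m}" "j \<in> {1..m}" "i \<noteq> j"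
      then have ne: "2 * m + 1 - i \<noteq> j" by auto
      note dist = distinct[OF sub(1)[OF ij(1)] sub(1)[OF ij(2)] ij(3)]
        distinct[OF sub(2)[OF ij(1)] sub(1)[OF ij(2)] ne]
      have "\<not> 2 * int p dvd y j - y i"
      proof
        assume "2 * int p dvd y j - y i"
        then have "4 * int p dvd y j - y i + 2 * int p" using dist(1) unfolding dvd_half by blast
        from dvd_add[OF this cond[OF ij(1)]]
        have "4 * int p dvd (y j + y (2 * m + 1 - i)) + 4 * int p" by (simp add: algebra_simps)
        then have "4 * int p dvd y j + y (2 * m + 1 - i)" by (simp only: dvd_add_left_iff dvd_refl)
        then show False using dist(4) by blast
      qed
      moreover have "\<not> 2 * int p dvd y j + y i"
      proof
        assume "2 * int p dvd y j + y i"
        then have "4 * int p dvd y j + y i + 2 * int p" using dist(2) unfolding dvd_half by blast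
        from dvd_diff[OF this cond[OF ij(1)]]
        have "4 * int p dvd y j - y (2 * m + 1 - i)" by (simp add: algebra_simps)
        then show False using dist(3) by blast
      qed
      ultimately show "\<not> 2 * int p dvd ?r y j - ?r y i \<and> \<not> 2 * int p dvd ?r y j + ?r y i"
        unfolding r[OF ij(1)] r[OF ij(2)] by blast
    qed
    ultimately show ?thesis unfolding sign_distinct_functions_def by (intro CollectI conjI)
  qed
  have eG: "?e g \<in> ?Y" if g: "g \<in> ?G" for g
  proof -
    note D = sign_distinctD[OF g]
    \<comment> \<open>Folding the index set onto its first half identifies exactly the partners \<open>k\<close> and \<open>2m + 1 - k\<close>.\<close>
    define f where "f k = (if k \<le> m then k else 2 * m + 1 - k)" for k
    have f: "f k \<in> {1..m}" if "k \<in> {1..2 * m}" for k using that by (auto simp: f_def)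
    have l: "lift g k = g (f k) \<or> lift g k = 2 * int p - g (f k)" for k by (simp add: lift_def f_def)
    have half: "\<not> 4 * int p dvd x" if "\<not> 2 * int p dvd x" for x
      using that dvd_half by blast
    have "?e g \<in> sign_distinct_functions (int (2 * p)) 1 {1..2 * m}"
    proof (rule residue_vector_sign_distinct)
      show "0 < 2 * p" using p by simp
      show "equal_parity (2 * m) (lift g)"
        unfolding equal_parity_def
      proof (intro ballI)
        fix i j assume "i \<in> {1..2 * m}" "j \<in> {1..2 * m}"
        then have "g (f i) mod 2 = g (f j) mod 2" using D(2) f by blast
        moreover have "(2 * int p - x) mod 2 = x mod 2" for x by presburger
        ultimately show "lift g i mod 2 = lift g j mod 2" using l[of i] l[of j] by metis
      qed
      show "\<forall>i\<in>{1..2 * m}. \<not> int (2 * p) dvd lift g i"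
      proof (intro ballI notI)
        fix i assume i: "i \<in> {1..2 * m}" and "int (2 * p) dvd lift g i"
        then have "2 * int p dvd lift g i" by simp
        then have "int p dvd lift g i" by (rule dvd_mult_right)
        then have "int p dvd g (f i) \<or> int p dvd 2 * int p - g (f i)" using l[of i] by metis
        moreover have "int p dvd 2 * int p - g (f i) \<longleftrightarrow> int p dvd g (f i)"
          by (rule dvd_diff_right_iff) simp
        ultimately show False using D(3) f[OF i] by blast
      qed
      show "\<forall>i\<in>{1..2 * m}. \<forall>j\<in>{1..2 * m}. i \<noteq> j \<longrightarrow>
         \<not> 2 * int (2 * p) dvd lift g j - lift g i \<and> \<not> 2 * int (2 * p) dvd lift g j + lift g i"
      proof (intro ballI impI)
        fix i j assume ij: "i \<in> {1..2 * m}" "j \<in> {1..2 * m}" "i \<noteq> j"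
        have "\<not> 4 * int p dvd lift g j - lift g i \<and> \<not> 4 * int p dvd lift g j + lift g i"
        proof (cases "f i = f j")
          case False
          then have n: "\<not> 2 * int p dvd g (f j) - g (f i)" "\<not> 2 * int p dvd g (f j) + g (f i)"
            using D(4) f[OF ij(1)] f[OF ij(2)] by blast+
          have c: "2 * int p dvd u + 2 * int p \<longleftrightarrow> 2 * int p dvd u"
              "2 * int p dvd u - 2 * int p \<longleftrightarrow> 2 * int p dvd u"
              "2 * int p dvd u + 4 * int p \<longleftrightarrow> 2 * int p dvd u" for u
          proof -
            have d: "2 * int p dvd 4 * int p" by (rule dvdI[of _ _ 2]) simp
            show "2 * int p dvd u + 2 * int p \<longleftrightarrow> 2 * int p dvd u"
              by (rule dvd_add_left_iff) simp
            show "2 * int p dvd u - 2 * int p \<longleftrightarrow> 2 * int p dvd u"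
              by (rule dvd_diff_left_iff) simp
            show "2 * int p dvd u + 4 * int p \<longleftrightarrow> 2 * int p dvd u" by (rule dvd_add_left_iff[OF d])
          qed
          have m: "2 * int p dvd - u \<longleftrightarrow> 2 * int p dvd u" for u by (rule dvd_minus_iff)
          have e: "g (f j) - (2 * int p - g (f i)) = (g (f j) + g (f i)) - 2 * int p"
            "2 * int p - g (f j) - g (f i) = - (g (f j) + g (f i)) + 2 * int p"
            "2 * int p - g (f j) - (2 * int p - g (f i)) = - (g (f j) - g (f i))"
            "g (f j) + (2 * int p - g (f i)) = (g (f j) - g (f i)) + 2 * int p"
            "2 * int p - g (f j) + g (f i) = - (g (f j) - g (f i)) + 2 * int p"
            "2 * int p - g (f j) + (2 * int p - g (f i)) = - (g (f j) + g (f i)) + 4 * int p" by simp_all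
          have "\<not> 2 * int p dvd lift g j - lift g i \<and> \<not> 2 * int p dvd lift g j + lift g i"
            using l[of i] l[of j]
            by (elim disjE) (simp_all only: e c m n not_False_eq_True simp_thms)
          then show ?thesis using half by blast
        next
          case True
          have n: "\<not> int p dvd g (f i)" using D(3) f[OF ij(1)] by blast
          have "lift g j + lift g i = 2 * int p"
            "lift g j - lift g i = 2 * (int p - g (f i)) \<or> lift g j - lift g i = - (2 * (int p - g (f i)))"
            using True ij by (auto simp: lift_def f_def split: if_splits)
          moreover have "\<not> 4 * int p dvd 2 * int p" using p zdvd_imp_le[of "4 * int p" "2 * int p"] by simp
          moreover have "\<not> 4 * int p dvd 2 * (int p - g (f i))"
          proof
            assume "4 * int p dvd 2 * (int p - g (f i))"
            then have "2 * (2 * int p) dvd 2 * (int p - g (f i))" by simp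
            then have "2 * int p dvd int p - g (f i)" by (simp only: dvd_mult_cancel_left) simp
            then have "int p dvd int p - g (f i)" by (rule dvd_mult_right)
            then have "int p dvd g (f i)" by (simp only: dvd_diff_right_iff dvd_refl)
            then show False using n by blast
          qed
          ultimately show ?thesis by (metis dvd_minus_iff)
        qed
        then show "\<not> 2 * int (2 * p) dvd lift g j - lift g i \<and> \<not> 2 * int (2 * p) dvd lift g j + lift g i"
          by simp
      qed
    qed
    moreover have "4 * int p dvd ?e g k + ?e g (2 * m + 1 - k) + 2 * int p" if k: "k \<in> {1..2 * m}" for k
    proof -
      have k': "2 * m + 1 - k \<in> {1..2 * m}" using k by auto
      have "lift g k + lift g (2 * m + 1 - k) = 2 * int p"
        using k by (auto simp: lift_def)
      then have "4 * int p dvd lift g k + lift g (2 * m + 1 - k) + 2 * int p" by simp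
      then show ?thesis
        unfolding e[OF k] e[OF k'] dvd_eq_mod_eq_0 by (metis mod_add_eq mod_add_left_eq)
    qed
    ultimately show ?thesis by simp
  qed
  have re: "?r (?e g) = g" if g: "g \<in> ?G" for g
  proof (rule PiE_ext[OF sign_distinctD(1)[OF rY[OF eG[OF g]]] sign_distinctD(1)[OF g]])
    fix k assume k: "k \<in> {1..m}"
    then have k': "k \<in> {1..2 * m}" by auto
    have "?r (?e g) k = ?e g k" using k by (simp only: restrict_apply if_True)
    also have "\<dots> = g k mod (4 * int p)" unfolding e[OF k'] using k by (simp add: lift_def)
    also have "\<dots> = g k" using PiE_mem[OF sign_distinctD(1)[OF g] k] by simp
    finally show "?r (?e g) k = g k" .
  qed
  have er: "?e (?r y) = y" if y: "y \<in> ?Y" for y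
  proof (rule PiE_ext[OF sign_distinctD(1)[OF Y(1)[OF eG[OF rY[OF y]]]] sign_distinctD(1)[OF Y(1)[OF y]]])
    fix k assume k: "k \<in> {1..2 * m}"
    have yk: "y k mod (4 * int p) = y k"
      using PiE_mem[OF sign_distinctD(1)[OF Y(1)[OF y]] k] by simp
    have "lift (?r y) k mod (4 * int p) = y k mod (4 * int p)"
    proof (cases "k \<le> m")
      case True
      then show ?thesis using k by (simp add: lift_def)
    next
      case False
      then have k': "2 * m + 1 - k \<in> {1..m}" using k by auto
      have a: "lift (?r y) k = 2 * int p - ?r y (2 * m + 1 - k)" using False by (simp only: lift_def if_False)
      have b: "?r y (2 * m + 1 - k) = y (2 * m + 1 - k)" using k' by (simp only: restrict_apply if_True)
      have "lift (?r y) k - y k = - (y k + y (2 * m + 1 - k) + 2 * int p) + 4 * int p"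
        unfolding a b by simp
      then have "4 * int p dvd lift (?r y) k - y k"
        using Y(2)[OF y k] by (simp only: dvd_add_left_iff dvd_refl dvd_minus_iff)
      then show ?thesis by (simp only: mod_eq_dvd_iff)
    qed
    then show "?e (?r y) k = y k" unfolding e[OF k] yk .
  qed
  show ?thesis
    by (rule bij_betw_byWitness[where f' = ?e]) (use re er rY eG in blast)+
qed

lemma chi_omega_even:
  assumes q: "q = 2 * p" "p > 0" and l: "CARD('n::{finite,linorder}) = 2 * m"
  shows "2 * int (chi q (omega CARD('n) :: (real, 'n) vec \<Rightarrow> _)) =
    (if odd p then 2 * (\<Prod>i<m. int q - 2 - 4 * int i)
     else 2 * (\<Prod>i=1..m - 1. int q - 4 * int i) * (int q - int CARD('n)))"
proof -
  have m: "m > 0" using l by (metis finite_UNIV_card_ge_0 finite mult_is_0 not_gr_zero)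
  have "q > 0" "even CARD('n)" using q l by simp_all
  then have "2 * chi q (omega CARD('n) :: (real, 'n) vec \<Rightarrow> _) =
     card {y \<in> sign_distinct_functions (2 * int p) 1 {1..2 * m}.
        \<forall>k\<in>{1..2 * m}. 4 * int p dvd y k + y (2 * m + 1 - k) + 2 * int p}"
    using twice_chi_omega[where 'n='n, of q] unfolding l by (simp add: q)
  also have "\<dots> = card (sign_distinct_functions (int p) 2 {1..m})"
    by (rule bij_betw_same_card[OF sign_distinct_fold[OF q(2)]])
  finally have "2 * int (chi q (omega CARD('n) :: (real, 'n) vec \<Rightarrow> _))
      = int (card (sign_distinct_functions (int p) 2 {1..m}))" by linarith
  also have "\<dots> = (if odd (int p) then 2 * (\<Prod>i<card {1..m}. 2 * (int p - 1) - 2 * 2 * int i)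
      else 2 * (\<Prod>i=1..card {1..m} - 1. 2 * int p - 2 * 2 * int i) * (2 * int p - 2 * int (card {1..m})))"
    by (rule card_sign_distinct_functions) (use q m in auto)
  finally show ?thesis by (simp add: q l algebra_simps)
qed

section \<open>The alcove and its stabilizer\<close>

text \<open>
The combinations of simple roots by which the definition of the highest root compares roots.
\<close>

definition simple_cone :: "(real ^ 'n::{finite,linorder}) set" where
  "simple_cone = {x. \<exists>c :: nat \<Rightarrow> nat. x = (\<Sum>i=1..CARD('n). real (c i) *\<^sub>R simple_root i)}"

lemma simple_cone_add:
  fixes x y :: "real ^ 'n::{finite,linorder}"
  assumes "x \<in> simple_cone" "y \<in> simple_cone"
  shows "x + y \<in> simple_cone"
proof -
  obtain c d :: "nat \<Rightarrow> nat" where "x = (\<Sum>i=1..CARD('n). real (c i) *\<^sub>R simple_root i)"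
    "y = (\<Sum>i=1..CARD('n). real (d i) *\<^sub>R simple_root i)"
    using assms unfolding simple_cone_def by blast
  then have "x + y = (\<Sum>i=1..CARD('n). real (c i + d i) *\<^sub>R simple_root i)"
    by (simp add: sum.distrib scaleR_add_left)
  then show ?thesis unfolding simple_cone_def
    by (intro CollectI exI[of _ "\<lambda>i. c i + d i"])
qed

lemma zero_in_simple_cone: "0 \<in> (simple_cone :: (real ^ 'n::{finite,linorder}) set)"
  unfolding simple_cone_def by (intro CollectI exI[of _ "\<lambda>_. 0"]) simp

lemma simple_root_in_simple_cone:
  assumes "i \<in> {1..CARD('n::{finite,linorder})}"
  shows "simple_root i \<in> (simple_cone :: (real, 'n) vec set)"
proof -
  have "(\<Sum>j=1..CARD('n). real (if j = i then 1 else 0) *\<^sub>R simple_root j)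
      = (\<Sum>j=1..CARD('n). if j = i then simple_root j else (0 :: (real, 'n) vec))"
    by (intro sum.cong) auto
  also have "\<dots> = simple_root i" using assms by simp
  finally show ?thesis unfolding simple_cone_def
    by (intro CollectI exI[of _ "\<lambda>j. if j = i then 1 else 0"]) (rule sym)
qed

lemma simple_cone_ee_diff:
  assumes "1 \<le> i" "i \<le> k" "k \<le> CARD('n::{finite,linorder})"
  shows "ee i - ee k \<in> (simple_cone :: (real, 'n) vec set)"
  using assms(2,3)
proof (induction k rule: dec_induct)
  case base
  show ?case using zero_in_simple_cone by simp
next
  case (step k)
  have "simple_root k \<in> (simple_cone :: (real, 'n) vec set)"
    using step assms(1) by (intro simple_root_in_simple_cone) simp
  moreover have "simple_root k = (ee k - ee (Suc k) :: (real, 'n) vec)"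
    using step by (simp add: simple_root_def)
  ultimately have "(ee i - ee k) + (ee k - ee (Suc k)) \<in> (simple_cone :: (real, 'n) vec set)"
    using step by (intro simple_cone_add) auto
  then show ?case by simp
qed

lemma simple_cone_ee_sum:
  assumes "i \<in> {1..CARD('n::{finite,linorder})}" "k \<in> {1..CARD('n)}"
  shows "ee i + ee k \<in> (simple_cone :: (real, 'n) vec set)"
proof -
  have "simple_root CARD('n) \<in> (simple_cone :: (real, 'n) vec set)"
    by (intro simple_root_in_simple_cone) (simp add: Suc_leI)
  then have "2 *\<^sub>R ee CARD('n) \<in> (simple_cone :: (real, 'n) vec set)" by (simp add: simple_root_def)
  then have "(ee i - ee CARD('n)) + (ee k - ee CARD('n)) + 2 *\<^sub>R ee CARD('n) \<in> (simple_cone :: (real, 'n) vec set)"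
    using assms by (intro simple_cone_add simple_cone_ee_diff) auto
  moreover have "(ee i - ee CARD('n)) + (ee k - ee CARD('n)) + 2 *\<^sub>R ee CARD('n) = (ee i + ee k :: (real, 'n) vec)"
    by (simp add: scaleR_2)
  ultimately show ?thesis by (simp only:)
qed

text \<open>
Simple roots have positive height. So the cone contains no pair of opposite nonzero vectors, which
makes the highest root unique.
\<close>

lemma height_simple_cone:
  fixes x :: "real ^ 'n::{finite,linorder}"
  assumes "x \<in> simple_cone"
  shows "0 \<le> height_vector \<bullet> x" "height_vector \<bullet> x = 0 \<Longrightarrow> x = 0"
proof -
  obtain c :: "nat \<Rightarrow> nat" where x: "x = (\<Sum>i=1..CARD('n). real (c i) *\<^sub>R simple_root i)"
    using assms unfolding simple_cone_def by blast
  have h: "height_vector \<bullet> x = (\<Sum>i=1..CARD('n). real (c i) * (height_vector \<bullet> (simple_root i :: (real, 'n) vec)))"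
    unfolding x by (simp add: inner_sum_right)
  have nonneg: "0 \<le> real (c i) * (height_vector \<bullet> (simple_root i :: (real, 'n) vec))"
    if "i \<in> {1..CARD('n)}" for i
    using height_simple_root[OF that] by simp
  then show "0 \<le> height_vector \<bullet> x" unfolding h by (rule sum_nonneg)
  assume "height_vector \<bullet> x = 0"
  then have "\<forall>i\<in>{1..CARD('n)}. real (c i) * (height_vector \<bullet> (simple_root i :: (real, 'n) vec)) = 0"
    unfolding h using nonneg by (subst (asm) sum_nonneg_eq_0_iff) auto
  then have "c i = 0" if "i \<in> {1..CARD('n)}" for i
    using that height_simple_root[OF that] by auto
  then show "x = 0" unfolding x by simp
qed

text \<open>
For existence, \<open>2 e\<^sub>1 - (\<plusminus>e\<^sub>i \<plusminus> e\<^sub>k)\<close> splits as \<open>(e\<^sub>1 \<mp> e\<^sub>i) + (e\<^sub>1 \<mp> e\<^sub>k)\<close>, and each summand lies in the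
cone.
\<close>

lemma highest_root_eq: "highest_root = (2 *\<^sub>R ee 1 :: real ^ 'n::{finite,linorder})"
proof -
  have 1: "(1::nat) \<in> {1..CARD('n)}" by (simp add: Suc_leI)
  have hi: "(2 *\<^sub>R ee 1 :: (real, 'n) vec) \<in> roots"
    using double_in_roots[OF 1, of 1] by simp
  have part: "ee 1 - a *\<^sub>R ee i \<in> (simple_cone :: (real, 'n) vec set)" if "i \<in> {1..CARD('n)}" "a \<in> {1, -1}" for a i
    using that(2) simple_cone_ee_diff[where 'n='n, of 1 i] simple_cone_ee_sum[OF 1 that(1)] that(1) by auto
  have dom: "2 *\<^sub>R ee 1 - \<beta> \<in> simple_cone" if "\<beta> \<in> roots" for \<beta> :: "(real, 'n) vec"
    using that
  proof (cases rule: rootE)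
    case (pair a b i k)
    have "(ee 1 - a *\<^sub>R ee i) + (ee 1 - b *\<^sub>R ee k) \<in> (simple_cone :: (real, 'n) vec set)"
      by (intro simple_cone_add part pair)
    moreover have "(ee 1 - a *\<^sub>R ee i) + (ee 1 - b *\<^sub>R ee k) = 2 *\<^sub>R ee 1 - \<beta>"
      unfolding pair(1) by (simp add: scaleR_2)
    ultimately show ?thesis by (simp only:)
  next
    case (double a k)
    have "(ee 1 - a *\<^sub>R ee k) + (ee 1 - a *\<^sub>R ee k) \<in> (simple_cone :: (real, 'n) vec set)"
      by (intro simple_cone_add part double)
    moreover have "(ee 1 - a *\<^sub>R ee k) + (ee 1 - a *\<^sub>R ee k) = 2 *\<^sub>R ee 1 - \<beta>"
      unfolding double(1) by (simp add: scaleR_2 scaleR_add_right)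
    ultimately show ?thesis by (simp only:)
  qed
  have def: "highest_root = (THE \<alpha> :: (real, 'n) vec. \<alpha> \<in> roots \<and> (\<forall>\<beta>\<in>roots. \<alpha> - \<beta> \<in> simple_cone))"
    unfolding highest_root_def simple_cone_def mem_Collect_eq by (rule refl)
  show ?thesis
    unfolding def
  proof (rule the_equality)
    show "2 *\<^sub>R ee 1 \<in> (roots :: (real, 'n) vec set) \<and> (\<forall>\<beta>\<in>roots. 2 *\<^sub>R ee 1 - \<beta> \<in> (simple_cone :: (real, 'n) vec set))"
      by (intro conjI ballI hi dom)
    fix \<alpha> :: "(real, 'n) vec" assume \<alpha>: "\<alpha> \<in> roots \<and> (\<forall>\<beta>\<in>roots. \<alpha> - \<beta> \<in> simple_cone)"
    then have c: "\<alpha> - 2 *\<^sub>R ee 1 \<in> simple_cone" "2 *\<^sub>R ee 1 - \<alpha> \<in> simple_cone" using hi dom by blast+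
    have "height_vector \<bullet> (\<alpha> - 2 *\<^sub>R ee 1) = 0"
      using height_simple_cone(1)[OF c(1)] height_simple_cone(1)[OF c(2)] by (simp add: inner_diff_right)
    then have "\<alpha> - 2 *\<^sub>R ee 1 = 0" by (rule height_simple_cone(2)[OF c(1)])
    then show "\<alpha> = 2 *\<^sub>R ee 1" by simp
  qed
qed

lemma fundamental_alcove_iff:
  fixes x :: "real ^ 'n::{finite,linorder}"
  shows "x \<in> fundamental_alcove \<longleftrightarrow> (\<forall>i\<in>{1..<CARD('n)}. ee (i + 1) \<bullet> x < ee i \<bullet> x) \<and>
     0 < ee CARD('n) \<bullet> x \<and> ee 1 \<bullet> x < 1/2"
proof -
  have "{1..CARD('n)} = insert CARD('n) {1..<CARD('n)}"
    by (auto simp: Suc_leI)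
  then have "(\<forall>i\<in>{1..CARD('n)}. simple_root i \<bullet> x > 0) \<longleftrightarrow>
     simple_root CARD('n) \<bullet> x > 0 \<and> (\<forall>i\<in>{1..<CARD('n)}. simple_root i \<bullet> x > 0)" by simp
  also have "\<dots> \<longleftrightarrow> 0 < ee CARD('n) \<bullet> x \<and> (\<forall>i\<in>{1..<CARD('n)}. ee (i + 1) \<bullet> x < ee i \<bullet> x)"
    by (auto simp: simple_root_def inner_diff_left)
  finally show ?thesis
    unfolding fundamental_alcove_def highest_root_eq by auto
qed

lemma fundamental_alcove_bounds:
  fixes x :: "real ^ 'n::{finite,linorder}"
  assumes x: "x \<in> fundamental_alcove" and i: "i \<in> {1..CARD('n)}"
  shows "0 < ee i \<bullet> x" "ee i \<bullet> x < 1/2"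
proof -
  have dec: "ee (k + 1) \<bullet> x < ee k \<bullet> x" if "k \<in> {1..<CARD('n)}" for k
    using x that unfolding fundamental_alcove_iff by blast
  have ends: "0 < ee CARD('n) \<bullet> x" "ee 1 \<bullet> x < 1/2"
    using x unfolding fundamental_alcove_iff by blast+
  have "i \<le> CARD('n)" "1 \<le> i" using i by auto
  then show "0 < ee i \<bullet> x"
  proof (induction i rule: inc_induct)
    case base
    show ?case by (rule ends)
  next
    case (step k)
    then show ?case using dec[of k] by simp
  qed
  from \<open>1 \<le> i\<close> \<open>i \<le> CARD('n)\<close> show "ee i \<bullet> x < 1/2"
  proof (induction i rule: dec_induct)
    case base
    show ?case by (rule ends)
  next
    case (step k)
    then show ?case using dec[of k] by simp
  qed
qed

lemma coweight_coset_eq_iff: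
  "x +o coweight_lattice = y +o coweight_lattice \<longleftrightarrow> x - y \<in> (coweight_lattice :: (real ^ 'n::{finite,linorder}) set)"
  by (rule coset_eq_iff[OF coweight_lattice_diff(1)]) (rule coweight_lattice_diff(2))

lemma reverse_coords_involution: "reverse_coords (reverse_coords x) = (x :: real ^ 'n::{finite,linorder})"
proof (rule eqI_ee)
  fix k assume k: "k \<in> {1..CARD('n)}"
  then have k': "CARD('n) + 1 - k \<in> {1..CARD('n)}" "CARD('n) + 1 - (CARD('n) + 1 - k) = k" by auto
  show "ee k \<bullet> reverse_coords (reverse_coords x) = ee k \<bullet> x"
    unfolding ee_reverse_coords[OF k] ee_reverse_coords[OF k'(1)] k'(2) ..
qed

lemma reverse_coords_minus: "reverse_coords (- x) = - (reverse_coords x :: real ^ 'n::{finite,linorder})"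
  by (rule linear_neg[OF signed_permutation_linear[OF signed_permutation_reverse_coords]])

text \<open>
A single point \<open>x\<^sub>0\<close> suffices. Let \<open>w x\<^sub>0\<close> be congruent to an alcove point \<open>y\<close>. The coordinates of \<open>w x\<^sub>0\<close>
have absolute value below \<open>1/2\<close> and those of \<open>y\<close> lie between \<open>0\<close> and \<open>1/2\<close>, so the coweight \<open>w x\<^sub>0 - y\<close> is
either \<open>0\<close> or \<open>(-1/2, ..., -1/2)\<close>. In both cases the coordinates of \<open>w x\<^sub>0\<close> decrease and have constant sign. Up to a factor
they are the heights of the images of the basis vectors under the inverse of \<open>w\<close>, which is therefore
known.
\<close>

lemma alcove_stabilizer_subset:
  fixes w :: "real ^ 'n::{finite,linorder} \<Rightarrow> real ^ 'n::{finite,linorder}"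
  assumes w: "w \<in> alcove_stabilizer"
  shows "w = id \<or> w = omega CARD('n)"
proof -
  let ?l = "CARD('n)"
  let ?Z = "coweight_lattice :: (real, 'n) vec set"
  \<comment> \<open>With a multiple of \<open>height_vector\<close>, the coordinates of \<open>w x0\<close> are heights of images of basis vectors.\<close>
  define x0 :: "(real, 'n) vec" where "x0 = (1 / (2 * (real ?l + 1))) *\<^sub>R height_vector"
  have wW: "w \<in> weyl_group" and im: "coset_action ?Z w ` alcove_image = alcove_image"
    using w unfolding alcove_stabilizer_def by blast+
  obtain v where v: "v \<in> refl_group roots" and wv: "w \<circ> v = id" and vw: "v \<circ> w = id"
    using wW unfolding weyl_group_def by (rule refl_group_inverse)
  have sv: "signed_permutation v" by (rule refl_group_signed_permutation[OF v]) simp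
  have sw: "signed_permutation w"
    using wW unfolding weyl_group_def by (rule refl_group_signed_permutation) simp
  have x0: "ee i \<bullet> x0 = (real ?l + 1 - real i) / (2 * (real ?l + 1))" if "i \<in> {1..?l}" for i
    unfolding x0_def using height_ee[OF that] by (simp add: inner_commute)
  have "x0 \<in> fundamental_alcove"
    unfolding fundamental_alcove_iff
  proof (intro conjI ballI)
    fix i assume "i \<in> {1..<?l}"
    then have "ee (i + 1) \<bullet> x0 = (real ?l + 1 - real (i + 1)) / (2 * (real ?l + 1))"
      "ee i \<bullet> x0 = (real ?l + 1 - real i) / (2 * (real ?l + 1))"
      using x0[of "i + 1"] x0[of i] by simp_all
    then show "ee (i + 1) \<bullet> x0 < ee i \<bullet> x0" by (simp add: divide_strict_right_mono)
  next
    have 1: "?l \<in> {1..?l}" "1 \<in> {1..?l}" by (simp_all add: Suc_leI)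
    show "0 < ee ?l \<bullet> x0" using x0[OF 1(1)] by simp
    show "ee 1 \<bullet> x0 < 1/2"
    proof -
      have "(real ?l + 1 - real 1) / (2 * (real ?l + 1)) < 1/2"
        by (simp add: divide_less_eq)
      then show ?thesis using x0[OF 1(2)] by simp
    qed
  qed
  then have "x0 +o ?Z \<in> alcove_image" unfolding alcove_image_def by (rule imageI)
  then have "coset_action ?Z w (x0 +o ?Z) \<in> coset_action ?Z w ` alcove_image" by (rule imageI)
  then have "coset_action ?Z w (x0 +o ?Z) \<in> alcove_image" unfolding im .
  then have "w x0 +o ?Z \<in> alcove_image" unfolding coset_action_coweight[OF wW] .
  then obtain y where y: "y \<in> fundamental_alcove" and "w x0 +o ?Z = y +o ?Z"
    unfolding alcove_image_def by blast
  then have "w x0 - y \<in> ?Z" unfolding coweight_coset_eq_iff by blast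
  then obtain z where z: "w x0 - y = half_vector z" and par: "equal_parity ?l z"
    unfolding coweight_lattice_eq by blast
  have f: "ee i \<bullet> w x0 = (height_vector \<bullet> v (ee i)) / (2 * (real ?l + 1))" for i
  proof -
    have "ee i \<bullet> w x0 = w (v (ee i)) \<bullet> w x0" using wv by (metis comp_apply id_apply)
    also have "\<dots> = v (ee i) \<bullet> x0" by (rule signed_permutation_inner[OF sw])
    finally show ?thesis unfolding x0_def by (simp add: inner_commute)
  qed
  have bound: "\<bar>ee i \<bullet> w x0\<bar> < 1/2" if i: "i \<in> {1..?l}" for i
  proof -
    obtain g where g: "height_vector \<bullet> v (ee i) = real_of_int g" "\<bar>g\<bar> \<in> {1..int ?l}"
      by (rule signed_permutation_height[OF sv i])
    then have "\<bar>g\<bar> < int (?l + 1)" by simp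
    then have "\<bar>real_of_int g\<bar> < real ?l + 1" by linarith
    then show ?thesis unfolding f g(1) by (simp add: abs_divide field_simps)
  qed
  have diff: "ee i \<bullet> w x0 - ee i \<bullet> y = real_of_int (z i) / 2" if i: "i \<in> {1..?l}" for i
    using ee_half_vector[OF i, of z] unfolding z[symmetric] by (simp add: inner_diff_right)
  have zi: "z i = 0 \<or> z i = -1" if i: "i \<in> {1..?l}" for i
  proof -
    have "-1 < real_of_int (z i) / 2" "real_of_int (z i) / 2 < 1/2"
      using diff[OF i] bound[OF i] fundamental_alcove_bounds[OF y i] by linarith+
    then show ?thesis by linarith
  qed
  have dec: "height_vector \<bullet> v (ee (i + 1)) < height_vector \<bullet> v (ee i)" if i: "i \<in> {1..<?l}" for i
  proof -
    have i': "i \<in> {1..?l}" "i + 1 \<in> {1..?l}" using i by auto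
    have "z (i + 1) mod 2 = z i mod 2" using par i' unfolding equal_parity_def by blast
    then have "z (i + 1) = z i" using zi[OF i'(1)] zi[OF i'(2)] by auto
    moreover have "ee (i + 1) \<bullet> y < ee i \<bullet> y" using y i unfolding fundamental_alcove_iff by blast
    ultimately have "ee (i + 1) \<bullet> w x0 < ee i \<bullet> w x0"
      using diff[OF i'(1)] diff[OF i'(2)] by simp
    then show ?thesis unfolding f by (simp add: divide_less_cancel)
  qed
  have 1: "1 \<in> {1..?l}" by (simp add: Suc_leI)
  \<comment> \<open>The two possible values \<open>0\<close> and \<open>-1\<close> have different parity.\<close>
  have same: "z i = z 1" if i: "i \<in> {1..?l}" for i
  proof -
    have "z i mod 2 = z 1 mod 2" using par i 1 unfolding equal_parity_def by blast
    then show ?thesis using zi[OF i] zi[OF 1] by auto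
  qed
  from zi[OF 1] show ?thesis
  proof
    assume z1: "z 1 = 0"
    have "0 < height_vector \<bullet> v (ee i)" if i: "i \<in> {1..?l}" for i
    proof -
      have "0 < ee i \<bullet> w x0"
        using diff[OF i] same[OF i] z1 fundamental_alcove_bounds(1)[OF y i] by simp
      then show ?thesis unfolding f by (simp add: zero_less_divide_iff)
    qed
    then have "v = id" using dec by (intro decreasing_signed_permutation[OF sv])
    then have "w = id" using wv by simp
    then show ?thesis ..
  next
    assume z1: "z 1 = -1"
    have "0 < height_vector \<bullet> - v (ee i)" if i: "i \<in> {1..?l}" for i
    proof -
      have "ee i \<bullet> w x0 < 0"
        using diff[OF i] same[OF i] z1 fundamental_alcove_bounds(2)[OF y i] by simp
      then show ?thesis unfolding f by (simp add: divide_less_0_iff)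
    qed
    moreover have "height_vector \<bullet> - v (ee i) < height_vector \<bullet> - v (ee (i + 1))" if "i \<in> {1..<?l}" for i
      using dec[OF that] by simp
    ultimately have "(\<lambda>x. - v x) = reverse_coords"
      by (intro increasing_signed_permutation[OF signed_permutation_uminus[OF sv]])
    then have v_eq: "v x = - reverse_coords x" for x by (metis minus_minus)
    have "w x = reverse_coords (- x)" for x
    proof -
      have "v (reverse_coords (- x)) = x" unfolding v_eq reverse_coords_minus by (simp add: reverse_coords_involution reverse_coords_minus)
      then show ?thesis using wv by (metis comp_apply id_apply)
    qed
    then have "w = omega ?l" unfolding omega_eq(1) by (rule ext)
    then show ?thesis ..
  qed
qed

lemma id_in_alcove_stabilizer: "id \<in> (alcove_stabilizer :: (real ^ 'n::{finite,linorder} \<Rightarrow> _) set)"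
proof -
  have w: "id \<in> (weyl_group :: ((real, 'n) vec \<Rightarrow> _) set)"
    unfolding weyl_group_def by (rule id_in_refl_group)
  have "coset_action coweight_lattice id (x +o coweight_lattice) = x +o coweight_lattice" for x :: "(real, 'n) vec"
    using coset_action_coweight[OF w, of x] by (simp only: id_apply)
  then have "coset_action coweight_lattice id ` alcove_image = (alcove_image :: (real, 'n) vec set set)"
    unfolding alcove_image_def by (simp only: image_image)
  then show ?thesis unfolding alcove_stabilizer_def using w by blast
qed

text \<open>
Translating by the coweight \<open>(1/2, ..., 1/2)\<close> turns \<open>x \<mapsto> -(x\<^sub>l, ..., x\<^sub>1)\<close> into an involution of the
alcove itself.
\<close>

lemma omega_in_alcove_stabilizer:
  "omega CARD('n) \<in> (alcove_stabilizer :: (real ^ 'n::{finite,linorder} \<Rightarrow> _) set)"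
proof -
  let ?Z = "coweight_lattice :: (real, 'n) vec set" and ?w = "omega CARD('n) :: (real, 'n) vec \<Rightarrow> _"
  define h :: "(real, 'n) vec" where "h = half_vector (\<lambda>_. 1)"
  define \<phi> where "\<phi> x = h + reverse_coords (- x)" for x
  have h: "h \<in> ?Z"
    unfolding coweight_lattice_eq h_def by (intro imageI CollectI) (simp add: equal_parity_def)
  have ee_\<phi>: "ee k \<bullet> \<phi> x = 1/2 - ee (CARD('n) + 1 - k) \<bullet> x" if k: "k \<in> {1..CARD('n)}" for k x
    unfolding \<phi>_def h_def inner_add_right ee_half_vector[OF k] ee_reverse_coords[OF k] by simp
  have \<phi>\<phi>: "\<phi> (\<phi> x) = x" for x
  proof (rule eqI_ee)
    fix k assume k: "k \<in> {1..CARD('n)}"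
    then have k': "CARD('n) + 1 - k \<in> {1..CARD('n)}" "CARD('n) + 1 - (CARD('n) + 1 - k) = k" by auto
    show "ee k \<bullet> \<phi> (\<phi> x) = ee k \<bullet> x" unfolding ee_\<phi>[OF k] ee_\<phi>[OF k'(1)] k'(2) by simp
  qed
  have \<phi>A: "\<phi> x \<in> fundamental_alcove" if x: "x \<in> fundamental_alcove" for x :: "(real, 'n) vec"
    unfolding fundamental_alcove_iff
  proof (intro conjI ballI)
    fix i assume i: "i \<in> {1..<CARD('n)}"
    then have i': "i \<in> {1..CARD('n)}" "i + 1 \<in> {1..CARD('n)}" "CARD('n) - i \<in> {1..<CARD('n)}"
      "CARD('n) + 1 - i = CARD('n) - i + 1" "CARD('n) + 1 - (i + 1) = CARD('n) - i" by auto
    have "ee (CARD('n) - i + 1) \<bullet> x < ee (CARD('n) - i) \<bullet> x"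
      using x i'(3) unfolding fundamental_alcove_iff by blast
    then show "ee (i + 1) \<bullet> \<phi> x < ee i \<bullet> \<phi> x"
      unfolding ee_\<phi>[OF i'(1)] ee_\<phi>[OF i'(2)] i'(4,5) by simp
  next
    have 1: "1 \<in> {1..CARD('n)}" "CARD('n) \<in> {1..CARD('n)}" by (simp_all add: Suc_leI)
    show "0 < ee CARD('n) \<bullet> \<phi> x" "ee 1 \<bullet> \<phi> x < 1/2"
      unfolding ee_\<phi>[OF 1(1)] ee_\<phi>[OF 1(2)]
      using fundamental_alcove_bounds[OF x 1(1)] fundamental_alcove_bounds[OF x 1(2)] by simp_all
  qed
  have \<phi>_image: "\<phi> ` fundamental_alcove = fundamental_alcove"
  proof (intro equalityI subsetI)
    fix x :: "(real, 'n) vec" assume "x \<in> fundamental_alcove"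
    then show "x \<in> \<phi> ` fundamental_alcove" by (intro image_eqI[where x = "\<phi> x"] \<phi>A) (rule \<phi>\<phi>[symmetric])
  next
    fix y assume "y \<in> \<phi> ` fundamental_alcove"
    then obtain x where "y = \<phi> x" "x \<in> fundamental_alcove" by (rule imageE)
    then show "y \<in> fundamental_alcove" by (simp only: \<phi>A)
  qed
  have "coset_action ?Z ?w (x +o ?Z) = \<phi> x +o ?Z" for x
  proof -
    have "coset_action ?Z ?w (x +o ?Z) = ?w x +o ?Z" by (rule coset_action_coweight[OF omega_eq(2)])
    also have "\<dots> = reverse_coords (- x) +o ?Z" unfolding omega_eq(1) ..
    also have "\<dots> = \<phi> x +o ?Z"
    proof -
      have "\<phi> x - reverse_coords (- x) \<in> ?Z" unfolding \<phi>_def using h by simp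
      then show ?thesis by (rule coweight_coset_eq_iff[THEN iffD2, symmetric])
    qed
    finally show ?thesis .
  qed
  then have "coset_action ?Z ?w ` alcove_image = (\<lambda>x. x +o ?Z) ` \<phi> ` fundamental_alcove"
    unfolding alcove_image_def by (simp only: image_image)
  also have "\<dots> = alcove_image" unfolding \<phi>_image alcove_image_def ..
  finally show ?thesis unfolding alcove_stabilizer_def using omega_eq(2) by blast
qed

section \<open>The character values\<close>

theorem theorem5p5:
  fixes \<omega> :: "real ^ 'n::{finite,linorder} \<Rightarrow> real ^ 'n::{finite,linorder}" and l q :: nat
  assumes "l = CARD('n)" and "l \<ge> 4" and "even l"
    and "\<omega> \<in> alcove_stabilizer"
    and "q > 0"
  shows "(alcove_stabilizer :: ((real, 'n) vec \<Rightarrow> (real, 'n) vec) set) = {id, omega l} \<and>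
    (\<omega> = id \<and> odd q \<longrightarrow>
       int (chi q \<omega>) = (\<Prod>i = 1..l. int q - (2 * int i - 1))) \<and>
    (\<omega> = id \<and> even q \<longrightarrow>
       int (chi q \<omega>) = (\<Prod>i = 1..l - 1. int q - 2 * int i) * (int q - int l)) \<and>
    (\<omega> = omega l \<and> gcd 4 q = 1 \<longrightarrow>
       int (chi q \<omega>) = 0) \<and>
    (\<omega> = omega l \<and> gcd 4 q = 2 \<longrightarrow>
       int (chi q \<omega>) = (\<Prod>i = 1..l div 2. int q - (4 * int i - 2))) \<and>
    (\<omega> = omega l \<and> gcd 4 q = 4 \<longrightarrow>
       int (chi q \<omega>) = (int q - int l) * (\<Prod>i = 1..l div 2 - 1. int q - 4 * int i))"
proof (intro conjI impI)
  note l = assms(1)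
  obtain m where m: "l = 2 * m" using \<open>even l\<close> by (elim evenE)
  have shift: "(\<Prod>i=1..n. f i) = (\<Prod>i<n. f (Suc i) :: int)" for n and f :: "nat \<Rightarrow> int"
    using prod.atLeast1_atMost_eq[of f n] by simp
  show "(alcove_stabilizer :: ((real, 'n) vec \<Rightarrow> (real, 'n) vec) set) = {id, omega l}"
    unfolding l using alcove_stabilizer_subset id_in_alcove_stabilizer omega_in_alcove_stabilizer by blast
  {
    assume "\<omega> = id \<and> odd q"
    then have "int (chi q \<omega>) = (\<Prod>i<l. int q - 1 - 2 * int i)"
      using chi_id[where 'n='n, OF \<open>q > 0\<close>] l by simp
    then show "int (chi q \<omega>) = (\<Prod>i = 1..l. int q - (2 * int i - 1))"
      unfolding shift by (simp add: algebra_simps)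
  next
    assume "\<omega> = id \<and> even q"
    then show "int (chi q \<omega>) = (\<Prod>i = 1..l - 1. int q - 2 * int i) * (int q - int l)"
      using chi_id[where 'n='n, OF \<open>q > 0\<close>] l by simp
  next
    assume *: "\<omega> = omega l \<and> gcd 4 q = 1"
    have "odd q"
    proof
      assume "even q"
      then have "2 dvd gcd 4 q" by simp
      then show False using * by simp
    qed
    then show "int (chi q \<omega>) = 0"
      using chi_omega_odd[where 'n='n, of q] * l \<open>even l\<close> by simp
  next
    assume *: "\<omega> = omega l \<and> gcd 4 q = 2"
    then have "2 dvd q" by (metis gcd_dvd2)
    then obtain p where p: "q = 2 * p" by (elim dvdE)
    have "odd p"
    proof
      assume "even p"
      then have "4 dvd q" unfolding p by (elim evenE) simp
      then have "4 dvd gcd 4 q" by simp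
      then show False using * by simp
    qed
    then have "int (chi q \<omega>) = (\<Prod>i<m. int q - 2 - 4 * int i)"
      using chi_omega_even[where 'n='n, OF p _ l[symmetric, unfolded m]] p * l \<open>q > 0\<close> by simp
    then show "int (chi q \<omega>) = (\<Prod>i = 1..l div 2. int q - (4 * int i - 2))"
      unfolding shift m by (simp add: algebra_simps)
  next
    assume *: "\<omega> = omega l \<and> gcd 4 q = 4"
    then have "4 dvd q" by (metis gcd_dvd2)
    then obtain s where s: "q = 4 * s" by (elim dvdE)
    then have p: "q = 2 * (2 * s)" by simp
    have "int (chi q \<omega>) = (\<Prod>i=1..m - 1. int q - 4 * int i) * (int q - int l)"
      using chi_omega_even[where 'n='n, OF p _ l[symmetric, unfolded m]] s * l \<open>q > 0\<close> by simp
    then show "int (chi q \<omega>) = (int q - int l) * (\<Prod>i = 1..l div 2 - 1. int q - 4 * int i)"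
      unfolding m by (simp add: mult.commute)
  }
qed

end
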